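(* Let $h:[0,\infty)\to[0,\infty)$ be right continuous, non-negative and increasing (in the sense of non-decreasing), with $h(r)\to 1$ as $r\to\infty$. Let $g$ denote the generalised inverse of $h$. If $\ln(g)\in L^p([0,1])$ for some $p>1$, then there exists a stopping time $\tau\in\mathcal{H}$ such that, for all $r\ge 0$, $$h(r)=h_\tau^0(r)=P_0(|Z_\tau|\le r).$$
   Context: Generalised inverse: $g(s)=\inf\{r\ge 0: h(r)\ge s\}$. Let $\mathbb{H}=\{z\in\mathbb{C}:\mathrm{Im}\, z>0\}$. For a planar Brownian motion $W$ started at a point of a domain $D\subset\mathbb{C}$, let $\tau_D$ be its first exit time from $D$. Given a nonconstant analytic function $f$ on $D$, set $$\sigma_t:=\int_0^{\tau_D\wedge t}|f'(W_s)|^2\,ds,\qquad C_t:=\sigma_t^{-1}\ \text{(inverse function of } t\mapsto\sigma_t).$$ By Lévy's theorem, $\hat W_t:=f(W_{C_t})$ is a planar Brownian motion on the random interval $[0,\sigma_{\tau_D}]$, and $\sigma_{\tau_D}$ is a stopping time for it (not necessarily the exit time of a domain). The class $\mathcal{H}$ consists of all stopping times $\tau$ of the form $\tau=\sigma_{\tau_{\mathbb{H}}}$, obtained in this way (with $D=\mathbb{H}$) from some nonconstant analytic $f$ on $\mathbb{H}$; replacing $\mathbb{H}$ by the unit disk $\mathbb{D}$ gives an equivalent definition, since the two are conformally equivalent. For such a $\tau$, the Brownian motion $Z$ that is stopped at $\tau$ is $\hat W$. It starts at $f(W_0)$, and its terminal value $Z_\tau$ is the limit of $f(W_s)$ as $s\uparrow\tau_{\mathbb{H}}$,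 when this exists almost surely. The $h$-function of $\tau$ with base point $z$ is $h_\tau^z(r):=P_z(|Z_\tau-z|\le r)$, where $P_z$ indicates that $Z$ starts at $z$ (that is, $f(W_0)=z$). *)

theory Defs
  imports "HOL-Probability.Probability" "HOL-Complex_Analysis.Complex_Analysis"
begin

definition gen_inverse :: "(real \<Rightarrow> real) \<Rightarrow> real \<Rightarrow> real" where
  "gen_inverse h s = Inf {r. 0 \<le> r \<and> s \<le> h r}"

text \<open>
  In HOL, \<open>ln 0 = 0\<close>, whereas here \<open>ln 0\<close> stands for minus infinity. A function
  that is infinite on a set of positive measure is not in \<open>L\<^sup>p\<close>, so the statement that
  \<open>ln u\<close> is in \<open>L\<^sup>p\<close> has to include that \<open>u\<close> is positive almost everywhere.
  (For \<open>u = gen_inverse h\<close> the infimum may be taken over the empty set at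
  \<open>s = 1\<close>; this single point does not affect the predicate.)
\<close>

definition ln_in_Lp :: "real \<Rightarrow> real set \<Rightarrow> (real \<Rightarrow> real) \<Rightarrow> bool" where
  "ln_in_Lp p A u \<longleftrightarrow>
     (AE s in lborel. s \<in> A \<longrightarrow> 0 < u s) \<and>
     set_borel_measurable lborel A (\<lambda>s. ln (u s)) \<and>
     set_integrable lborel A (\<lambda>s. \<bar>ln (u s)\<bar> powr p)"

text \<open>
  Processes are indexed by \<open>real\<close>, but only times \<open>t \<ge> 0\<close> matter. The second
  parameter of \<^const>\<open>normal_density\<close> is the standard deviation.
\<close>

definition linear_brownian_motion ::
  "'a measure \<Rightarrow> (real \<Rightarrow> 'a \<Rightarrow> real) \<Rightarrow> real \<Rightarrow> bool" where
  "linear_brownian_motion M X x \<longleftrightarrow>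
     prob_space M \<and>
     (\<forall>t\<ge>0. X t \<in> borel_measurable M) \<and>
     (\<forall>\<omega>\<in>space M. X 0 \<omega> = x) \<and>
     (\<forall>\<omega>\<in>space M. continuous_on {0..} (\<lambda>t. X t \<omega>)) \<and>
     (\<forall>s t. 0 \<le> s \<longrightarrow> s < t \<longrightarrow>
        distributed M lborel (\<lambda>\<omega>. X t \<omega> - X s \<omega>)
          (\<lambda>y. ennreal (normal_density 0 (sqrt (t - s)) y))) \<and>
     (\<forall>(n::nat) t. 0 \<le> t 0 \<longrightarrow> strict_mono_on {..n} t \<longrightarrow>
        prob_space.indep_vars M (\<lambda>_. borel)
          (\<lambda>i \<omega>. X (t (Suc i)) \<omega> - X (t i) \<omega>) {..<n})"

definition planar_brownian_motion ::
  "'a measure \<Rightarrow> (real \<Rightarrow> 'a \<Rightarrow> complex) \<Rightarrow> complex \<Rightarrow> bool" where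
  "planar_brownian_motion M W z \<longleftrightarrow>
     linear_brownian_motion M (\<lambda>t \<omega>. Re (W t \<omega>)) (Re z) \<and>
     linear_brownian_motion M (\<lambda>t \<omega>. Im (W t \<omega>)) (Im z) \<and>
     prob_space.indep_var M
       (PiM {0..} (\<lambda>_. borel)) (\<lambda>\<omega>. \<lambda>t\<in>{0..}. Re (W t \<omega>))
       (PiM {0..} (\<lambda>_. borel)) (\<lambda>\<omega>. \<lambda>t\<in>{0..}. Im (W t \<omega>))"

definition upper_half_plane :: "complex set" where
  "upper_half_plane = {z. 0 < Im z}"

text \<open>The following functionals act on a single path \<open>w\<close>.\<close>

definition exit_time :: "complex set \<Rightarrow> (real \<Rightarrow> complex) \<Rightarrow> ereal" where
  "exit_time D w = Inf (ereal ` {t. 0 \<le> t \<and> w t \<notin> D})"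

text \<open>
  The clock \<open>\<sigma>\<^sub>t\<close>, for \<open>t\<close> in \<open>[0, \<infinity>]\<close>. The upper endpoint of the integration
  interval is left out, as \<open>f\<close> need not be defined at the exit point.
\<close>

definition clock ::
  "complex set \<Rightarrow> (complex \<Rightarrow> complex) \<Rightarrow> (real \<Rightarrow> complex) \<Rightarrow> ereal \<Rightarrow> ennreal" where
  "clock D f w t =
     (\<integral>\<^sup>+ s \<in> {s. 0 \<le> s \<and> ereal s < min (exit_time D w) t}.
        ennreal ((cmod (deriv f (w s)))\<^sup>2) \<partial>lborel)"

definition clock_inverse ::
  "complex set \<Rightarrow> (complex \<Rightarrow> complex) \<Rightarrow> (real \<Rightarrow> complex) \<Rightarrow> ennreal \<Rightarrow> real" where
  "clock_inverse D f w =
     the_inv_into {t. 0 \<le> t \<and> ereal t < exit_time D w} (\<lambda>t. clock D f w (ereal t))"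

definition stopping_time_of ::
  "complex set \<Rightarrow> (complex \<Rightarrow> complex) \<Rightarrow> (real \<Rightarrow> complex) \<Rightarrow> ennreal" where
  "stopping_time_of D f w = clock D f w (exit_time D w)"

definition has_terminal_value ::
  "complex set \<Rightarrow> (complex \<Rightarrow> complex) \<Rightarrow> (real \<Rightarrow> complex) \<Rightarrow> bool" where
  "has_terminal_value D f w \<longleftrightarrow>
     (\<exists>l. ((\<lambda>s. f (w (real_of_ereal s))) \<longlongrightarrow> l) (at_left (exit_time D w)))"

text \<open>
  The time-changed motion \<open>f(W\<^bsub>C\<^sub>t\<^esub>)\<close>, continued from its stopping time on by its terminal
  value. The left limit at the exit time is taken in \<^typ>\<open>ereal\<close>, so that it also makes
  sense for an infinite exit time.
\<close>

definition stopped_motion ::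
  "complex set \<Rightarrow> (complex \<Rightarrow> complex) \<Rightarrow> (real \<Rightarrow> complex) \<Rightarrow> ennreal \<Rightarrow> complex" where
  "stopped_motion D f w t =
     (if t < stopping_time_of D f w then f (w (clock_inverse D f w t))
      else Lim (at_left (exit_time D w)) (\<lambda>s. f (w (real_of_ereal s))))"

text \<open>
  An element \<open>\<tau>\<close> of the class \<open>\<H>\<close> is given by the analytic function
  \<open>f\<close> it is obtained from: with \<open>W\<close> a planar Brownian motion started in the upper
  half-plane \<open>H\<close>, it is \<open>stopping_time_of H f\<close> evaluated along the path of \<open>W\<close>,
  and the Brownian motion \<open>Z\<close> stopped at \<open>\<tau>\<close> is \<open>stopped_motion H f\<close>.
\<close>

definition generates_class_H :: "(complex \<Rightarrow> complex) \<Rightarrow> bool" where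
  "generates_class_H f \<longleftrightarrow>
     f analytic_on upper_half_plane \<and> \<not> f constant_on upper_half_plane"

definition h_function ::
  "'a measure \<Rightarrow> (real \<Rightarrow> 'a \<Rightarrow> complex) \<Rightarrow> (complex \<Rightarrow> complex) \<Rightarrow> complex \<Rightarrow> real \<Rightarrow> real" where
  "h_function M W f z r =
     measure M {\<omega> \<in> space M.
       (let w = (\<lambda>t. W t \<omega>); \<tau> = stopping_time_of upper_half_plane f w
        in cmod (stopped_motion upper_half_plane f w \<tau> - z) \<le> r)}"

end

theory Submission
  imports Defs "HOL-Real_Asymp.Real_Asymp"
begin

text \<open>
  Let \<open>\<psi> = ln g\<close> on \<open>(0, 1)\<close> and take \<open>f z = (z - \<i>) / (z + \<i>) * exp (F z)\<close>, where \<open>Re F\<close> has the boundary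
  values \<open>\<psi> (V x)\<close> with \<open>V\<close> the distribution function of the Cauchy law. Brownian motion from \<open>\<i>\<close> leaves the
  half-plane at a Cauchy distributed point \<open>x\<close>, so \<open>\<bar>f\<bar>\<close> ends at \<open>g (V x)\<close> with \<open>V x\<close>
  uniform, and \<open>g (V x) \<le> r\<close> iff \<open>V x \<le> h r\<close>.

  The only stochastic ingredient is the maximal inequality
  \<open>P (\<exists>s < \<tau>. Re F (W\<^sub>s) > c) \<le> Re F \<i> / c\<close> for analytic \<open>F\<close> with \<open>Re F \<ge> 0\<close>. Applied to
  \<open>-\<i> z\<close> it gives \<open>\<tau> < \<infinity>\<close>; applied to the harmonic measures of the two half-lines at a point, it bounds both tails of
  the exit law by the Cauchy tails, and as these bounds add up to 1, they are equalities; applied to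
  \<open>F / (c + F)\<close> it gives a weak type inequality for \<open>\<bar>F\<bar>\<close>. Since \<open>\<psi>\<close> is monotone, its positive and
  negative parts are increasing limits of dyadic step functions, whose analytic extensions are explicit and extend
  continuously to all but finitely many boundary points. By the weak type inequality their limits
  converge along almost every path as well.
\<close>

section \<open>Gaussian increments on a time grid\<close>

text \<open>\<open>f\<close> has to vanish at the starting point \<open>\<i>\<close>, whereas
  \<open>exp (F z)\<close> has no zeros. The factor \<open>(z - \<i>) / (z + \<i>)\<close> supplies
  the zero and has modulus 1 on the real axis, so it leaves the terminal modulus unchanged. A
  terminal value of \<open>f\<close> requires that \<open>F\<close> itself converge along the path,
  and \<open>Im F\<close> is a conjugate function that may be unbounded even where
  \<open>Re F\<close> is not; this is why a bound on \<open>\<bar>F\<bar>\<close> is needed. That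
  bound demands a nonnegative real part, hence monotone approximation, separately for the two parts
  of \<open>\<psi>\<close>.

  The maximal inequality rests on the fact that an isotropic Gaussian increment \<open>h\<close>
  satisfies \<open>E h = 0\<close> and \<open>E h^2 = 0\<close>: along a time grid an analytic
  function changes in mean only by the cubic Taylor remainder, which is summable when the grid is
  fine. Events that quantify over all times before the exit are handled through measurable covers
  throughout.\<close>

lemma open_upper_half_plane: "open upper_half_plane"
  unfolding upper_half_plane_def by (rule open_halfspace_Im_gt)

text \<open>For \<open>cmod h \<le> e/2\<close> this is Taylor's formula with Cauchy estimates on
  discs of radius \<open>e/2\<close>. A larger \<open>h\<close> may leave the half-plane; there
  every term is estimated by itself and absorbed into the cube because
  \<open>cmod h / e > 1/2\<close>. A cubic bound valid for all \<open>h\<close> is what Gaussian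
  increments of unbounded size require.\<close>

lemma taylor_cutoff_bound:
  fixes G :: "complex \<Rightarrow> complex"
  assumes hol: "G holomorphic_on upper_half_plane"
    and bd: "\<And>z. z \<in> upper_half_plane \<Longrightarrow> cmod (G z) \<le> B"
    and e: "0 < e" and z: "e < Im z"
  shows "cmod ((if z + h \<in> upper_half_plane then G (z + h) else 0)
     - (G z + deriv G z * h + deriv (deriv G) z * h\<^sup>2 / 2)) \<le> 32 * B * cmod h ^ 3 / e ^ 3"
proof -
  define D where "D n = (deriv ^^ n) G" for n
  have sub: "cball x (e/2) \<subseteq> upper_half_plane" if "dist z x \<le> e/2" for x
  proof
    fix y assume "y \<in> cball x (e/2)"
    then have "dist z y \<le> e" using that dist_triangle[of z y x] by simp
    then have "\<bar>Im (z - y)\<bar> \<le> e" using abs_Im_le_cmod[of "z - y"] by (simp add: dist_norm)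
    then show "y \<in> upper_half_plane" using z by (simp add: upper_half_plane_def)
  qed
  have B0: "0 \<le> B"
    using order_trans[OF norm_ge_zero bd[of z]] z e by (simp add: upper_half_plane_def)
  have cau: "cmod (D n x) \<le> fact n * B / (e/2) ^ n" if "dist z x \<le> e/2" for n x
    unfolding D_def
  proof (rule Cauchy_inequality)
    have "cball x (e/2) \<subseteq> upper_half_plane" by (rule sub[OF that])
    then show "G holomorphic_on ball x (e/2)" "continuous_on (cball x (e/2)) G"
      using hol ball_subset_cball by (meson holomorphic_on_subset holomorphic_on_imp_continuous_on order_trans)+
    show "cmod (G y) \<le> B" if "cmod (x - y) = e/2" for y
      using \<open>cball x (e/2) \<subseteq> _\<close> that by (intro bd) (auto simp: dist_norm)
  qed (use e in auto)
  show ?thesis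
  proof (cases "cmod h \<le> e/2")
    case True
    have inU: "z + h \<in> upper_half_plane" 
      using sub[of z] True e by (auto simp: dist_norm subset_iff)
    \<comment> \<open>The constant 48 is \<open>3! * 2^3\<close> from Cauchy's estimate of the third
      derivative; division by \<open>fact 2\<close> leaves 24.\<close>
    have "cmod (D 0 (z + h) - (\<Sum>i\<le>2. D i z * ((z + h) - z) ^ i / fact i))
        \<le> (48 * B / e ^ 3) * cmod ((z + h) - z) ^ (Suc 2) / fact 2"
    proof (rule complex_Taylor[where S = "cball z (e/2)"])
      show "(D i has_field_derivative D (Suc i) x) (at x within cball z (e / 2))"
        if "x \<in> cball z (e/2)" "i \<le> 2" for i x
      proof -
        have "x \<in> upper_half_plane" using sub[of z] that e by auto
        then have "(D i has_field_derivative deriv (D i) x) (at x)"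
          unfolding D_def using hol open_upper_half_plane
          by (meson holomorphic_derivI holomorphic_higher_deriv)
        then show ?thesis by (simp add: D_def has_field_derivative_at_within)
      qed
      show "cmod (D (Suc 2) x) \<le> 48 * B / e ^ 3" if "x \<in> cball z (e/2)" for x
        using cau[of x "Suc 2"] that by (simp add: fact_numeral power3_eq_cube field_simps)
    qed (use True e in \<open>auto simp: dist_norm\<close>)
    then have "cmod (G (z + h) - (G z + deriv G z * h + deriv (deriv G) z * h\<^sup>2 / 2))
        \<le> 24 * B * cmod h ^ 3 / e ^ 3"
      by (simp add: D_def eval_nat_numeral mult.assoc)
    also have "\<dots> \<le> 32 * B * cmod h ^ 3 / e ^ 3"
      using B0 e by (intro divide_right_mono mult_right_mono) auto
    finally show ?thesis using inU by simp
  next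
    case False
    define r where "r = cmod h / e"
    have r: "1/2 < r" "cmod h = r * e" using False e by (auto simp: r_def field_simps)
    \<comment> \<open>These absorb the lower powers of \<open>r > 1/2\<close> and produce the
      constant 2*8 + 2*4 + 4*2 = 32.\<close>
    have rr: "r * r \<le> 2 * r^3" "r \<le> 4 * r^3" "1 \<le> 8 * r^3"
    proof -
      have "1 * (r*r) \<le> (2*r) * (r*r)" using r by (intro mult_right_mono) auto
      then show 1: "r * r \<le> 2 * r^3" by (simp add: power3_eq_cube)
      have "1 * r \<le> (2*r) * r" using r by (intro mult_right_mono) auto
      with 1 show 2: "r \<le> 4 * r^3" by simp
      with r show "1 \<le> 8 * r^3" by simp
    qed
    have 0: "cmod (if z + h \<in> upper_half_plane then G (z + h) else 0) \<le> B" using bd B0 by auto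
    have 1: "cmod (G z) \<le> B" using cau[of z 0] e by (simp add: D_def)
    have "cmod (deriv G z) \<le> B / (e/2)" using cau[of z 1] e by (simp add: D_def)
    then have "cmod (deriv G z) * cmod h \<le> B / (e/2) * cmod h" by (intro mult_right_mono) auto
    also have "\<dots> = 2 * B * r" using e by (simp add: r)
    finally have 2: "cmod (deriv G z * h) \<le> 2 * B * r" by (simp add: norm_mult)
    have "cmod (deriv (deriv G) z) \<le> 2 * B / (e/2)^2" using cau[of z 2] e by (simp add: D_def numeral_2_eq_2)
    then have "cmod (deriv (deriv G) z) * (cmod h)^2 \<le> 2 * B / (e/2)^2 * (cmod h)^2" by (intro mult_right_mono) auto
    also have "\<dots> = 8 * B * (r*r)" using e by (simp add: r power2_eq_square)
    finally have 3: "cmod (deriv (deriv G) z * h\<^sup>2 / 2) \<le> 4 * B * (r*r)" by (simp add: norm_mult norm_divide norm_power)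
    have "cmod ((if z + h \<in> upper_half_plane then G (z + h) else 0)
     - (G z + deriv G z * h + deriv (deriv G) z * h\<^sup>2 / 2)) \<le> B + (B + 2 * B * r + 4 * B * (r*r))"
      by (intro order_trans[OF norm_triangle_ineq4] add_mono order_trans[OF norm_triangle_ineq] 0 1 2 3)
    also have "\<dots> = 2 * (B * 1) + 2 * (B * r) + 4 * (B * (r*r))" by (simp add: algebra_simps)
    also have "\<dots> \<le> 2 * (B * (8 * r^3)) + 2 * (B * (4 * r^3)) + 4 * (B * (2 * r^3))"
      using B0 rr by (intro add_mono mult_left_mono) auto
    also have "\<dots> = 32 * B * cmod h ^ 3 / e ^ 3" using e by (simp add: r power_mult_distrib)
    finally show ?thesis .
  qed
qed

text \<open>Events about the increments of one coordinate are preimages under its whole path.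
  Probabilities therefore split first over the two coordinates, by independence of the paths
  (\<open>cross\<close>), and then over the increments of each (\<open>prodb\<close>).\<close>

lemma planar_increments_indep:
  fixes N :: nat and d :: real
  assumes W: "planar_brownian_motion M W z0" and d: "0 < d"
  shows "prob_space.indep_vars M (\<lambda>_. borel)
     (\<lambda>(b, i) \<omega>. if b then Im (W (real (Suc i) * d) \<omega>) - Im (W (real i * d) \<omega>)
                  else Re (W (real (Suc i) * d) \<omega>) - Re (W (real i * d) \<omega>)) (UNIV \<times> {..<N})"
proof -
  define Z where "Z b i \<omega> = (if b then Im (W (real (Suc i) * d) \<omega>) - Im (W (real i * d) \<omega>)
                  else Re (W (real (Suc i) * d) \<omega>) - Re (W (real i * d) \<omega>))" for b i \<omega>
  have lbm: "linear_brownian_motion M (\<lambda>t \<omega>. Re (W t \<omega>)) (Re z0)"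
      "linear_brownian_motion M (\<lambda>t \<omega>. Im (W t \<omega>)) (Im z0)"
    using W by (auto simp: planar_brownian_motion_def)
  interpret prob_space M using lbm by (simp add: linear_brownian_motion_def)
  have ind: "indep_var
       (PiM {0..} (\<lambda>_. borel)) (\<lambda>\<omega>. \<lambda>t\<in>{0..}. Re (W t \<omega>))
       (PiM {0..} (\<lambda>_. borel)) (\<lambda>\<omega>. \<lambda>t\<in>{0..}. Im (W t \<omega>))"
    using W by (auto simp: planar_brownian_motion_def)
  have meas: "(\<lambda>\<omega>. Re (W t \<omega>)) \<in> borel_measurable M" "(\<lambda>\<omega>. Im (W t \<omega>)) \<in> borel_measurable M"
    if "0 \<le> t" for t
    using that lbm by (auto simp: linear_brownian_motion_def)
  have rv: "Z b i \<in> borel_measurable M" for b i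
    using d unfolding Z_def by (cases b) (auto intro!: borel_measurable_diff meas)
  have mono: "strict_mono_on {..N} (\<lambda>i. real i * d)"
    using d by (auto simp: strict_mono_on_def)
  have i1: "indep_vars (\<lambda>_. borel) (Z b) {..<N}" for b
    using lbm mono d unfolding linear_brownian_motion_def Z_def
    by (cases b) (auto dest!: spec[of _ N] spec[of _ "\<lambda>i. real i * d"])
  have prodb: "prob (\<Inter>i\<in>J. Z b i -` A i \<inter> space M) = (\<Prod>i\<in>J. prob (Z b i -` A i \<inter> space M))"
    if "J \<subseteq> {..<N}" "J \<noteq> {}" "\<And>i. i \<in> J \<Longrightarrow> A i \<in> sets borel" for b J A
    using that finite_subset[OF that(1)]
    by (intro indep_varsD_finite[where M' = "\<lambda>_. borel"] indep_vars_subset[OF i1]) auto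
  have cross: "prob ((\<Inter>i\<in>J. Z False i -` A i \<inter> space M) \<inter> (\<Inter>i\<in>K. Z True i -` B i \<inter> space M))
     = prob (\<Inter>i\<in>J. Z False i -` A i \<inter> space M) * prob (\<Inter>i\<in>K. Z True i -` B i \<inter> space M)"
    if J: "J \<subseteq> {..<N}" "J \<noteq> {}" "\<And>i. i \<in> J \<Longrightarrow> A i \<in> sets borel"
     and K: "K \<subseteq> {..<N}" "K \<noteq> {}" "\<And>i. i \<in> K \<Longrightarrow> B i \<in> sets borel" for J K A B
  proof -
    let ?P = "PiM {0::real..} (\<lambda>_. borel :: real measure)"
    define E where "E J A = (\<Inter>i\<in>J. (\<lambda>p. p (real (Suc i) * d) - p (real i * d)) -` A i \<inter> space ?P)"
      for J :: "nat set" and A :: "nat \<Rightarrow> real set"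
    have Es: "E J A \<in> sets ?P" if "J \<subseteq> {..<N}" "J \<noteq> {}" "\<And>i. i \<in> J \<Longrightarrow> A i \<in> sets borel" for J A
      unfolding E_def using that finite_subset[OF that(1)] d
      by (intro sets.finite_INT measurable_sets[where A = borel] borel_measurable_diff measurable_component_singleton) auto
    have "prob ((\<lambda>x. (\<lambda>t\<in>{0..}. Re (W t x), \<lambda>t\<in>{0..}. Im (W t x))) -` (E J A \<times> E K B) \<inter> space M) =
      prob ((\<lambda>\<omega>. \<lambda>t\<in>{0..}. Re (W t \<omega>)) -` E J A \<inter> space M) *
      prob ((\<lambda>\<omega>. \<lambda>t\<in>{0..}. Im (W t \<omega>)) -` E K B \<inter> space M)"
      by (rule indep_varD[OF ind Es[OF J] Es[OF K]])
    moreover have "(\<lambda>\<omega>. \<lambda>t\<in>{0..}. Re (W t \<omega>)) -` E J A \<inter> space M = (\<Inter>i\<in>J. Z False i -` A i \<inter> space M)"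
      using J(2) d by (auto simp: E_def Z_def space_PiM PiE_def extensional_def)
    moreover have "(\<lambda>\<omega>. \<lambda>t\<in>{0..}. Im (W t \<omega>)) -` E K B \<inter> space M = (\<Inter>i\<in>K. Z True i -` B i \<inter> space M)"
      using K(2) d by (auto simp: E_def Z_def space_PiM PiE_def extensional_def)
    moreover have "(\<lambda>x. (\<lambda>t\<in>{0..}. Re (W t x), \<lambda>t\<in>{0..}. Im (W t x))) -` (E J A \<times> E K B) \<inter> space M
       = ((\<lambda>\<omega>. \<lambda>t\<in>{0..}. Re (W t \<omega>)) -` E J A \<inter> space M) \<inter> ((\<lambda>\<omega>. \<lambda>t\<in>{0..}. Im (W t \<omega>)) -` E K B \<inter> space M)"
      by auto
    ultimately show ?thesis by simp
  qed
  have "indep_vars (\<lambda>_. borel) (\<lambda>(b, i). Z b i) (UNIV \<times> {..<N})"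
    unfolding indep_vars_def2
  proof (intro conjI ballI indep_setsI)
    show rv': "(case x of (b, i) \<Rightarrow> Z b i) \<in> borel_measurable M" for x
      by (cases x) (simp add: rv)
    show "{(case x of (b, i) \<Rightarrow> Z b i) -` A \<inter> space M |A. A \<in> sets borel} \<subseteq> events" for x
      using measurable_sets[OF rv'] by blast
    fix F and J :: "(bool \<times> nat) set"
    assume J: "J \<noteq> {}" "J \<subseteq> UNIV \<times> {..<N}" "finite J"
      and "\<forall>j\<in>J. F j \<in> {(case j of (b, i) \<Rightarrow> Z b i) -` A \<inter> space M |A. A \<in> sets borel}"
    then have "\<forall>j\<in>J. \<exists>A. F j = (case j of (b, i) \<Rightarrow> Z b i) -` A \<inter> space M \<and> A \<in> sets borel"
      by blast
    then obtain A where A: "\<And>j. j \<in> J \<Longrightarrow> F j = (case j of (b, i) \<Rightarrow> Z b i) -` A j \<inter> space M"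
        "\<And>j. j \<in> J \<Longrightarrow> A j \<in> sets borel"
      unfolding bchoice_iff by blast
    define K where "K b = {i. (b, i) \<in> J}" for b
    define F' where "F' b = (\<Inter>i\<in>K b. Z b i -` A (b, i) \<inter> space M)" for b
    have JK: "J = Pair False ` K False \<union> Pair True ` K True"
    proof (rule set_eqI)
      fix x show "x \<in> J \<longleftrightarrow> x \<in> Pair False ` K False \<union> Pair True ` K True"
        by (cases x; cases "fst x") (auto simp: K_def)
    qed
    have K: "K b \<subseteq> {..<N}" "finite (K b)" "\<And>i. i \<in> K b \<Longrightarrow> A (b, i) \<in> sets borel" for b
      using J A(2) finite_subset[of "K b" "{..<N}"] by (auto simp: K_def)
    have prF: "(\<Prod>j\<in>Pair b ` K b. prob (F j)) = (\<Prod>i\<in>K b. prob (Z b i -` A (b, i) \<inter> space M))" for b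
      using A(1) by (auto simp: prod.reindex inj_on_def K_def intro!: prod.cong)
    have pr: "(\<Prod>j\<in>J. prob (F j)) = (\<Prod>i\<in>K False. prob (Z False i -` A (False, i) \<inter> space M))
        * (\<Prod>i\<in>K True. prob (Z True i -` A (True, i) \<inter> space M))"
      unfolding JK by (subst prod.union_disjoint) (use K in \<open>auto simp flip: prF\<close>)
    have int: "(\<Inter>j\<in>J. F j) = (\<Inter>j\<in>Pair False ` K False. F j) \<inter> (\<Inter>j\<in>Pair True ` K True. F j)"
      by (subst JK) blast
    have intF: "(\<Inter>j\<in>Pair b ` K b. F j) = F' b" for b
      using A(1) unfolding F'_def by (auto simp: K_def)
    show "prob (\<Inter>j\<in>J. F j) = (\<Prod>j\<in>J. prob (F j))"
    \<comment> \<open>An empty intersection is \<open>UNIV\<close> rather than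
      \<open>space M\<close>, so \<open>cross\<close> and \<open>prodb\<close> apply only to
      nonempty index sets.\<close>
    proof (cases "K False = {} \<or> K True = {}")
      case False
      then have ne: "K b \<noteq> {}" for b by (cases b) auto
      show ?thesis
        unfolding int intF pr F'_def
        by (simp only: cross[OF K(1) ne K(3) K(1) ne K(3)] prodb[OF K(1) ne K(3)])
    next
      case True
      then show ?thesis
      proof
        assume e: "K False = {}"
        then have ne: "K True \<noteq> {}" using J JK by auto
        show ?thesis unfolding int intF pr F'_def prodb[OF K(1) ne K(3)]
          using prodb[OF K(1) ne K(3)] by (simp add: e del: INT_simps)
      next
        assume e: "K True = {}"
        then have ne: "K False \<noteq> {}" using J JK by auto
        show ?thesis unfolding int intF pr F'_def
          using prodb[OF K(1) ne K(3)] by (simp add: e del: INT_simps)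
      qed
    qed
  qed
  moreover have "(\<lambda>(b, i). Z b i) = (\<lambda>(b, i) \<omega>. if b then Im (W (real (Suc i) * d) \<omega>) - Im (W (real i * d) \<omega>)
                  else Re (W (real (Suc i) * d) \<omega>) - Re (W (real i * d) \<omega>))"
    by (auto simp: Z_def fun_eq_iff)
  ultimately show ?thesis by simp
qed

text \<open>This stands in for conditioning on the past: with \<open>X\<close> the earlier
  increments and \<open>Y\<close> the next one, the joint law is a product, and Fubini allows
  \<open>X\<close> to be frozen while \<open>Y\<close> is averaged.\<close>

lemma (in prob_space) indep_var_iterated_integral:
  fixes f :: "_ \<Rightarrow> real"
  assumes ind: "indep_var S X T Y" and f[measurable]: "f \<in> borel_measurable (S \<Otimes>\<^sub>M T)"
    and K: "\<And>p. \<bar>f p\<bar> \<le> K"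
  shows "expectation (\<lambda>\<omega>. f (X \<omega>, Y \<omega>)) = expectation (\<lambda>\<omega>. expectation (\<lambda>\<omega>'. f (X \<omega>, Y \<omega>')))"
proof -
  note X[measurable] = indep_var_rv1[OF ind] note Y[measurable] = indep_var_rv2[OF ind]
  interpret X: prob_space "distr M S X" by (rule prob_space_distr) simp
  interpret Y: prob_space "distr M T Y" by (rule prob_space_distr) simp
  interpret XY: pair_prob_space "distr M S X" "distr M T Y" ..
  have "expectation (\<lambda>\<omega>. f (X \<omega>, Y \<omega>)) = integral\<^sup>L (distr M (S \<Otimes>\<^sub>M T) (\<lambda>x. (X x, Y x))) f"
    by (subst integral_distr) auto
  also have "\<dots> = integral\<^sup>L (distr M S X \<Otimes>\<^sub>M distr M T Y) f"
    using ind by (simp add: indep_var_distribution_eq)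
  also have "\<dots> = (\<integral>x. (\<integral>y. f (x, y) \<partial>distr M T Y) \<partial>distr M S X)"
    by (rule XY.integral_fst'[symmetric]) (use K in \<open>auto intro!: XY.integrable_const_bound[where B=K]\<close>)
  also have "\<dots> = (\<integral>x. expectation (\<lambda>\<omega>'. f (x, Y \<omega>')) \<partial>distr M S X)"
    by (intro Bochner_Integration.integral_cong refl integral_distr) auto
  also have "\<dots> = expectation (\<lambda>\<omega>. expectation (\<lambda>\<omega>'. f (X \<omega>, Y \<omega>')))"
    by (intro integral_distr) auto
  finally show ?thesis .
qed

lemma (in prob_space) normal_moments:
  assumes D: "distributed M lborel x (normal_density 0 \<sigma>)" and s: "0 < \<sigma>"
  shows "has_bochner_integral M x 0" "has_bochner_integral M (\<lambda>\<omega>. (x \<omega>)\<^sup>2) (\<sigma>\<^sup>2)"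
    "integrable M (\<lambda>\<omega>. \<bar>x \<omega>\<bar> ^ 3)" "expectation (\<lambda>\<omega>. \<bar>x \<omega>\<bar> ^ 3) \<le> 2 * \<sigma> ^ 3"
proof -
  have tr: "has_bochner_integral M (\<lambda>\<omega>. g (x \<omega>)) v"
    if "has_bochner_integral lborel (\<lambda>y. normal_density 0 \<sigma> y * g y) v" "g \<in> borel_measurable borel" for g v
    using that distributed_integrable[OF D, of g] distributed_integral[OF D, of g]
    by (auto simp: has_bochner_integral_iff)
  show "has_bochner_integral M x 0"
    using normal_moment_odd[OF s, of 0 0] using tr[of "\<lambda>y. y" 0] by simp
  show "has_bochner_integral M (\<lambda>\<omega>. (x \<omega>)\<^sup>2) (\<sigma>\<^sup>2)"
    using normal_moment_even[OF s, of 0 1] s by (intro tr) (auto simp: power2_eq_square)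
  have *: "has_bochner_integral M (\<lambda>\<omega>. \<bar>x \<omega>\<bar> ^ 3) (2 * \<sigma>^3 * sqrt (2 / pi))"
    using normal_moment_abs_odd[OF s, of 0 1] by (intro tr) (auto simp: numeral_3_eq_3)
  then show "integrable M (\<lambda>\<omega>. \<bar>x \<omega>\<bar> ^ 3)" by (rule integrable.intros)
  have "sqrt (2 / pi) \<le> 1" using pi_gt3 by (simp add: divide_le_eq)
  then have "2 * \<sigma>^3 * sqrt (2 / pi) \<le> 2 * \<sigma>^3 * 1" using s by (intro mult_left_mono) auto
  then show "expectation (\<lambda>\<omega>. \<bar>x \<omega>\<bar> ^ 3) \<le> 2 * \<sigma> ^ 3"
    using has_bochner_integral_integral_eq[OF *] by simp
qed

text \<open>The grid walk may jump across the boundary. The value 0 there preserves a bound on the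
  modulus and the nonnegativity of the real part.\<close>

definition cutoff :: "(complex \<Rightarrow> complex) \<Rightarrow> complex \<Rightarrow> complex" where
  "cutoff G w = (if w \<in> upper_half_plane then G w else 0)"

lemma cutoff_measurable:
  assumes "continuous_on upper_half_plane G"
  shows "cutoff G \<in> borel_measurable borel"
  unfolding cutoff_def[abs_def] using open_upper_half_plane
  by (intro borel_measurable_continuous_on_if assms) auto

lemma cmod_cube_le: "cmod (Complex a b) ^ 3 \<le> 4 * (\<bar>a\<bar> ^ 3 + \<bar>b\<bar> ^ 3)"
proof -
  have "cmod (Complex a b) ^ 3 \<le> (\<bar>a\<bar> + \<bar>b\<bar>) ^ 3"
    using cmod_le[of "Complex a b"] by (intro power_mono) auto
  also have "\<dots> \<le> 4 * (\<bar>a\<bar> ^ 3 + \<bar>b\<bar> ^ 3)"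
  proof -
    have "4 * (p ^ 3 + q ^ 3) - (p + q) ^ 3 = 3 * ((p + q) * (p - q)\<^sup>2)" for p q :: real
      by algebra
    from this[of "\<bar>a\<bar>" "\<bar>b\<bar>"] show ?thesis
      by (smt (verit) mult_nonneg_nonneg zero_le_power2 abs_ge_zero)
  qed
  finally show ?thesis .
qed

text \<open>The linear Taylor term has mean 0, and so has the quadratic one:
  \<open>E (x + \<i> y)^2\<close> vanishes since \<open>x\<close> and \<open>y\<close> are
  independent and centred with equal variances. Only the cubic remainder survives, with constant 32
  * 4 * (2 + 2) = 512.\<close>

lemma (in prob_space) mean_cutoff_le:
  assumes D: "distributed M lborel x (normal_density 0 \<sigma>)" "distributed M lborel y (normal_density 0 \<sigma>)"
    and s: "0 < \<sigma>" and ind: "indep_var borel x borel y"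
    and hol: "G holomorphic_on upper_half_plane"
    and bd: "\<And>z. z \<in> upper_half_plane \<Longrightarrow> cmod (G z) \<le> B"
    and e: "0 < e" and z: "e < Im z"
  shows "expectation (\<lambda>\<omega>. Re (cutoff G (z + Complex (x \<omega>) (y \<omega>)))) \<le> Re (G z) + 512 * B * \<sigma> ^ 3 / e ^ 3"
proof -
  note mx = normal_moments[OF D(1) s] and my = normal_moments[OF D(2) s]
  note rv[measurable] = indep_var_rv1[OF ind] indep_var_rv2[OF ind]
  have xy: "integrable M (\<lambda>\<omega>. x \<omega> * y \<omega>)" "expectation (\<lambda>\<omega>. x \<omega> * y \<omega>) = 0"
    using indep_var_integrable[OF ind] indep_var_lebesgue_integral[OF ind] mx(1) my(1)
    by (auto simp: has_bochner_integral_iff)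
  define p where "p = deriv G z" define q where "q = deriv (deriv G) z"
  have B0: "0 \<le> B"
    using order_trans[OF norm_ge_zero bd[of z]] z e by (simp add: upper_half_plane_def)
  define R where "R \<omega> = Re (G z) + (Re p * x \<omega> - Im p * y \<omega>)
     + (Re q * ((x \<omega>)\<^sup>2 - (y \<omega>)\<^sup>2) / 2 - Im q * (x \<omega> * y \<omega>))
     + 32 * B / e^3 * (4 * (\<bar>x \<omega>\<bar> ^ 3 + \<bar>y \<omega>\<bar> ^ 3))" for \<omega>
  have le: "Re (cutoff G (z + Complex (x \<omega>) (y \<omega>))) \<le> R \<omega>" for \<omega>
  proof -
    define h where "h = Complex (x \<omega>) (y \<omega>)"
    have "Re (cutoff G (z + h) - (G z + p * h + q * h\<^sup>2 / 2)) \<le> 32 * B * cmod h ^ 3 / e ^ 3"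
      using taylor_cutoff_bound[OF hol bd e z, of h] complex_Re_le_cmod order_trans
      unfolding cutoff_def p_def q_def by blast
    also have "\<dots> = 32 * B / e^3 * cmod h ^ 3" by simp
    also have "\<dots> \<le> 32 * B / e^3 * (4 * (\<bar>x \<omega>\<bar> ^ 3 + \<bar>y \<omega>\<bar> ^ 3))"
      unfolding h_def using B0 e by (intro mult_left_mono cmod_cube_le) auto
    finally have "Re (cutoff G (z + h)) \<le> Re (G z + p * h + q * h\<^sup>2 / 2) + 32 * B / e^3 * (4 * (\<bar>x \<omega>\<bar> ^ 3 + \<bar>y \<omega>\<bar> ^ 3))"
      by simp
    also have "\<dots> = R \<omega>"
      by (simp add: R_def h_def power2_eq_square field_simps)
    finally show ?thesis by (simp add: h_def)
  qed
  have int: "has_bochner_integral M R (Re (G z) + (Re p * 0 - Im p * 0)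
     + (Re q * (\<sigma>\<^sup>2 - \<sigma>\<^sup>2) / 2 - Im q * 0)
     + 32 * B / e^3 * (4 * (expectation (\<lambda>\<omega>. \<bar>x \<omega>\<bar> ^ 3) + expectation (\<lambda>\<omega>. \<bar>y \<omega>\<bar> ^ 3))))"
    unfolding R_def
    by (intro has_bochner_integral_add has_bochner_integral_diff has_bochner_integral_mult_right
        has_bochner_integral_divide_zero mx my has_bochner_integral_integrable)
       (use xy mx my in \<open>auto simp: has_bochner_integral_iff prob_space\<close>)
  have "(\<lambda>w. Re (cutoff G w)) \<in> borel_measurable borel"
    using cutoff_measurable[of G] holomorphic_on_imp_continuous_on[OF hol] by simp
  then have meas: "(\<lambda>\<omega>. Re (cutoff G (z + Complex (x \<omega>) (y \<omega>)))) \<in> borel_measurable M"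
    unfolding Complex_eq by measurable
  have bd': "\<bar>Re (cutoff G w)\<bar> \<le> B" for w
    using bd[of w] abs_Re_le_cmod[of "G w"] B0 by (auto simp: cutoff_def)
  have "expectation (\<lambda>\<omega>. Re (cutoff G (z + Complex (x \<omega>) (y \<omega>)))) \<le> expectation R"
    by (rule integral_mono) (use le int meas bd' in \<open>auto intro!: integrable_const_bound[where B=B] simp: has_bochner_integral_iff\<close>)
  also have "\<dots> = Re (G z) + 32 * B / e^3 * (4 * (expectation (\<lambda>\<omega>. \<bar>x \<omega>\<bar> ^ 3) + expectation (\<lambda>\<omega>. \<bar>y \<omega>\<bar> ^ 3)))"
    using has_bochner_integral_integral_eq[OF int] by simp
  also have "\<dots> \<le> Re (G z) + 32 * B / e^3 * (4 * (2 * \<sigma>^3 + 2 * \<sigma>^3))"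
    using mx(4) my(4) B0 e by (intro add_left_mono mult_left_mono add_mono) auto
  finally show ?thesis by (simp add: field_simps)
qed

section \<open>Maximal inequalities\<close>

lemma planar_brownian_motion_basic:
  assumes W: "planar_brownian_motion M W z0"
  shows "prob_space M" "0 \<le> t \<Longrightarrow> W t \<in> borel_measurable M"
    "\<omega> \<in> space M \<Longrightarrow> W 0 \<omega> = z0" "\<omega> \<in> space M \<Longrightarrow> continuous_on {0..} (\<lambda>t. W t \<omega>)"
    "0 \<le> s \<Longrightarrow> s < t \<Longrightarrow> distributed M lborel (\<lambda>\<omega>. Re (W t \<omega>) - Re (W s \<omega>)) (normal_density 0 (sqrt (t - s)))"
    "0 \<le> s \<Longrightarrow> s < t \<Longrightarrow> distributed M lborel (\<lambda>\<omega>. Im (W t \<omega>) - Im (W s \<omega>)) (normal_density 0 (sqrt (t - s)))"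
proof -
  have lbm: "linear_brownian_motion M (\<lambda>t \<omega>. Re (W t \<omega>)) (Re z0)"
      "linear_brownian_motion M (\<lambda>t \<omega>. Im (W t \<omega>)) (Im z0)"
    using W by (auto simp: planar_brownian_motion_def)
  note l = lbm[unfolded linear_brownian_motion_def]
  show "prob_space M" using l by blast
  show "W t \<in> borel_measurable M" if "0 \<le> t"
    using l that by (subst borel_measurable_complex_iff) auto
  show "W 0 \<omega> = z0" if "\<omega> \<in> space M"
    using l that by (auto simp: complex_eq_iff)
  show "continuous_on {0..} (\<lambda>t. W t \<omega>)" if "\<omega> \<in> space M"
  proof -
    have "continuous_on {0..} (\<lambda>t. Complex (Re (W t \<omega>)) (Im (W t \<omega>)))"
      using l that by (intro continuous_on_Complex) auto
    then show ?thesis by simp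
  qed
  show "0 \<le> s \<Longrightarrow> s < t \<Longrightarrow> distributed M lborel (\<lambda>\<omega>. Re (W t \<omega>) - Re (W s \<omega>)) (normal_density 0 (sqrt (t - s)))"
    "0 \<le> s \<Longrightarrow> s < t \<Longrightarrow> distributed M lborel (\<lambda>\<omega>. Im (W t \<omega>) - Im (W s \<omega>)) (normal_density 0 (sqrt (t - s)))"
    using l by blast+
qed

text \<open>The position at step \<open>k\<close> and the event of having stayed in \<open>S\<close>
  are functions of the first \<open>k\<close> increments (\<open>pos\<close>), which are independent
  of the next one. With that past frozen, the position lies above height \<open>e\<close>, so
  \<open>mean_cutoff_le\<close> applies to the remaining average.\<close>

lemma grid_step_le:
  fixes k :: nat
  assumes W: "planar_brownian_motion M W z0" and d: "0 < d"
    and hol: "G holomorphic_on upper_half_plane"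
    and bd: "\<And>z. z \<in> upper_half_plane \<Longrightarrow> cmod (G z) \<le> B"
    and nn: "\<And>z. z \<in> upper_half_plane \<Longrightarrow> 0 \<le> Re (G z)"
    and e: "0 < e" and S[measurable]: "S \<in> sets borel" and Sub: "\<And>z. z \<in> S \<Longrightarrow> e < Im z"
  shows "integral\<^sup>L M (\<lambda>\<omega>. indicator {\<omega>. \<forall>j\<le>k. W (real j * d) \<omega> \<in> S} \<omega> * Re (cutoff G (W (real (Suc k) * d) \<omega>)))
    \<le> integral\<^sup>L M (\<lambda>\<omega>. indicator {\<omega>. \<forall>j\<le>k. W (real j * d) \<omega> \<in> S} \<omega> * Re (cutoff G (W (real k * d) \<omega>)))
      + 512 * B * sqrt d ^ 3 / e ^ 3"
proof -
  interpret prob_space M using planar_brownian_motion_basic[OF W] by simp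
  define Z where "Z = (\<lambda>(b::bool, i) \<omega>. if b then Im (W (real (Suc i) * d) \<omega>) - Im (W (real i * d) \<omega>)
                  else Re (W (real (Suc i) * d) \<omega>) - Re (W (real i * d) \<omega>))"
  have indZ: "indep_vars (\<lambda>_. borel) Z (UNIV \<times> {..<Suc k})"
    unfolding Z_def by (rule planar_increments_indep[OF W d])
  let ?P = "PiM (UNIV \<times> {..<k}) (\<lambda>_. borel :: real measure)" and ?Q = "PiM (UNIV \<times> {k}) (\<lambda>_. borel :: real measure)"
  define P where "P \<omega> = (\<lambda>i\<in>UNIV \<times> {..<k}. Z i \<omega>)" for \<omega>
  define Q where "Q \<omega> = (\<lambda>i\<in>UNIV \<times> {k}. Z i \<omega>)" for \<omega>
  have ind: "indep_var ?P P ?Q Q"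
    unfolding P_def Q_def by (rule indep_var_restrict[OF indZ]) auto
  note rv[measurable] = indep_var_rv1[OF ind] indep_var_rv2[OF ind]
  define pos where "pos p j = z0 + (\<Sum>i<j. of_real (p (False, i)) + \<i> * of_real (p (True, i)))"
    for p :: "bool \<times> nat \<Rightarrow> real" and j :: nat
  have pos_meas[measurable]: "(\<lambda>p. pos p j) \<in> borel_measurable ?P" if "j \<le> k" for j
    unfolding pos_def using that
    by (intro borel_measurable_add borel_measurable_sum borel_measurable_times borel_measurable_const
        borel_measurable_of_real measurable_component_singleton) auto
  have W_rec: "W (real (Suc j) * d) \<omega> = W (real j * d) \<omega> + (of_real (Z (False, j) \<omega>) + \<i> * of_real (Z (True, j) \<omega>))" for j \<omega>
    by (simp add: Z_def complex_eq_iff)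
  have posW: "W (real j * d) \<omega> = pos (P \<omega>) j" if "j \<le> k" "\<omega> \<in> space M" for j \<omega>
    using that(1)
  proof (induction j)
    case 0
    then show ?case using planar_brownian_motion_basic(3)[OF W that(2)] by (simp add: pos_def)
  next
    case (Suc j)
    then have "P \<omega> (b, j) = Z (b, j) \<omega>" for b by (simp add: P_def)
    with Suc W_rec[of j \<omega>] show ?case by (simp add: pos_def algebra_simps)
  qed
  have WS: "W (real (Suc k) * d) \<omega> = pos (P \<omega>) k + Complex (Q \<omega> (False, k)) (Q \<omega> (True, k))"
    if "\<omega> \<in> space M" for \<omega>
    using W_rec[of k \<omega>] posW[OF order_refl that] by (simp add: Q_def Complex_eq)
  let ?u = "\<lambda>w. Re (cutoff G w)"
  have u[measurable]: "?u \<in> borel_measurable borel"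
    using cutoff_measurable[of G] holomorphic_on_imp_continuous_on[OF hol] by simp
  have B0: "0 \<le> B" using bd[of \<i>] norm_ge_zero[of "G \<i>"] by (simp add: upper_half_plane_def del: norm_ge_zero)
  have bd': "\<bar>?u w\<bar> \<le> B" for w
    using bd[of w] abs_Re_le_cmod[of "G w"] B0 by (auto simp: cutoff_def)
  define A where "A = {p \<in> space ?P. \<forall>j\<le>k. pos p j \<in> S}"
  have A[measurable]: "A \<in> sets ?P"
  proof -
    have "A = (\<Inter>j\<in>{..k}. {p \<in> space ?P. pos p j \<in> S})" by (auto simp: A_def)
    also have "\<dots> \<in> sets ?P" by (intro sets.finite_INT) auto
    finally show ?thesis .
  qed
  have AW: "indicator {\<omega>. \<forall>j\<le>k. W (real j * d) \<omega> \<in> S} \<omega> = (indicator A (P \<omega>) :: real)"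
    if "\<omega> \<in> space M" for \<omega>
    using that posW[OF _ that] measurable_space[OF rv(1) that] by (auto simp: indicator_def A_def)
  define f where "f = (\<lambda>(p, q). indicator A p * ?u (pos p k + (of_real (q (False, k)) + \<i> * of_real (q (True, k)))))"
  have "f \<in> borel_measurable (?P \<Otimes>\<^sub>M ?Q)"
    unfolding f_def by measurable
  moreover have "\<bar>f pq\<bar> \<le> B" for pq
    using bd' B0 by (auto simp: f_def indicator_def split: prod.splits)
  ultimately have it: "expectation (\<lambda>\<omega>. f (P \<omega>, Q \<omega>)) = expectation (\<lambda>\<omega>. expectation (\<lambda>\<omega>'. f (P \<omega>, Q \<omega>')))"
    by (rule indep_var_iterated_integral[OF ind])
  let ?err = "512 * B * sqrt d ^ 3 / e ^ 3"
  have D: "distributed M lborel (Z (b, k)) (normal_density 0 (sqrt d))" for b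
    using planar_brownian_motion_basic(5,6)[OF W, of "real k * d" "real (Suc k) * d"] d
    by (cases b) (simp_all add: Z_def algebra_simps)
  have indxy: "indep_var borel (Z (False, k)) borel (Z (True, k))"
    using indep_var_compose[OF indep_var_restrict[OF indZ, of "{(False, k)}" "{(True, k)}"],
        of "\<lambda>p. p (False, k)" borel "\<lambda>p. p (True, k)" borel]
    by (auto simp: comp_def)
  have step: "expectation (\<lambda>\<omega>'. f (P \<omega>, Q \<omega>')) \<le> indicator A (P \<omega>) * ?u (pos (P \<omega>) k) + ?err" for \<omega>
  proof (cases "P \<omega> \<in> A")
    case True
    then have im: "e < Im (pos (P \<omega>) k)" using Sub by (auto simp: A_def)
    have "expectation (\<lambda>\<omega>'. f (P \<omega>, Q \<omega>')) =
       expectation (\<lambda>\<omega>'. ?u (pos (P \<omega>) k + Complex (Z (False, k) \<omega>') (Z (True, k) \<omega>')))"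
      using True by (simp add: f_def Q_def Complex_eq)
    also have "\<dots> \<le> Re (G (pos (P \<omega>) k)) + ?err"
      by (rule mean_cutoff_le[OF D D _ indxy hol bd e im]) (use d in auto)
    finally show ?thesis using True im e by (simp add: cutoff_def upper_half_plane_def)
  qed (use B0 d e in \<open>auto simp: f_def\<close>)
  have int0: "integrable M (\<lambda>\<omega>. indicator A (P \<omega>) * ?u (pos (P \<omega>) k))"
    using bd' B0 by (intro integrable_const_bound[where B=B]) (auto simp: indicator_def)
  have "integral\<^sup>L M (\<lambda>\<omega>. indicator {\<omega>. \<forall>j\<le>k. W (real j * d) \<omega> \<in> S} \<omega> * ?u (W (real (Suc k) * d) \<omega>))
     = expectation (\<lambda>\<omega>. f (P \<omega>, Q \<omega>))"
    by (rule Bochner_Integration.integral_cong) (auto simp: AW WS f_def Complex_eq simp del: of_nat_Suc)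
  also have "\<dots> = expectation (\<lambda>\<omega>. expectation (\<lambda>\<omega>'. f (P \<omega>, Q \<omega>')))" by (rule it)
  also have "\<dots> \<le> expectation (\<lambda>\<omega>. indicator A (P \<omega>) * ?u (pos (P \<omega>) k) + ?err)"
    using int0 B0 d e nn by (intro integral_mono'[OF _ step]) (auto simp: cutoff_def)
  also have "\<dots> = expectation (\<lambda>\<omega>. indicator A (P \<omega>) * ?u (pos (P \<omega>) k)) + ?err"
    using int0 by (simp add: prob_space)
  also have "expectation (\<lambda>\<omega>. indicator A (P \<omega>) * ?u (pos (P \<omega>) k)) =
     integral\<^sup>L M (\<lambda>\<omega>. indicator {\<omega>. \<forall>j\<le>k. W (real j * d) \<omega> \<in> S} \<omega> * ?u (W (real k * d) \<omega>))"
    by (rule Bochner_Integration.integral_cong) (auto simp: AW posW)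
  finally show ?thesis .
qed

text \<open>
  \<open>Re G\<close>, cut off outside the half-plane and stopped at the first exit from \<open>{e < Im z}\<close>, is a
  supermartingale along the time grid up to an error of order \<open>d\<^sup>3\<^sup>/\<^sup>2\<close> per step.
\<close>

lemma grid_maximal_inequality:
  assumes W: "planar_brownian_motion M W z0" and d: "0 < d"
    and hol: "G holomorphic_on upper_half_plane"
    and bd: "\<And>z. z \<in> upper_half_plane \<Longrightarrow> cmod (G z) \<le> B"
    and nn: "\<And>z. z \<in> upper_half_plane \<Longrightarrow> 0 \<le> Re (G z)"
    and e: "0 < e" and z0: "e < Im z0" and c: "0 < c"
  defines "E \<equiv> \<lambda>k. {\<omega>\<in>space M. \<exists>i\<le>k. c < Re (G (W (real i * d) \<omega>)) \<and> (\<forall>j\<le>i. e < Im (W (real j * d) \<omega>))}"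
  shows "E k \<in> sets M" "c * measure M (E k) \<le> Re (G z0) + real k * (512 * B * sqrt d ^ 3 / e ^ 3)"
proof -
  note basic = planar_brownian_motion_basic[OF W]
  interpret prob_space M using basic by simp
  let ?u = "\<lambda>w. Re (cutoff G w)"
  have u[measurable]: "?u \<in> borel_measurable borel"
    using cutoff_measurable[of G] holomorphic_on_imp_continuous_on[OF hol] by simp
  have B0: "0 \<le> B" using bd[of \<i>] norm_ge_zero[of "G \<i>"] by (simp add: upper_half_plane_def del: norm_ge_zero)
  have bd': "\<bar>?u w\<bar> \<le> B" for w
    using bd[of w] abs_Re_le_cmod[of "G w"] B0 by (auto simp: cutoff_def)
  have u0: "0 \<le> ?u w" for w using nn by (auto simp: cutoff_def)
  have uG: "?u w = Re (G w)" if "e < Im w" for w using that e by (auto simp: cutoff_def upper_half_plane_def)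
  define X where "X j = W (real j * d)" for j
  have X[measurable]: "X j \<in> borel_measurable M" for j
    unfolding X_def using d by (intro basic(2)) auto
  define S where "S = {w. e < Im w \<and> ?u w \<le> c}"
  have S[measurable]: "S \<in> sets borel" unfolding S_def by measurable
  define A where "A k = {\<omega>. \<forall>j\<le>k. X j \<omega> \<in> S}" for k
  have A: "A k \<inter> space M \<in> sets M" for k
  proof -
    have "A k \<inter> space M = (\<Inter>j\<in>{..k}. {\<omega> \<in> space M. X j \<omega> \<in> S})" by (auto simp: A_def)
    also have "\<dots> \<in> sets M" by (intro sets.finite_INT) auto
    finally show ?thesis .
  qed
  have E_eq: "E k = {\<omega>\<in>space M. \<exists>i\<le>k. c < ?u (X i \<omega>) \<and> (\<forall>j\<le>i. e < Im (X j \<omega>))}" for k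
    unfolding E_def X_def using uG by (auto intro!: exI conjI)
  show E: "E k \<in> sets M" for k
  proof -
    have "E k = (\<Union>i\<in>{..k}. {\<omega>\<in>space M. c < ?u (X i \<omega>)} \<inter> (\<Inter>j\<in>{..i}. {\<omega>\<in>space M. e < Im (X j \<omega>)}))"
      by (auto simp: E_eq)
    also have "\<dots> \<in> sets M" by (intro sets.finite_UN sets.Int sets.finite_INT) auto
    finally show ?thesis .
  qed
  define err where "err = 512 * B * sqrt d ^ 3 / e ^ 3"
  let ?a = "\<lambda>i k \<omega>. indicator (A k) \<omega> * ?u (X i \<omega>)"
  have indA[measurable]: "(\<lambda>\<omega>. indicator (A k) \<omega> :: real) \<in> borel_measurable M" for k
    using A by (simp add: borel_measurable_indicator_iff)
  have int: "integrable M (?a i k)" for i k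
    using bd' B0
    by (intro integrable_const_bound[where B=B] AE_I2 borel_measurable_times indA measurable_compose[OF X u])
      (auto simp: indicator_def)
  have intE: "integrable M (\<lambda>\<omega>. c * indicator (E k) \<omega>)" for k
    using E by (intro integrable_mult_right integrable_real_indicator) (auto simp: less_top[symmetric])
  \<comment> \<open>The potential pays \<open>c\<close> once the level has been exceeded and
    \<open>?u\<close> while the walk is still in the strip at or below the level. A walk that leaves
    the strip otherwise contributes 0, which is a loss because \<open>?u\<close> is nonnegative.
    When the level is first exceeded, \<open>?u\<close> is above \<open>c\<close> and covers the
    payment.\<close>
  have key: "expectation (\<lambda>\<omega>. c * indicator (E k) \<omega> + ?a k k \<omega>) \<le> Re (G z0) + real k * err"
  proof (induction k)
    case 0
    have "c * indicator (E 0) \<omega> + ?a 0 0 \<omega> \<le> Re (G z0)" if "\<omega> \<in> space M" for \<omega>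
    proof -
      have "X 0 \<omega> = z0" using basic(3)[OF that] by (simp add: X_def)
      then show ?thesis using z0 uG[OF z0] that by (auto simp: E_eq A_def S_def indicator_def)
    qed
    then have "expectation (\<lambda>\<omega>. c * indicator (E 0) \<omega> + ?a 0 0 \<omega>) \<le> expectation (\<lambda>_. Re (G z0))"
      using int intE by (intro integral_mono) auto
    then show ?case by (simp add: prob_space)
  next
    case (Suc k)
    have "c * indicator (E (Suc k)) \<omega> + ?a (Suc k) (Suc k) \<omega> \<le> c * indicator (E k) \<omega> + ?a (Suc k) k \<omega>"
      if "\<omega> \<in> space M" for \<omega>
    proof (cases "\<omega> \<in> E k")
      case True
      then have "\<omega> \<in> E (Suc k)" "\<omega> \<notin> A (Suc k)"
        by (auto simp: E_eq A_def S_def) (auto intro: le_SucI)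
      then show ?thesis using True u0 by (auto simp: indicator_def)
    next
      case False
      show ?thesis
      proof (cases "\<omega> \<in> E (Suc k)")
        case True
        then obtain i where i: "i \<le> Suc k" "c < ?u (X i \<omega>)" "\<forall>j\<le>i. e < Im (X j \<omega>)"
          by (auto simp: E_eq)
        with False that have iS: "i = Suc k" by (auto simp: E_eq le_Suc_eq)
        have "?u (X j \<omega>) \<le> c" if "j \<le> k" for j
        proof (rule ccontr)
          assume "\<not> ?u (X j \<omega>) \<le> c"
          then have "\<omega> \<in> E k" unfolding E_eq using that i iS \<open>\<omega> \<in> space M\<close> by (auto intro!: exI[of _ j])
          with False show False ..
        qed
        then have "\<omega> \<in> A k" "\<omega> \<notin> A (Suc k)" using i iS by (auto simp: A_def S_def intro!: exI[of _ "Suc k"])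
        then show ?thesis using True False i iS by (auto simp: indicator_def)
      next
        case nE: False
        have "A (Suc k) \<subseteq> A k" by (auto simp: A_def)
        with False nE u0 show ?thesis by (auto simp: indicator_def)
      qed
    qed
    then have "expectation (\<lambda>\<omega>. c * indicator (E (Suc k)) \<omega> + ?a (Suc k) (Suc k) \<omega>)
       \<le> expectation (\<lambda>\<omega>. c * indicator (E k) \<omega> + ?a (Suc k) k \<omega>)"
      using int intE by (intro integral_mono) auto
    also have "\<dots> = expectation (\<lambda>\<omega>. c * indicator (E k) \<omega>) + expectation (?a (Suc k) k)"
      using int intE by (rule Bochner_Integration.integral_add[rotated])
    also have "expectation (?a (Suc k) k) \<le> expectation (?a k k) + err"
      using grid_step_le[OF W d hol bd nn e S, of k] by (simp add: A_def X_def S_def err_def)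
    also have "expectation (\<lambda>\<omega>. c * indicator (E k) \<omega>) + (expectation (?a k k) + err)
       = expectation (\<lambda>\<omega>. c * indicator (E k) \<omega> + ?a k k \<omega>) + err"
      using int intE by (subst Bochner_Integration.integral_add) auto
    also note Suc
    finally show ?case by (simp add: algebra_simps)
  qed
  have "c * measure M (E k) = expectation (\<lambda>\<omega>. c * indicator (E k) \<omega>)" using E by simp
  also have "\<dots> \<le> expectation (\<lambda>\<omega>. c * indicator (E k) \<omega> + ?a k k \<omega>)"
    using int intE u0 by (intro integral_mono) auto
  also note key
  finally show "c * measure M (E k) \<le> Re (G z0) + real k * (512 * B * sqrt d ^ 3 / e ^ 3)"
    by (simp add: err_def)
qed

text \<open>The map sends the closed right half-plane into the disc with diameter
  \<open>[0, 1]\<close> and the unit circle into the line \<open>Re = 1/2\<close>. It is used both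
  to truncate a function and to turn a large modulus into a large real part.\<close>

lemma mobius_half_plane:
  fixes w :: complex
  assumes "0 \<le> Re w"
  shows "1 + w \<noteq> 0" "cmod (w / (1 + w)) \<le> 1" "0 \<le> Re (w / (1 + w))"
    "1 < cmod w \<Longrightarrow> 1 / 2 < Re (w / (1 + w))"
proof -
  show ne: "1 + w \<noteq> 0" using assms by (auto simp: complex_eq_iff)
  have D: "0 < (1 + Re w)\<^sup>2 + (Im w)\<^sup>2" using assms by (intro add_pos_nonneg) auto
  have eq: "Re (w / (1 + w)) = (Re w * (1 + Re w) + (Im w)\<^sup>2) / ((1 + Re w)\<^sup>2 + (Im w)\<^sup>2)"
    by (simp add: Re_divide power2_eq_square)
  have "(cmod w)\<^sup>2 \<le> (cmod (1 + w))\<^sup>2"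
    unfolding cmod_power2 using assms by (simp add: power2_eq_square algebra_simps)
  then have "cmod w \<le> cmod (1 + w)" by (rule power2_le_imp_le) simp
  then show "cmod (w / (1 + w)) \<le> 1" using ne by (simp add: norm_divide divide_simps)
  show "0 \<le> Re (w / (1 + w))" unfolding eq using assms D by (intro divide_nonneg_pos) auto
  show "1 / 2 < Re (w / (1 + w))" if "1 < cmod w"
  proof -
    have "1 < (cmod w)\<^sup>2" using that by simp
    then have "1 < (Re w)\<^sup>2 + (Im w)\<^sup>2" by (simp add: cmod_power2)
    then show ?thesis unfolding eq using D by (simp add: field_simps power2_eq_square)
  qed
qed

text \<open>Survival up to and including time \<open>s\<close>, expressed without the exit time,
  which may be infinite.\<close>

definition alive :: "(real \<Rightarrow> complex) \<Rightarrow> real \<Rightarrow> bool" where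
  "alive w s \<longleftrightarrow> 0 \<le> s \<and> (\<forall>r\<in>{0..s}. w r \<in> upper_half_plane)"

text \<open>
  The event need not be known to be measurable, so it is only covered by a measurable set. The
  function \<open>F\<close> is replaced by the bounded \<open>G n = F / (1 + F / n)\<close>, whose real part is also
  nonnegative, and the grid \<open>4\<^sup>-\<^sup>n\<close> is fine enough to make the total error on \<open>[0, n]\<close> vanish.
\<close>

lemma maximal_inequality:
  assumes W: "planar_brownian_motion M W z0" and z0: "z0 \<in> upper_half_plane"
    and hol: "F holomorphic_on upper_half_plane"
    and nn: "\<And>z. z \<in> upper_half_plane \<Longrightarrow> 0 \<le> Re (F z)"
    and c: "0 < c"
  shows "\<exists>A\<in>sets M. {\<omega>\<in>space M. \<exists>s. alive (\<lambda>t. W t \<omega>) s \<and> c < Re (F (W s \<omega>))} \<subseteq> A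
    \<and> measure M A \<le> Re (F z0) / c"
proof -
  note basic = planar_brownian_motion_basic[OF W]
  interpret prob_space M using basic by simp
  define G where "G n z = F z / (1 + F z / of_nat n)" for n :: nat and z
  have G_eq: "G n z = of_nat n * ((F z / of_nat n) / (1 + F z / of_nat n))" if "0 < n" for n z
    using that by (simp add: G_def)
  have mob: "1 + F z / of_nat n \<noteq> 0" "cmod (G n z) \<le> real n" "0 \<le> Re (G n z)"
    if "z \<in> upper_half_plane" "0 < n" for n z
  proof -
    have r: "0 \<le> Re (F z / of_nat n)" using nn[OF that(1)] that(2) by simp
    note m = mobius_half_plane[OF r]
    show "1 + F z / of_nat n \<noteq> 0" by (rule m)
    define X where "X = (F z / of_nat n) / (1 + F z / of_nat n)"
    have X: "G n z = of_nat n * X" "cmod X \<le> 1" "0 \<le> Re X"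
      unfolding X_def by (fact G_eq[OF that(2)] m(2) m(3))+
    show "cmod (G n z) \<le> real n" using X by (simp add: norm_mult mult_left_le)
    show "0 \<le> Re (G n z)" using X by simp
  qed
  have holG: "G n holomorphic_on upper_half_plane" if "0 < n" for n
    unfolding G_def[abs_def] by (intro holomorphic_intros hol) (use mob that in auto)
  define d :: "nat \<Rightarrow> real" where "d n = 1 / 4 ^ n" for n
  define E where "E n = {\<omega>\<in>space M. \<exists>i\<le>n * 4^n. c < Re (G n (W (real i * d n) \<omega>)) \<and> (\<forall>j\<le>i. 1 / real n < Im (W (real j * d n) \<omega>))}" for n
  define b where "b n = (Re (G n z0) + real (n * 4^n) * (512 * real n * sqrt (d n) ^ 3 / (1 / real n) ^ 3)) / c" for n
  have Imz0: "0 < Im z0" using z0 by (simp add: upper_half_plane_def)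
  obtain N0 :: nat where N0: "1 / Im z0 < real N0" using reals_Archimedean2 by blast
  have "0 < 1 / Im z0" using Imz0 by simp
  then have N0': "0 < N0" using N0 by (cases N0) auto
  have En: "E n \<in> sets M" "prob (E n) \<le> b n" if "N0 \<le> n" for n
  proof -
    have n: "0 < n" using that N0' by simp
    have "1 / Im z0 < real n" using that N0 by simp
    then have z: "1 / real n < Im z0" using n Imz0 by (simp add: field_simps)
    have dn: "0 < d n" "0 < 1 / real n" using n by (auto simp: d_def)
    note g = grid_maximal_inequality[OF W dn(1) holG[OF n] mob(2)[OF _ n] mob(3)[OF _ n] dn(2) z c, of "n * 4^n"]
    show "E n \<in> sets M" unfolding E_def by (rule g(1))
    show "prob (E n) \<le> b n"
      unfolding E_def b_def pos_le_divide_eq[OF c] using g(2) by (simp only: mult.commute[of _ c])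
  qed
  have Glim: "(\<lambda>n. G n (x n)) \<longlonglongrightarrow> F y"
    if "x \<longlonglongrightarrow> y" "y \<in> upper_half_plane" for x y
  proof -
    have "continuous (at y) F"
      using hol open_upper_half_plane that(2) by (meson continuous_on_eq_continuous_at holomorphic_on_imp_continuous_on)
    then have Fx: "(\<lambda>n. F (x n)) \<longlonglongrightarrow> F y" by (rule isCont_tendsto_compose[OF _ that(1)])
    have "(\<lambda>n. F (x n) / (1 + F (x n) * (1 / of_nat n))) \<longlonglongrightarrow> F y / (1 + F y * 0)"
      by (intro tendsto_intros Fx lim_1_over_n) auto
    then show ?thesis by (simp add: G_def)
  qed
  \<comment> \<open>With \<open>B = n\<close>, \<open>e = 1/n\<close> and
    \<open>sqrt (d n) = 1/2^n\<close>, the \<open>n * 4^n\<close> steps contribute a total error of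
    \<open>512 * n^5 / 2^n\<close>.\<close>
  have b: "b \<longlonglongrightarrow> Re (F z0) / c"
  proof -
    have "real (n * 4^n) * (512 * real n * sqrt (d n) ^ 3 / (1 / real n) ^ 3) = 512 * (real n ^ 5 / 2 ^ n)" for n
    proof -
      define a :: real where "a = 2 ^ n"
      have a: "(4::real) ^ n = a * a" "0 < a" by (auto simp: a_def simp flip: power_mult_distrib)
      then have s: "sqrt (d n) = 1 / a" by (simp add: d_def real_sqrt_divide)
      show ?thesis
        using a(2) unfolding s of_nat_mult of_nat_power of_nat_numeral a(1) a_def[symmetric]
        by (cases "n = 0") (simp_all add: field_simps eval_nat_numeral)
    qed
    moreover have "(\<lambda>n. 512 * (real n ^ 5 / 2 ^ n)) \<longlonglongrightarrow> 0" by real_asymp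
    ultimately have "(\<lambda>n. real (n * 4^n) * (512 * real n * sqrt (d n) ^ 3 / (1 / real n) ^ 3)) \<longlonglongrightarrow> 0"
      by (simp only:)
    then have "b \<longlonglongrightarrow> (Re (F z0) + 0) / c"
      unfolding b_def[abs_def] using c z0 by (intro tendsto_intros Glim) auto
    then show ?thesis by simp
  qed
  \<comment> \<open>The union of the \<open>I m\<close> is the lower limit of the events
    \<open>E n\<close>. Every path of the event in question lies in all but finitely many
    \<open>E n\<close>, so this union covers it, and it inherits the limit of the bounds
    \<open>b n\<close>.\<close>
  define I where "I m = (\<Inter>n\<in>{m + N0..}. E n)" for m
  have I: "I m \<in> sets M" for m unfolding I_def using En by (intro sets.countable_INT) auto
  have probI: "prob (I m) \<le> Re (F z0) / c" for m
  proof (rule LIMSEQ_le_const[OF b], intro exI allI impI)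
    fix n assume n: "m + N0 \<le> n"
    then have "prob (I m) \<le> prob (E n)" using En by (intro finite_measure_mono) (auto simp: I_def)
    also have "\<dots> \<le> b n" using En n by simp
    finally show "prob (I m) \<le> b n" .
  qed
  have "incseq I" by (auto simp: incseq_def I_def)
  then have "(\<lambda>m. prob (I m)) \<longlonglongrightarrow> prob (\<Union>m. I m)"
    using I by (intro finite_Lim_measure_incseq) auto
  then have "prob (\<Union>m. I m) \<le> Re (F z0) / c"
    using probI by (intro LIMSEQ_le_const2) auto
  moreover have "\<omega> \<in> (\<Union>m. I m)" if \<omega>: "\<omega> \<in> space M" and s: "alive (\<lambda>t. W t \<omega>) s" and cs: "c < Re (F (W s \<omega>))" for \<omega> s
  proof -
    let ?w = "\<lambda>t. W t \<omega>"
    have s0: "0 \<le> s" using s by (simp add: alive_def)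
    have cont: "continuous_on {0..} ?w" by (rule basic(4)[OF \<omega>])
    have "\<exists>r\<in>{0..s}. \<forall>r'\<in>{0..s}. Im (?w r) \<le> Im (?w r')"
      using s0 by (intro continuous_attains_inf continuous_on_Im continuous_on_subset[OF cont]) auto
    then obtain \<eta> where \<eta>: "0 < \<eta>" "\<And>r. r \<in> {0..s} \<Longrightarrow> \<eta> \<le> Im (?w r)"
      using s unfolding alive_def upper_half_plane_def by blast
    define k where "k n = nat \<lfloor>s * 4 ^ n\<rfloor>" for n :: nat
    define t where "t n = real (k n) * d n" for n
    have kle: "real (k n) \<le> s * 4 ^ n" and kge: "s * 4 ^ n - 1 \<le> real (k n)" for n
      using s0 by (auto simp: k_def)
    have t: "t n \<le> s" "s - d n \<le> t n" "0 \<le> t n" for n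
      using divide_right_mono[OF kle[of n], of "4 ^ n"] divide_right_mono[OF kge[of n], of "4 ^ n"]
      by (auto simp: t_def d_def diff_divide_distrib)
    have d0: "d \<longlonglongrightarrow> 0" unfolding d_def[abs_def] by real_asymp
    have "t \<longlonglongrightarrow> s"
    proof (rule tendsto_sandwich[of "\<lambda>n. s - d n" _ _ "\<lambda>_. s"])
      show "(\<lambda>n. s - d n) \<longlonglongrightarrow> s" using tendsto_diff[OF tendsto_const d0, of s] by simp
    qed (use t in auto)
    then have "(\<lambda>n. ?w (t n)) \<longlonglongrightarrow> ?w s"
      using t s0 by (intro continuous_on_tendsto_compose[OF cont]) auto
    then have "(\<lambda>n. Re (G n (?w (t n)))) \<longlonglongrightarrow> Re (F (?w s))"
      using s s0 by (intro tendsto_Re Glim) (auto simp: alive_def)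
    then have "\<forall>\<^sub>F n in sequentially. c < Re (G n (?w (t n)))" using cs by (rule order_tendstoD(1))
    moreover have "\<forall>\<^sub>F n in sequentially. 1 / real n < \<eta>"
      using lim_1_over_n[where 'a=real] \<eta>(1) by (rule order_tendstoD(2))
    moreover have "\<forall>\<^sub>F n in sequentially. s \<le> real n" by real_asymp
    ultimately have "\<forall>\<^sub>F n in sequentially. \<omega> \<in> E n"
    proof eventually_elim
      case (elim n)
      have "real (k n) \<le> real (n * 4 ^ n)" using kle[of n] elim(3) by (simp add: order_trans mult_right_mono)
      then have "k n \<le> n * 4 ^ n" by linarith
      moreover have "1 / real n < Im (W (real j * d n) \<omega>)" if "j \<le> k n" for j
      proof -
        have "real j * d n \<le> t n" using that unfolding t_def by (intro mult_right_mono) (auto simp: d_def)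
        then have "real j * d n \<in> {0..s}" using t[of n] by (auto simp: d_def)
        then show ?thesis using \<eta>(2) elim(2) by (meson less_le_trans)
      qed
      ultimately show ?case using elim(1) \<omega> unfolding E_def t_def by auto
    qed
    then obtain m where "\<And>n. m \<le> n \<Longrightarrow> \<omega> \<in> E n" by (auto simp: eventually_sequentially)
    then have "\<omega> \<in> I m" by (auto simp: I_def)
    then show ?thesis by blast
  qed
  ultimately have "{\<omega>\<in>space M. \<exists>s. alive (\<lambda>t. W t \<omega>) s \<and> c < Re (F (W s \<omega>))} \<subseteq> (\<Union>m. I m)
      \<and> prob (\<Union>m. I m) \<le> Re (F z0) / c"
    by blast
  moreover have "(\<Union>m. I m) \<in> sets M" using I by blast
  ultimately show ?thesis by blast
qed

text \<open>
  Kolmogorov's trick: \<open>F / (c + F)\<close> has nonnegative real part, which exceeds \<open>1/2\<close> where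
  \<open>\<bar>F\<bar> > c\<close>.
\<close>

lemma weak_type_inequality:
  assumes W: "planar_brownian_motion M W z0" and z0: "z0 \<in> upper_half_plane"
    and hol: "F holomorphic_on upper_half_plane"
    and nn: "\<And>z. z \<in> upper_half_plane \<Longrightarrow> 0 \<le> Re (F z)" and Im0: "Im (F z0) = 0"
    and c: "0 < c"
  shows "\<exists>A\<in>sets M. {\<omega>\<in>space M. \<exists>s. alive (\<lambda>t. W t \<omega>) s \<and> c < cmod (F (W s \<omega>))} \<subseteq> A
    \<and> measure M A \<le> 2 * Re (F z0) / c"
proof -
  define G where "G z = (F z / of_real c) / (1 + F z / of_real c)" for z
  have r: "0 \<le> Re (F z / of_real c)" if "z \<in> upper_half_plane" for z using nn[OF that] c by simp
  note m = mobius_half_plane(1-3)[OF r] and m5 = mobius_half_plane(4)[OF r]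
  have "G holomorphic_on upper_half_plane"
    unfolding G_def[abs_def] by (intro holomorphic_intros hol) (use m c in auto)
  from maximal_inequality[OF W z0 this, of "1/2"] m(3)
  obtain A where A: "A \<in> sets M" "{\<omega>\<in>space M. \<exists>s. alive (\<lambda>t. W t \<omega>) s \<and> 1/2 < Re (G (W s \<omega>))} \<subseteq> A"
      "measure M A \<le> Re (G z0) / (1/2)"
    by (auto simp: G_def)
  have "1/2 < Re (G z)" if "z \<in> upper_half_plane" "c < cmod (F z)" for z
    unfolding G_def using c that by (intro m5) (auto simp: norm_divide)
  moreover have "W s \<omega> \<in> upper_half_plane" if "alive (\<lambda>t. W t \<omega>) s" for s \<omega>
    using that by (simp add: alive_def)
  ultimately have sub: "{\<omega>\<in>space M. \<exists>s. alive (\<lambda>t. W t \<omega>) s \<and> c < cmod (F (W s \<omega>))} \<subseteq> A"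
    using A(2) by blast
  \<comment> \<open>Here it matters that \<open>F z0\<close> is real: \<open>G z0\<close> is then
    \<open>x / (1 + x)\<close>, which is at most \<open>x\<close>.\<close>
  have "Re (G z0) \<le> Re (F z0) / c"
  proof -
    define x where "x = Re (F z0) / c"
    have x: "0 \<le> x" "F z0 / of_real c = of_real x"
      using nn[OF z0] c Im0 by (auto simp: x_def complex_eq_iff)
    have "G z0 = of_real (x / (1 + x))" by (simp add: G_def x)
    moreover have "x / (1 + x) \<le> x" using x(1) by (simp add: field_simps)
    ultimately show ?thesis by (simp add: x_def)
  qed
  then have "measure M A \<le> 2 * Re (F z0) / c" using A(3) by simp
  with sub A(1) show ?thesis by blast
qed

section \<open>Analytic functions on the half-plane\<close>

definition cauchy_cdf :: "real \<Rightarrow> real" where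
  "cauchy_cdf x = 1 / 2 + arctan x / pi"

lemma cauchy_cdf_bounds: "0 < cauchy_cdf x" "cauchy_cdf x < 1"
  using arctan_lbound[of x] arctan_ubound[of x] pi_gt_zero by (simp_all add: cauchy_cdf_def field_simps)

text \<open>
  For \<open>0 < s < 1\<close> the real part of \<open>half_line_fun s\<close> is the harmonic measure of the half-line
  \<open>(a, \<infinity>)\<close>, where \<open>a\<close> is the \<open>s\<close>-quantile of the Cauchy law, the exit law from \<open>\<i>\<close>; the constant makes
  the function real at \<open>\<i>\<close>. The factor \<open>-\<i>\<close> moves the branch cut of \<^const>\<open>Ln\<close> away from the
  closed half-plane.
\<close>

definition half_line_fun :: "real \<Rightarrow> complex \<Rightarrow> complex" where
  "half_line_fun s z = (if s \<le> 0 then 1 else if 1 \<le> s then 0 else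
     let a = of_real (tan (pi * (s - 1 / 2)))
     in 1 / 2 + \<i> / pi * (Ln (- \<i> * (z - a)) - ln (cmod (\<i> - a))))"

lemma arctan_quantile:
  assumes "0 < s" "s < 1"
  shows "arctan (tan (pi * (s - 1 / 2))) = pi * (s - 1 / 2)"
proof (rule arctan_tan)
  have "pi * (- (1/2)) < pi * (s - 1/2)" using assms by (intro mult_strict_left_mono) auto
  then show "- (pi/2) < pi * (s - 1/2)" by simp
  have "pi * (s - 1/2) < pi * (1/2)" using assms by (intro mult_strict_left_mono) auto
  then show "pi * (s - 1/2) < pi/2" by simp
qed

lemma holomorphic_half_line_fun: "half_line_fun s holomorphic_on upper_half_plane"
proof (cases "s \<le> 0 \<or> 1 \<le> s")
  case True
  then show ?thesis by (auto simp: half_line_fun_def[abs_def])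
next
  case False
  have "Re (- \<i> * (z - of_real a)) > 0" if "z \<in> upper_half_plane" for z a
    using that by (simp add: upper_half_plane_def)
  then have "- \<i> * (z - of_real a) \<notin> \<real>\<^sub>\<le>\<^sub>0" if "z \<in> upper_half_plane" for z a
    using that complex_nonpos_Reals_iff by (metis not_le)
  then show ?thesis
    unfolding half_line_fun_def[abs_def] Let_def using False by (auto intro!: holomorphic_intros)
qed

lemma Re_half_line_fun:
  assumes "0 < s" "s < 1" "z \<in> upper_half_plane"
  shows "Re (half_line_fun s z) = 1 / 2 - arctan ((tan (pi * (s - 1 / 2)) - Re z) / Im z) / pi"
proof -
  define v where "v = - \<i> * (z - of_real (tan (pi * (s - 1 / 2))))"
  have v: "Re v = Im z" "Im v = tan (pi * (s - 1 / 2)) - Re z" by (simp_all add: v_def)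
  then have "0 < Re v" using assms(3) by (simp add: upper_half_plane_def)
  then have "Im (Ln v) = arctan (Im v / Re v)"
    using arg_conv_arctan[of v] Arg_eq_Im_Ln[of v] by fastforce
  then show ?thesis
    using assms(1,2) unfolding half_line_fun_def Let_def v_def[symmetric] by (simp add: v)
qed

lemma half_line_fun_ii:
  assumes "0 \<le> s" "s \<le> 1"
  shows "half_line_fun s \<i> = of_real (1 - s)"
proof (cases "s = 0 \<or> s = 1")
  case True
  then show ?thesis by (auto simp: half_line_fun_def)
next
  case False
  then have s: "0 < s" "s < 1" using assms by auto
  define a where "a = tan (pi * (s - 1 / 2))"
  have "Re (half_line_fun s \<i>) = 1 - s"
    using s by (subst Re_half_line_fun) (auto simp: upper_half_plane_def arctan_quantile[OF s])
  moreover have "Im (half_line_fun s \<i>) = 0"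
  proof -
    have "\<i> - of_real a \<noteq> 0" by (simp add: complex_eq_iff)
    then have "- \<i> * (\<i> - of_real a) \<noteq> 0" by simp
    then have "Re (Ln (- \<i> * (\<i> - of_real a))) = ln (cmod (- \<i> * (\<i> - of_real a)))"
      by (rule Re_Ln)
    also have "cmod (- \<i> * (\<i> - of_real a)) = cmod (\<i> - of_real a)" by (simp only: norm_mult norm_minus_cancel norm_ii mult_1)
    finally show ?thesis using s unfolding half_line_fun_def Let_def a_def[symmetric] by simp
  qed
  ultimately show ?thesis by (simp add: complex_eq_iff)
qed

lemma Re_half_line_fun_bounds:
  assumes "z \<in> upper_half_plane"
  shows "0 \<le> Re (half_line_fun s z)" "Re (half_line_fun s z) \<le> 1"
proof -
  consider "s \<le> 0" | "1 \<le> s" | "0 < s" "s < 1" by linarith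
  then have "0 \<le> Re (half_line_fun s z) \<and> Re (half_line_fun s z) \<le> 1"
  proof cases
    case 3
    define y where "y = (tan (pi * (s - 1 / 2)) - Re z) / Im z"
    have "- (1/2) < arctan y / pi" "arctan y / pi < 1/2"
      using arctan_lbound[of y] arctan_ubound[of y] pi_gt_zero by (simp_all add: field_simps)
    then show ?thesis unfolding Re_half_line_fun[OF 3 assms] y_def[symmetric] by linarith
  qed (auto simp: half_line_fun_def)
  then show "0 \<le> Re (half_line_fun s z)" "Re (half_line_fun s z) \<le> 1" by auto
qed

lemma Re_half_line_fun_antimono:
  assumes z: "z \<in> upper_half_plane" and st: "s \<le> t"
  shows "Re (half_line_fun t z) \<le> Re (half_line_fun s z)"
proof -
  consider "s \<le> 0" | "1 \<le> t" | "0 < s" "t < 1" by linarith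
  then show ?thesis
  proof cases
    case 1
    then show ?thesis using Re_half_line_fun_bounds[OF z, of t] by (simp add: half_line_fun_def)
  next
    case 2
    then show ?thesis using Re_half_line_fun_bounds[OF z, of s] by (simp add: half_line_fun_def)
  next
    case 3
    then have s: "0 < s" "s < 1" and t: "0 < t" "t < 1" using st by auto
    have "pi * (s - 1/2) \<le> pi * (t - 1/2)" using st by simp
    then have "tan (pi * (s - 1/2)) \<le> tan (pi * (t - 1/2))"
      by (metis arctan_quantile[OF s] arctan_quantile[OF t] arctan_le_iff)
    then show ?thesis
      unfolding Re_half_line_fun[OF s z] Re_half_line_fun[OF t z] using z
      by (simp add: divide_right_mono arctan_le_iff upper_half_plane_def)
  qed
qed

text \<open>Away from the end point \<open>a\<close> of the half-line the logarithm extends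
  continuously to the real axis, where \<open>- \<i> * (x - a)\<close> has argument
  \<open>- pi/2\<close> or \<open>pi/2\<close> according to the side of \<open>a\<close>. The
  assumption excludes the logarithmic singularity at \<open>a\<close>.\<close>

lemma half_line_fun_boundary:
  fixes x :: real
  assumes "cauchy_cdf x \<noteq> s"
  shows "\<exists>l. (half_line_fun s \<longlongrightarrow> l) (at (of_real x) within upper_half_plane) \<and>
     Re l = (if s < cauchy_cdf x then 1 else 0)"
proof -
  consider "s \<le> 0" | "1 \<le> s" | "0 < s" "s < 1" by linarith
  then show ?thesis
  proof cases
    case 1
    then show ?thesis using cauchy_cdf_bounds[of x] by (auto simp: half_line_fun_def[abs_def] intro!: exI[of _ 1])
  next
    case 2
    then show ?thesis using cauchy_cdf_bounds[of x] by (auto simp: half_line_fun_def[abs_def] intro!: exI[of _ 0])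
  next
    case 3
    define a where "a = tan (pi * (s - 1 / 2))"
    have ar: "arctan a = pi * (s - 1/2)" unfolding a_def using arctan_quantile[OF 3] .
    have "s < cauchy_cdf x \<longleftrightarrow> arctan a < arctan x"
      using pi_gt_zero by (simp add: ar cauchy_cdf_def field_simps)
    then have less: "s < cauchy_cdf x \<longleftrightarrow> a < x" by (simp add: arctan_less_iff)
    have ne: "a \<noteq> x" using assms ar pi_gt_zero by (auto simp: cauchy_cdf_def)
    have eq: "half_line_fun s = (\<lambda>z. 1 / 2 + \<i> / pi * (Ln (- \<i> * (z - of_real a)) - ln (cmod (\<i> - of_real a))))"
      using 3 by (simp add: half_line_fun_def[abs_def] a_def Let_def)
    have "- \<i> * (of_real x - of_real a) \<notin> \<real>\<^sub>\<le>\<^sub>0"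
      using ne by (simp add: complex_nonpos_Reals_iff)
    then have "(half_line_fun s \<longlongrightarrow> half_line_fun s (of_real x)) (at (of_real x) within upper_half_plane)"
      unfolding eq by (intro tendsto_intros tendsto_Ln)
    moreover have "Re (half_line_fun s (of_real x)) = 1/2 - Im (Ln (- \<i> * (of_real x - of_real a))) / pi"
      by (simp add: eq)
    moreover have "Im (Ln (- \<i> * (of_real x - of_real a))) = (if a < x then - pi/2 else pi/2)"
      using ne by (subst Im_Ln_eq) auto
    ultimately show ?thesis using less by (auto intro!: exI[of _ "half_line_fun s (of_real x)"])
  qed
qed

text \<open>Schwarz's lemma, after a Cayley transform in the domain that takes 0 to
  \<open>\<i>\<close> and one in the range that takes the value at \<open>\<i>\<close> to 0. The
  quotient \<open>(1 + r) / (1 - r)\<close> with \<open>r = cmod ((z - \<i>) / (z + \<i>))\<close>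
  is multiplied out. The bound concerns the modulus, so the real part at one point controls the
  whole function.\<close>

lemma harnack_half_plane:
  assumes hol: "D holomorphic_on upper_half_plane"
    and nn: "\<And>z. z \<in> upper_half_plane \<Longrightarrow> 0 \<le> Re (D z)" and Im0: "Im (D \<i>) = 0"
    and z: "z \<in> upper_half_plane"
  shows "cmod (D z) * (cmod (z + \<i>) - cmod (z - \<i>)) \<le> Re (D \<i>) * (cmod (z + \<i>) + cmod (z - \<i>))"
proof -
  have zi: "z + \<i> \<noteq> 0" using z by (auto simp: upper_half_plane_def complex_eq_iff)
  \<comment> \<open>The shift by \<open>t > 0\<close> makes the real part strictly positive, so that
    \<open>m > 0\<close> and \<open>B\<close> maps into the open disc; at the end \<open>t\<close>
    tends to 0.\<close>
  have key: "cmod (D z + of_real t) * (cmod (z + \<i>) - cmod (z - \<i>)) \<le> (Re (D \<i>) + t) * (cmod (z + \<i>) + cmod (z - \<i>))"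
    if t: "0 < t" for t
  proof -
    define m where "m = Re (D \<i>) + t"
    have m: "0 < m" "D \<i> + of_real t = of_real m"
      using nn[of \<i>] t Im0 by (auto simp: m_def upper_half_plane_def complex_eq_iff)
    define \<phi> where "\<phi> \<xi> = \<i> * (1 + \<xi>) / (1 - \<xi>)" for \<xi>
    have \<phi>: "\<phi> \<xi> \<in> upper_half_plane" if "cmod \<xi> < 1" for \<xi>
    proof -
      have "1 - \<xi> \<noteq> 0" using that by auto
      then have d: "0 < (cmod (1 - \<xi>))\<^sup>2" by simp
      have "Im (\<phi> \<xi>) = (1 - (cmod \<xi>)\<^sup>2) / (cmod (1 - \<xi>))\<^sup>2"
        unfolding \<phi>_def cmod_power2 by (simp add: Im_divide power2_eq_square algebra_simps)
      moreover have "(cmod \<xi>)\<^sup>2 < 1" using power_strict_mono[OF that, of 2] by simp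
      ultimately show ?thesis using d by (simp add: upper_half_plane_def)
    qed
    have ne: "D w + of_real t + of_real m \<noteq> 0" if "w \<in> upper_half_plane" for w
      using nn[OF that] t m(1) by (auto simp: complex_eq_iff)
    define B where "B \<xi> = (D (\<phi> \<xi>) + of_real t - of_real m) / (D (\<phi> \<xi>) + of_real t + of_real m)" for \<xi>
    have "\<phi> holomorphic_on ball 0 1" unfolding \<phi>_def by (intro holomorphic_intros) auto
    then have "(D \<circ> \<phi>) holomorphic_on ball 0 1"
      by (rule holomorphic_on_compose_gen[OF _ hol]) (use \<phi> in auto)
    then have holB: "B holomorphic_on ball 0 1"
      unfolding B_def comp_def using \<phi> ne by (intro holomorphic_intros) auto
    have B0: "B 0 = 0" using m by (simp add: B_def \<phi>_def)
    have B1: "cmod (B \<xi>) < 1" if "cmod \<xi> < 1" for \<xi>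
    proof -
      define v where "v = D (\<phi> \<xi>) + of_real t"
      have v: "0 < Re v" using nn[OF \<phi>[OF that]] t by (simp add: v_def)
      have "(cmod (v - of_real m))\<^sup>2 < (cmod (v + of_real m))\<^sup>2"
        unfolding cmod_power2 using v m(1) by (simp add: power2_eq_square algebra_simps)
      then have less: "cmod (v - of_real m) < cmod (v + of_real m)" by (rule power2_less_imp_less) simp
      show ?thesis unfolding B_def v_def[symmetric] norm_divide
        using less le_less_trans[OF norm_ge_zero less] by (simp only: divide_less_eq_1_pos)
    qed
    define \<xi> where "\<xi> = (z - \<i>) / (z + \<i>)"
    have "cmod (z - \<i>) < cmod (z + \<i>)"
    proof (rule power2_less_imp_less)
      show "(cmod (z - \<i>))\<^sup>2 < (cmod (z + \<i>))\<^sup>2"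
        unfolding cmod_power2 using z by (simp add: power2_eq_square algebra_simps upper_half_plane_def)
    qed simp
    then have \<xi>: "cmod \<xi> < 1" using zi by (simp add: \<xi>_def norm_divide)
    have "\<phi> \<xi> = z"
    proof -
      have "1 - \<xi> = 2 * \<i> / (z + \<i>)" "1 + \<xi> = 2 * z / (z + \<i>)" using zi by (simp_all add: \<xi>_def field_simps)
      then show ?thesis using zi by (simp add: \<phi>_def)
    qed
    moreover have "cmod (B \<xi>) \<le> cmod \<xi>" by (rule Schwarz_Lemma(1)[OF holB B0 B1 \<xi>])
    ultimately have "cmod (D z + of_real t - of_real m) \<le> cmod \<xi> * cmod (D z + of_real t + of_real m)"
      using ne[OF z] by (simp add: B_def norm_divide divide_le_eq)
    define v where "v = D z + of_real t"
    define r where "r = cmod \<xi>"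
    have "cmod v - m \<le> cmod (v - of_real m)" using norm_triangle_ineq2[of v "of_real m"] m(1) by simp
    also have "\<dots> \<le> r * cmod (v + of_real m)" using \<open>_ \<le> cmod \<xi> * _\<close> by (simp add: v_def r_def)
    also have "\<dots> \<le> r * (cmod v + m)"
      using norm_triangle_ineq[of v "of_real m"] m(1) by (intro mult_left_mono) (auto simp: r_def)
    finally have "cmod v * (1 - r) \<le> m * (1 + r)" by (simp add: algebra_simps)
    then have le: "cmod v * (1 - r) * cmod (z + \<i>) \<le> m * (1 + r) * cmod (z + \<i>)" by (rule mult_right_mono) simp
    have "cmod (z - \<i>) = r * cmod (z + \<i>)" using zi by (simp add: r_def \<xi>_def norm_divide)
    then show ?thesis using le by (simp add: algebra_simps v_def m_def)
  qed
  have "((\<lambda>t. cmod (D z + of_real t) * (cmod (z + \<i>) - cmod (z - \<i>))) \<longlongrightarrow> cmod (D z + of_real 0) * (cmod (z + \<i>) - cmod (z - \<i>))) (at_right 0)"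
    "((\<lambda>t. (Re (D \<i>) + t) * (cmod (z + \<i>) + cmod (z - \<i>))) \<longlongrightarrow> (Re (D \<i>) + 0) * (cmod (z + \<i>) + cmod (z - \<i>))) (at_right 0)"
    by (intro tendsto_intros)+
  from tendsto_le[OF _ this(2) this(1)] key show ?thesis
    by (simp add: eventually_at_right_less eventually_at_filter)
qed

section \<open>The exit point\<close>

text \<open>The half-plane is open and the path continuous, so the set of times spent outside is
  closed. Its infimum is attained unless the set is empty, in which case the exit time is
  infinite.\<close>

lemma alive_path:
  assumes cont: "continuous_on {0..} w" and s: "0 \<le> s"
  shows less_exit_time_iff: "ereal s < exit_time upper_half_plane w \<longleftrightarrow> alive w s" 
    and exit_time_attained: "\<not> alive w s \<Longrightarrow> \<exists>T\<ge>0. exit_time upper_half_plane w = ereal T \<and> w T \<notin> upper_half_plane"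
proof -
  define E where "E = {t. 0 \<le> t \<and> w t \<notin> upper_half_plane}"
  have ex: "exit_time upper_half_plane w = Inf (ereal ` E)" by (simp add: exit_time_def E_def)
  have "closed ({0..} \<inter> w -` (- upper_half_plane))"
    using open_upper_half_plane cont by (intro continuous_closed_preimage) auto
  also have "{0..} \<inter> w -` (- upper_half_plane) = E" by (auto simp: E_def)
  finally have cl: "closed E" .
  have att: "Inf (ereal ` E) = ereal (Inf E) \<and> Inf E \<in> E" if "E \<noteq> {}"
  proof -
    have bd: "bdd_below E" by (auto simp: bdd_below_def E_def)
    have "Inf E \<in> E" by (rule closed_contains_Inf[OF that bd cl])
    moreover have "Inf (ereal ` E) = ereal (Inf E)"
      using calculation by (intro antisym Inf_lower Inf_greatest) (auto intro: cInf_lower[OF _ bd])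
    ultimately show ?thesis by simp
  qed
  show "ereal s < exit_time upper_half_plane w \<longleftrightarrow> alive w s"
  proof
    assume l: "ereal s < exit_time upper_half_plane w"
    have "w r \<in> upper_half_plane" if "r \<in> {0..s}" for r
    proof (rule ccontr)
      assume "w r \<notin> upper_half_plane"
      then have "Inf (ereal ` E) \<le> ereal r" using that by (intro Inf_lower) (auto simp: E_def)
      also have "\<dots> \<le> ereal s" using that by simp
      finally show False using l by (simp add: ex)
    qed
    then show "alive w s" using s by (simp add: alive_def)
  next
    assume a: "alive w s"
    show "ereal s < exit_time upper_half_plane w"
    proof (cases "E = {}")
      case True
      then show ?thesis by (simp add: ex top_ereal_def)
    next
      case False
      with att have i: "Inf (ereal ` E) = ereal (Inf E)" "Inf E \<in> E" by auto
      then have "\<not> Inf E \<le> s" using a by (auto simp: alive_def E_def)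
      then show ?thesis by (simp add: ex i)
    qed
  qed
  show "\<exists>T\<ge>0. exit_time upper_half_plane w = ereal T \<and> w T \<notin> upper_half_plane" if "\<not> alive w s"
  proof -
    have "E \<noteq> {}" using that s by (auto simp: alive_def E_def)
    from att[OF this] show ?thesis by (auto simp: ex E_def)
  qed
qed

text \<open>The \<open>filterlim\<close> clause lets any limit at the boundary point, taken from
  inside the half-plane, be transported to the path.\<close>

definition exits_at :: "(real \<Rightarrow> complex) \<Rightarrow> real \<Rightarrow> real \<Rightarrow> bool" where
  "exits_at w T x \<longleftrightarrow> 0 < T \<and> exit_time upper_half_plane w = ereal T \<and> w T = of_real x \<and>
     (\<forall>s\<ge>0. alive w s \<longleftrightarrow> s < T) \<and> filterlim w (at (of_real x) within upper_half_plane) (at_left T)"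

text \<open>At the exit time the path is a limit of points of the half-plane but lies outside it,
  hence on the real axis.\<close>

lemma exits_at_ex:
  assumes cont: "continuous_on {0..} w" and w0: "w 0 \<in> upper_half_plane" and s: "0 \<le> s" "\<not> alive w s"
  shows "\<exists>T x. exits_at w T x"
proof -
  obtain T where T: "0 \<le> T" "exit_time upper_half_plane w = ereal T" "w T \<notin> upper_half_plane"
    using exit_time_attained[OF cont s] by blast
  have T0: "0 < T" using T w0 by (cases "T = 0") auto
  have al: "alive w s \<longleftrightarrow> s < T" if "0 \<le> s" for s
    using less_exit_time_iff[OF cont that] T(2) by simp
  have "continuous (at T within {0..}) w" using cont T(1) unfolding continuous_on_eq_continuous_within by simp
  moreover have "at T within {0..} = at T" using T0 by (intro at_within_interior) simp
  ultimately have "continuous (at T) w" by simp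
  then have lim: "(w \<longlongrightarrow> w T) (at_left T)"
    by (simp only: isCont_def filterlim_at_split)
  have ev: "\<forall>\<^sub>F s in at_left T. w s \<in> upper_half_plane"
    using eventually_at_left_real[OF T0]
  proof eventually_elim
    case (elim s)
    then have "alive w s" using al[of s] by simp
    with elim show ?case by (simp add: alive_def)
  qed
  have "0 \<le> Im (w T)"
    using tendsto_Im[OF lim] by (rule tendsto_lowerbound)
      (use ev in \<open>auto simp: upper_half_plane_def elim: eventually_mono\<close>)
  then have "Im (w T) = 0" using T(3) by (simp add: upper_half_plane_def)
  then have x: "w T = of_real (Re (w T))" by (simp add: complex_eq_iff)
  have "filterlim w (at (w T) within upper_half_plane) (at_left T)"
    unfolding filterlim_at using lim ev T(3) by (auto elim: eventually_mono)
  then have "filterlim w (at (of_real (Re (w T))) within upper_half_plane) (at_left T)"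
    using x by metis
  then have "exits_at w T (Re (w T))" unfolding exits_at_def using T0 T(2) x al by blast
  then show ?thesis by blast
qed

lemma exits_at_tendsto:
  assumes "exits_at w T x" "(F \<longlongrightarrow> l) (at (of_real x) within upper_half_plane)"
  shows "((\<lambda>s. F (w s)) \<longlongrightarrow> l) (at_left T)"
  using assms(1) unfolding exits_at_def by (blast intro: filterlim_compose[OF assms(2)])

lemma exits_at_eventually_alive:
  assumes "exits_at w T x"
  shows "\<forall>\<^sub>F s in at_left T. alive w s"
proof -
  have "0 < T" using assms by (simp add: exits_at_def)
  from eventually_at_left_real[OF this] show ?thesis
    by eventually_elim (use assms in \<open>auto simp: exits_at_def\<close>)
qed

text \<open>The set where \<open>P\<close> holds need not be measurable; it is contained in the
  intersection of countably many covers, which is null.\<close>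

lemma (in prob_space) AE_notin_of_small_covers:
  assumes "\<And>e. 0 < e \<Longrightarrow> \<exists>A\<in>sets M. {\<omega>\<in>space M. P \<omega>} \<subseteq> A \<and> prob A \<le> e"
  shows "AE \<omega> in M. \<not> P \<omega>"
proof -
  have "\<exists>A. \<forall>n. A n \<in> sets M \<and> {\<omega>\<in>space M. P \<omega>} \<subseteq> A n \<and> prob (A n) \<le> inverse (real (Suc n))"
    using assms[of "inverse (real (Suc n))" for n] by (intro choice) (auto simp del: of_nat_Suc)
  then obtain A where A: "\<And>n. A n \<in> sets M" "\<And>n. {\<omega>\<in>space M. P \<omega>} \<subseteq> A n"
     "\<And>n. prob (A n) \<le> inverse (real (Suc n))" by blast
  have I: "(\<Inter>n. A n) \<in> sets M" using A by auto
  have "prob (\<Inter>n. A n) \<le> inverse (real (Suc n))" for n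
    by (rule order_trans[OF _ A(3)[of n]]) (use A in \<open>auto intro!: finite_measure_mono\<close>)
  then have "prob (\<Inter>n. A n) \<le> 0"
    by (intro LIMSEQ_le_const[OF LIMSEQ_inverse_real_of_nat]) auto
  then have "prob (\<Inter>n. A n) = 0" using measure_nonneg[of M "\<Inter>n. A n"] by linarith
  then have "(\<Inter>n. A n) \<in> null_sets M" using I by (simp add: null_setsI emeasure_eq_measure)
  moreover have "{\<omega>\<in>space M. \<not> \<not> P \<omega>} \<subseteq> (\<Inter>n. A n)" using A(2) by auto
  ultimately show ?thesis by (rule AE_I')
qed

text \<open>A path alive at time \<open>t = K^4\<close> has either risen above height
  \<open>K\<close>, or its height at time \<open>t\<close> lies in \<open>[0, K]\<close>. The first
  has probability at most \<open>1/K\<close> by the maximal inequality, \<open>Im \<i>\<close> being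
  1. The second confines a Gaussian of standard deviation \<open>K^2\<close>, with density at most
  \<open>1/K^2\<close>, to an interval of length \<open>K\<close>. The choice \<open>K = 2/e\<close>
  makes the sum equal to \<open>e\<close>.\<close>

lemma AE_exits:
  assumes W: "planar_brownian_motion M W \<i>"
  shows "AE \<omega> in M. \<exists>T x. exits_at (\<lambda>t. W t \<omega>) T x"
proof -
  note basic = planar_brownian_motion_basic[OF W]
  interpret prob_space M using basic by simp
  have iH: "\<i> \<in> upper_half_plane" by (simp add: upper_half_plane_def)
  have "AE \<omega> in M. \<not> (\<forall>t\<ge>0. alive (\<lambda>t. W t \<omega>) t)"
  proof (rule AE_notin_of_small_covers)
    fix e :: real assume e: "0 < e"
    define K where "K = 2 / e"
    have K: "0 < K" using e by (simp add: K_def)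
    obtain A where A: "A \<in> sets M" "prob A \<le> 1 / K"
      "{\<omega>\<in>space M. \<exists>s. alive (\<lambda>t. W t \<omega>) s \<and> K < Re (- \<i> * W s \<omega>)} \<subseteq> A"
      using maximal_inequality[OF W iH, of "\<lambda>z. - \<i> * z" K] K
      by (auto simp: upper_half_plane_def intro!: holomorphic_intros)
    define t where "t = K ^ 4"
    have t: "0 < t" "sqrt t = K\<^sup>2" using K by (auto simp: t_def real_sqrt_unique power_mult[symmetric])
    define Y where "Y \<omega> = Im (W t \<omega>) - Im (W 0 \<omega>)" for \<omega>
    have D: "distributed M lborel Y (normal_density 0 (K\<^sup>2))"
      using basic(6)[of 0 t] t unfolding Y_def by simp
    define B where "B = Y -` {-1..K-1} \<inter> space M"
    have Bs: "B \<in> sets M" unfolding B_def using D by (auto simp: distributed_def intro: measurable_sets)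
    have "emeasure M B = (\<integral>\<^sup>+x. ennreal (normal_density 0 (K\<^sup>2) x) * indicator {-1..K-1} x \<partial>lborel)"
      unfolding B_def by (rule distributed_emeasure[OF D]) auto
    also have "\<dots> \<le> (\<integral>\<^sup>+x. ennreal (1 / K\<^sup>2) * indicator {-1..K-1} x \<partial>lborel)"
    proof (intro nn_integral_mono mult_right_mono ennreal_leI)
      fix x
      have "1 \<le> sqrt (2 * pi)" using pi_gt3 by simp
      then have "1 * K\<^sup>2 \<le> sqrt (2 * pi) * K\<^sup>2" by (intro mult_right_mono) auto
      also have "\<dots> = sqrt (2 * pi * (K\<^sup>2)\<^sup>2)" unfolding real_sqrt_mult real_sqrt_abs by simp
      finally have "1 / sqrt (2 * pi * (K\<^sup>2)\<^sup>2) \<le> 1 / K\<^sup>2" using K by (intro divide_left_mono) auto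
      moreover have "exp (- (x - 0)\<^sup>2 / (2 * (K\<^sup>2)\<^sup>2)) \<le> 1" by simp
      ultimately have "1 / sqrt (2 * pi * (K\<^sup>2)\<^sup>2) * exp (- (x - 0)\<^sup>2 / (2 * (K\<^sup>2)\<^sup>2)) \<le> 1 / K\<^sup>2 * 1"
        by (intro mult_mono) auto
      then show "normal_density 0 (K\<^sup>2) x \<le> 1 / K\<^sup>2" by (simp add: normal_density_def)
    qed simp
    also have "\<dots> = ennreal (1 / K\<^sup>2) * ennreal K"
      using K by (subst nn_integral_cmult_indicator) auto
    also have "\<dots> = ennreal (1 / K)" using K by (simp add: power2_eq_square flip: ennreal_mult)
    finally have PB: "prob B \<le> 1 / K" using K by (simp add: emeasure_eq_measure)
    show "\<exists>A\<in>sets M. {\<omega> \<in> space M. \<forall>t\<ge>0. alive (\<lambda>t. W t \<omega>) t} \<subseteq> A \<and> prob A \<le> e"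
    proof (intro bexI conjI)
      show "A \<union> B \<in> sets M" using A Bs by simp
      have "prob (A \<union> B) \<le> prob A + prob B" using A Bs by (intro measure_Un_le) auto
      also have "\<dots> \<le> 1 / K + 1 / K" using A PB by (intro add_mono) auto
      finally show "prob (A \<union> B) \<le> e" using e by (simp add: K_def)
      show "{\<omega> \<in> space M. \<forall>t\<ge>0. alive (\<lambda>t. W t \<omega>) t} \<subseteq> A \<union> B"
      proof
        fix \<omega> assume "\<omega> \<in> {\<omega> \<in> space M. \<forall>t\<ge>0. alive (\<lambda>t. W t \<omega>) t}"
        then have \<omega>: "\<omega> \<in> space M" "alive (\<lambda>t. W t \<omega>) t" using t by auto
        have "0 \<le> Im (W t \<omega>)" using \<omega>(2) by (simp add: alive_def upper_half_plane_def less_imp_le)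
        moreover have "Im (W 0 \<omega>) = 1" using basic(3)[OF \<omega>(1)] by simp
        moreover have "\<omega> \<in> A" if "K < Im (W t \<omega>)"
          using that A(3) \<omega> by auto
        ultimately show "\<omega> \<in> A \<union> B" using \<omega>(1) by (force simp: B_def Y_def)
      qed
    qed
  qed
  then show ?thesis
  proof (rule AE_mp, intro AE_I2 impI)
    fix \<omega> assume "\<omega> \<in> space M" "\<not> (\<forall>t\<ge>0. alive (\<lambda>t. W t \<omega>) t)"
    then show "\<exists>T x. exits_at (\<lambda>t. W t \<omega>) T x"
      using exits_at_ex[OF basic(4)] basic(3) iH by auto
  qed
qed

text \<open>If the limit of \<open>Re F\<close> at the exit point exceeds \<open>c\<close>, then the
  path meets \<open>{Re F > c}\<close> shortly before its exit, and the maximal inequality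
  applies.\<close>

lemma boundary_cover:
  assumes W: "planar_brownian_motion M W \<i>" and hol: "F holomorphic_on upper_half_plane"
    and nn: "\<And>z. z \<in> upper_half_plane \<Longrightarrow> 0 \<le> Re (F z)" and c: "0 < c"
    and Q: "\<And>x. Q x \<Longrightarrow> \<exists>l. (F \<longlongrightarrow> l) (at (of_real x) within upper_half_plane) \<and> c < Re l"
  shows "\<exists>A\<in>sets M. {\<omega>\<in>space M. \<exists>T x. exits_at (\<lambda>t. W t \<omega>) T x \<and> Q x} \<subseteq> A \<and> measure M A \<le> Re (F \<i>) / c"
proof -
  obtain A where A: "A \<in> sets M" "measure M A \<le> Re (F \<i>) / c"
      "{\<omega>\<in>space M. \<exists>s. alive (\<lambda>t. W t \<omega>) s \<and> c < Re (F (W s \<omega>))} \<subseteq> A"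
    using maximal_inequality[OF W _ hol nn c] by (auto simp: upper_half_plane_def)
  have "{\<omega>\<in>space M. \<exists>T x. exits_at (\<lambda>t. W t \<omega>) T x \<and> Q x} \<subseteq> A"
  proof (intro subsetI, clarify)
    fix \<omega> T x assume \<omega>: "\<omega> \<in> space M" and ex: "exits_at (\<lambda>t. W t \<omega>) T x" and "Q x"
    then obtain l where l: "(F \<longlongrightarrow> l) (at (of_real x) within upper_half_plane)" "c < Re l"
      using Q by blast
    have "\<forall>\<^sub>F s in at_left T. c < Re (F (W s \<omega>))"
      using tendsto_Re[OF exits_at_tendsto[OF ex l(1)]] l(2) by (rule order_tendstoD(1))
    then have "\<forall>\<^sub>F s in at_left T. alive (\<lambda>t. W t \<omega>) s \<and> c < Re (F (W s \<omega>))"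
      using exits_at_eventually_alive[OF ex] by eventually_elim auto
    from eventually_happens[OF this] A(3) \<omega> show "\<omega> \<in> A" by auto
  qed
  then show ?thesis using A by blast
qed

text \<open>The harmonic measure of the half-line tends to 1 at its interior points, which is above
  every \<open>c < 1\<close>, and its value at \<open>\<i>\<close> is \<open>1 - u\<close>; the
  other tail uses the complementary harmonic measure.\<close>

lemma exit_law_covers:
  assumes W: "planar_brownian_motion M W \<i>" and u: "0 \<le> u" "u \<le> 1" and c: "0 < c" "c < 1"
  shows "\<exists>A\<in>sets M. {\<omega>\<in>space M. \<exists>T x. exits_at (\<lambda>t. W t \<omega>) T x \<and> u < cauchy_cdf x} \<subseteq> A
      \<and> measure M A \<le> (1 - u) / c"
    and "\<exists>A\<in>sets M. {\<omega>\<in>space M. \<exists>T x. exits_at (\<lambda>t. W t \<omega>) T x \<and> cauchy_cdf x < u} \<subseteq> A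
      \<and> measure M A \<le> u / c"
proof -
  have "\<exists>l. (half_line_fun u \<longlongrightarrow> l) (at (of_real x) within upper_half_plane) \<and> c < Re l"
    if "u < cauchy_cdf x" for x
    using half_line_fun_boundary[of x u] that c by auto
  from boundary_cover[OF W holomorphic_half_line_fun Re_half_line_fun_bounds(1) c(1) this]
  show "\<exists>A\<in>sets M. {\<omega>\<in>space M. \<exists>T x. exits_at (\<lambda>t. W t \<omega>) T x \<and> u < cauchy_cdf x} \<subseteq> A
      \<and> measure M A \<le> (1 - u) / c"
    using u by (simp add: half_line_fun_ii)
  let ?F = "\<lambda>z. 1 - half_line_fun u z"
  have "\<exists>l. (?F \<longlongrightarrow> l) (at (of_real x) within upper_half_plane) \<and> c < Re l"
    if x: "cauchy_cdf x < u" for x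
  proof -
    from half_line_fun_boundary[of x u] x obtain l where
      "(half_line_fun u \<longlongrightarrow> l) (at (of_real x) within upper_half_plane)" "Re l = 0" by auto
    then show ?thesis using c by (intro exI[of _ "1 - l"]) (auto intro!: tendsto_intros)
  qed
  moreover have "?F holomorphic_on upper_half_plane" by (intro holomorphic_intros holomorphic_half_line_fun)
  ultimately show "\<exists>A\<in>sets M. {\<omega>\<in>space M. \<exists>T x. exits_at (\<lambda>t. W t \<omega>) T x \<and> cauchy_cdf x < u} \<subseteq> A
      \<and> measure M A \<le> u / c"
    using boundary_cover[OF W, of ?F c "\<lambda>x. cauchy_cdf x < u"] c(1) u Re_half_line_fun_bounds(2)
    by (simp add: half_line_fun_ii)
qed

text \<open>The exit law has no atoms: a point is enclosed in an interval of Cauchy mass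
  \<open>2 * d\<close>, whose harmonic measure tends to 1 at that point. This discards the singular
  points of the step extensions and the discontinuities of the boundary function.\<close>

lemma AE_exit_not_in_countable:
  assumes W: "planar_brownian_motion M W \<i>" and N: "countable N"
  shows "AE \<omega> in M. \<forall>T x. exits_at (\<lambda>t. W t \<omega>) T x \<longrightarrow> cauchy_cdf x \<notin> N"
proof -
  interpret prob_space M using planar_brownian_motion_basic[OF W] by simp
  have one: "AE \<omega> in M. \<not> (\<exists>T x. exits_at (\<lambda>t. W t \<omega>) T x \<and> cauchy_cdf x = u)" for u
  proof (cases "0 < u \<and> u < 1")
    case False
    then show ?thesis using cauchy_cdf_bounds by (intro AE_I2) (metis not_less_iff_gr_or_eq)
  next
    case u: True
    show ?thesis
    proof (rule AE_notin_of_small_covers)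
      fix e :: real assume e: "0 < e"
      \<comment> \<open>The minimum keeps \<open>u - d\<close> and \<open>u + d\<close> in
        \<open>[0, 1]\<close>, and with threshold 1/2 the bound is
        \<open>2 * d / (1/2) = 4 * d \<le> e\<close>.\<close>
      define d where "d = min (e / 4) (min u (1 - u))"
      have d: "0 < d" "d \<le> u" "d \<le> 1 - u" "4 * d \<le> e" using e u by (auto simp: d_def min_def)
      let ?F = "\<lambda>z. half_line_fun (u - d) z - half_line_fun (u + d) z"
      have hol: "?F holomorphic_on upper_half_plane" by (intro holomorphic_intros holomorphic_half_line_fun)
      have nn: "0 \<le> Re (?F z)" if "z \<in> upper_half_plane" for z
        using Re_half_line_fun_antimono[OF that, of "u - d" "u + d"] d by simp
      have "\<exists>l. (?F \<longlongrightarrow> l) (at (of_real x) within upper_half_plane) \<and> 1/2 < Re l"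
        if x: "cauchy_cdf x = u" for x
      proof -
        obtain l where
          l: "(half_line_fun (u - d) \<longlongrightarrow> l) (at (of_real x) within upper_half_plane)" "Re l = 1"
          using half_line_fun_boundary[of x "u - d"] x d by auto
        obtain l' where
          l': "(half_line_fun (u + d) \<longlongrightarrow> l') (at (of_real x) within upper_half_plane)" "Re l' = 0"
          using half_line_fun_boundary[of x "u + d"] x d by auto
        show ?thesis using l l' by (intro exI[of _ "l - l'"]) (auto intro!: tendsto_intros)
      qed
      from boundary_cover[OF W hol nn, of "1/2" "\<lambda>x. cauchy_cdf x = u"] this
      obtain A where A: "A \<in> sets M" "{\<omega>\<in>space M. \<exists>T x. exits_at (\<lambda>t. W t \<omega>) T x \<and> cauchy_cdf x = u} \<subseteq> A"
         and "measure M A \<le> Re (?F \<i>) / (1/2)" by auto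
      moreover have "Re (?F \<i>) / (1/2) = 4 * d"
        using d by (simp add: half_line_fun_ii)
      ultimately have "measure M A \<le> e" using d(4) by linarith
      with A show "\<exists>A\<in>sets M. {\<omega>\<in>space M. \<exists>T x. exits_at (\<lambda>t. W t \<omega>) T x \<and> cauchy_cdf x = u} \<subseteq> A \<and> prob A \<le> e"
        by blast
    qed
  qed
  have "AE \<omega> in M. \<forall>u\<in>N. \<not> (\<exists>T x. exits_at (\<lambda>t. W t \<omega>) T x \<and> cauchy_cdf x = u)"
    using N one by (simp add: AE_ball_countable)
  then show ?thesis by eventually_elim blast
qed

section \<open>Boundary limits along Brownian paths\<close>

text \<open>A Cauchy criterion whose centre may vary with \<open>e\<close>; the filter is arbitrary
  because it serves for real and for extended real times.\<close>

lemma convergent_if_eventually_close: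
  fixes f :: "'b \<Rightarrow> complex"
  assumes ne: "F \<noteq> bot" and cl: "\<And>e. 0 < e \<Longrightarrow> \<exists>c. \<forall>\<^sub>F s in F. cmod (f s - c) \<le> e"
  shows "\<exists>l. (f \<longlongrightarrow> l) F"
proof -
  have "cauchy_filter (filtermap f F)"
    unfolding cauchy_filter_metric_filtermap
  proof (intro allI impI)
    fix e :: real assume e: "0 < e"
    then obtain c where c: "\<forall>\<^sub>F s in F. cmod (f s - c) \<le> e / 3" using cl[of "e/3"] by auto
    have "dist (f x) (f y) < e" if "cmod (f x - c) \<le> e / 3" "cmod (f y - c) \<le> e / 3" for x y
      using dist_triangle2[of "f x" "f y" c] that e by (simp add: dist_norm)
    with c show "\<exists>P. eventually P F \<and> (\<forall>x y. P x \<and> P y \<longrightarrow> dist (f x) (f y) < e)"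
      by (intro exI[of _ "\<lambda>s. cmod (f s - c) \<le> e / 3"]) blast
  qed
  from cauchy_filter_complete_converges[OF this complete_UNIV] ne show ?thesis
    by (auto simp: filterlim_def filtermap_bot_iff)
qed

lemma limit_close:
  fixes f :: "'b \<Rightarrow> complex"
  assumes "F \<noteq> bot" "(f \<longlongrightarrow> l) F" "\<forall>\<^sub>F s in F. cmod (f s - c) \<le> e"
  shows "cmod (l - c) \<le> e"
  using assms by (intro tendsto_upperbound[of "\<lambda>s. cmod (f s - c)" _ F]) (auto intro!: tendsto_intros)

text \<open>\<open>F - \<Phi> n\<close> has nonnegative real part and a small value at
  \<open>\<i>\<close>, so with high probability \<open>F\<close> stays close to
  \<open>\<Phi> n\<close> along the entire path. As \<open>\<Phi> n\<close> converges at the exit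
  point, \<open>F\<close> oscillates little near the exit; this makes its values Cauchy, imaginary
  parts included.\<close>

lemma AE_boundary_limit:
  assumes W: "planar_brownian_motion M W \<i>"
    and hol\<Phi>: "\<And>n. \<Phi> n holomorphic_on upper_half_plane" and hol: "F holomorphic_on upper_half_plane"
    and nn: "\<And>n z. z \<in> upper_half_plane \<Longrightarrow> 0 \<le> Re (F z - \<Phi> n z)"
    and Im0: "\<And>n. Im (F \<i> - \<Phi> n \<i>) = 0" and conv: "(\<lambda>n. Re (F \<i> - \<Phi> n \<i>)) \<longlonglongrightarrow> 0"
    and N: "countable N"
    and bdry: "\<And>n x. cauchy_cdf x \<notin> N \<Longrightarrow> 
       \<exists>l. (\<Phi> n \<longlongrightarrow> l) (at (of_real x) within upper_half_plane) \<and> Re l = v n (cauchy_cdf x)"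
    and lim: "\<And>x. cauchy_cdf x \<notin> N \<Longrightarrow> (\<lambda>n. v n (cauchy_cdf x)) \<longlonglongrightarrow> \<psi> (cauchy_cdf x)"
  shows "AE \<omega> in M. \<exists>T x l. exits_at (\<lambda>t. W t \<omega>) T x \<and> cauchy_cdf x \<notin> N \<and>
     ((\<lambda>s. F (W s \<omega>)) \<longlongrightarrow> l) (at_left T) \<and> Re l = \<psi> (cauchy_cdf x)"
proof -
  interpret prob_space M using planar_brownian_motion_basic[OF W] by simp
  have iH: "\<i> \<in> upper_half_plane" by (simp add: upper_half_plane_def)
  define far where "far j n \<omega> \<longleftrightarrow> (\<exists>s. alive (\<lambda>t. W t \<omega>) s \<and> inverse (real (Suc j)) < cmod (F (W s \<omega>) - \<Phi> n (W s \<omega>)))"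
    for j n \<omega>
  \<comment> \<open>Closeness is obtained for some arbitrarily late \<open>n\<close>, possibly
    different for each path; lateness is needed so that \<open>v n\<close> is close to its limit at
    the same time.\<close>
  have "AE \<omega> in M. \<not> (\<forall>n\<ge>m. far j n \<omega>)" for j m
  proof (rule AE_notin_of_small_covers)
    fix e :: real assume e: "0 < e"
    define r where "r = inverse (real (Suc j))"
    have r: "0 < r" by (simp add: r_def)
    have "\<forall>\<^sub>F n in sequentially. Re (F \<i> - \<Phi> n \<i>) < e * r / 2"
      using conv e r by (intro order_tendstoD) auto
    then have "\<forall>\<^sub>F n in sequentially. Re (F \<i> - \<Phi> n \<i>) < e * r / 2 \<and> m \<le> n"
      using eventually_ge_at_top[of m] by eventually_elim auto
    then obtain n where n: "Re (F \<i> - \<Phi> n \<i>) < e * r / 2" "m \<le> n"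
      by (auto dest: eventually_happens)
    obtain A where A: "A \<in> sets M" "prob A \<le> 2 * Re (F \<i> - \<Phi> n \<i>) / r"
      "{\<omega>\<in>space M. far j n \<omega>} \<subseteq> A"
      using weak_type_inequality[OF W iH, of "\<lambda>z. F z - \<Phi> n z" r] hol hol\<Phi> nn Im0 r
      unfolding far_def r_def[symmetric] by (auto intro!: holomorphic_intros)
    moreover have "2 * Re (F \<i> - \<Phi> n \<i>) / r \<le> e" using n(1) r by (simp add: field_simps)
    ultimately show "\<exists>A\<in>sets M. {\<omega>\<in>space M. \<forall>n\<ge>m. far j n \<omega>} \<subseteq> A \<and> prob A \<le> e"
      using n(2) by (intro bexI[of _ A]) auto
  qed
  then have "AE \<omega> in M. \<forall>j m. \<not> (\<forall>n\<ge>m. far j n \<omega>)" by (simp only: AE_all_countable simp_thms)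
  then show ?thesis using AE_exits[OF W] AE_exit_not_in_countable[OF W N]
  proof eventually_elim
    case (elim \<omega>)
    then obtain T x where ex: "exits_at (\<lambda>t. W t \<omega>) T x" and x: "cauchy_cdf x \<notin> N" by blast
    let ?\<psi> = "\<psi> (cauchy_cdf x)"
    have close: "\<exists>c. \<bar>Re c - ?\<psi>\<bar> \<le> e \<and> (\<forall>\<^sub>F s in at_left T. cmod (F (W s \<omega>) - c) \<le> e)" if e: "0 < e" for e
    proof -
      obtain j where j: "inverse (real (Suc j)) < e / 2" using reals_Archimedean[of "e/2"] e by auto
      have "\<forall>\<^sub>F n in sequentially. \<bar>v n (cauchy_cdf x) - ?\<psi>\<bar> < e"
        using lim[OF x] e by (auto dest!: tendstoD[of _ _ _ e] simp: dist_real_def)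
      then obtain m where m: "\<And>n. m \<le> n \<Longrightarrow> \<bar>v n (cauchy_cdf x) - ?\<psi>\<bar> < e"
        by (auto simp: eventually_sequentially)
      obtain n where n: "m \<le> n" "\<not> far j n \<omega>" using elim(1) by blast
      obtain l where l: "(\<Phi> n \<longlongrightarrow> l) (at (of_real x) within upper_half_plane)" "Re l = v n (cauchy_cdf x)"
        using bdry[OF x] by blast
      have "\<forall>\<^sub>F s in at_left T. dist (\<Phi> n (W s \<omega>)) l < e / 2"
        using exits_at_tendsto[OF ex l(1)] e by (intro tendstoD) auto
      then have "\<forall>\<^sub>F s in at_left T. cmod (F (W s \<omega>) - l) \<le> e"
        using exits_at_eventually_alive[OF ex]
      proof eventually_elim
        case (elim s)
        have "cmod (F (W s \<omega>) - \<Phi> n (W s \<omega>)) \<le> inverse (real (Suc j))"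
          using n(2) elim(2) unfolding far_def by (meson not_le)
        then show ?case using j elim(1) norm_triangle_ineq[of "F (W s \<omega>) - \<Phi> n (W s \<omega>)" "\<Phi> n (W s \<omega>) - l"]
          by (simp add: dist_norm)
      qed
      then show ?thesis using m[OF n(1)] l(2) by (intro exI[of _ l]) auto
    qed
    obtain l where l: "((\<lambda>s. F (W s \<omega>)) \<longlongrightarrow> l) (at_left T)"
      using convergent_if_eventually_close[of "at_left T" "\<lambda>s. F (W s \<omega>)"] close by auto
    have "\<bar>Re l - ?\<psi>\<bar> \<le> 0 + e" if e: "0 < e" for e
    proof -
      obtain c where c: "\<bar>Re c - ?\<psi>\<bar> \<le> e / 2" "\<forall>\<^sub>F s in at_left T. cmod (F (W s \<omega>) - c) \<le> e / 2"
        using close[of "e/2"] e by auto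
      have "cmod (l - c) \<le> e / 2" by (rule limit_close[OF _ l c(2)]) simp
      then have "\<bar>Re l - Re c\<bar> \<le> e / 2" using abs_Re_le_cmod[of "l - c"] by simp
      then show ?thesis using c(1) by linarith
    qed
    then have "\<bar>Re l - ?\<psi>\<bar> \<le> 0" by (rule field_le_epsilon)
    then show ?case using ex x l by (intro exI[of _ T] exI[of _ x] exI[of _ l]) auto
  qed
qed

text \<open>Harnack's principle: the values at \<open>\<i>\<close> form a bounded increasing
  sequence, and \<open>harnack_half_plane\<close> turns its Cauchy property into locally uniform
  convergence. The normalisation \<open>Im0\<close> fixes the additive imaginary constants.\<close>

lemma holomorphic_increasing_limit:
  assumes hol: "\<And>n. \<Phi> n holomorphic_on upper_half_plane"
    and mono: "\<And>n z. z \<in> upper_half_plane \<Longrightarrow> 0 \<le> Re (\<Phi> (Suc n) z - \<Phi> n z)"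
    and Im0: "\<And>n. Im (\<Phi> n \<i>) = 0" and bd: "\<And>n. Re (\<Phi> n \<i>) \<le> C"
  obtains F where "F holomorphic_on upper_half_plane"
    "\<And>n z. z \<in> upper_half_plane \<Longrightarrow> 0 \<le> Re (F z - \<Phi> n z)"
    "\<And>n. Im (F \<i> - \<Phi> n \<i>) = 0" "(\<lambda>n. Re (F \<i> - \<Phi> n \<i>)) \<longlonglongrightarrow> 0"
proof -
  have iH: "\<i> \<in> upper_half_plane" by (simp add: upper_half_plane_def)
  have inc: "incseq (\<lambda>n. Re (\<Phi> n z))" if "z \<in> upper_half_plane" for z
    using mono[OF that] by (intro incseq_SucI) simp
  define a where "a n = Re (\<Phi> n \<i>)" for n
  have a: "incseq a" "\<And>n. a n \<le> C" using inc[OF iH] bd by (auto simp: a_def[abs_def])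
  then have "convergent a" by (metis incseq_convergent convergentI)
  then have ca: "Cauchy a" by (rule convergent_Cauchy)
  have har: "cmod (\<Phi> m z - \<Phi> n z) * (cmod (z + \<i>) - cmod (z - \<i>)) \<le> (a m - a n) * (cmod (z + \<i>) + cmod (z - \<i>))"
    if "n \<le> m" "z \<in> upper_half_plane" for m n z
    using harnack_half_plane[of "\<lambda>z. \<Phi> m z - \<Phi> n z" z] incseqD[OF inc that(1)] that(2) Im0
    by (auto simp: a_def intro!: holomorphic_intros hol)
  have unif: "uniformly_convergent_on (cball z r) \<Phi>" if sub: "cball z r \<subseteq> upper_half_plane" and r: "0 \<le> r" for z r
  proof -
    have pos: "0 < cmod (y + \<i>) - cmod (y - \<i>)" if "y \<in> upper_half_plane" for y
    proof -
      have "(cmod (y - \<i>))\<^sup>2 < (cmod (y + \<i>))\<^sup>2"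
        unfolding cmod_power2 using that by (simp add: power2_eq_square algebra_simps upper_half_plane_def)
      then have "cmod (y - \<i>) < cmod (y + \<i>)" by (rule power2_less_imp_less) simp
      then show ?thesis by simp
    qed
    have "continuous_on (cball z r) (\<lambda>y. (cmod (y + \<i>) + cmod (y - \<i>)) / (cmod (y + \<i>) - cmod (y - \<i>)))"
      using pos sub by (intro continuous_intros) (metis less_irrefl subsetD)
    then have "bounded ((\<lambda>y. (cmod (y + \<i>) + cmod (y - \<i>)) / (cmod (y + \<i>) - cmod (y - \<i>))) ` cball z r)"
      by (intro compact_imp_bounded compact_continuous_image) auto
    then obtain K where K: "0 < K" "\<And>y. y \<in> cball z r \<Longrightarrow> (cmod (y + \<i>) + cmod (y - \<i>)) / (cmod (y + \<i>) - cmod (y - \<i>)) \<le> K"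
      unfolding bounded_pos by (auto simp: abs_le_iff)
    have le: "dist (\<Phi> m y) (\<Phi> n y) \<le> (a m - a n) * K" if "n \<le> m" "y \<in> cball z r" for m n y
    proof -
      have y: "y \<in> upper_half_plane" using sub that by auto
      have "cmod (\<Phi> m y - \<Phi> n y) \<le> (a m - a n) * ((cmod (y + \<i>) + cmod (y - \<i>)) / (cmod (y + \<i>) - cmod (y - \<i>)))"
        using har[OF that(1) y] pos[OF y] by (simp add: pos_le_divide_eq)
      also have "\<dots> \<le> (a m - a n) * K"
        using K(2)[OF that(2)] incseqD[OF a(1) that(1)] by (intro mult_left_mono) auto
      finally show ?thesis by (simp add: dist_norm)
    qed
    show ?thesis
      unfolding uniformly_convergent_eq_Cauchy uniformly_Cauchy_on_def
    proof (intro allI impI)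
      fix e :: real assume e: "0 < e"
      then obtain M where M: "\<And>m n. M \<le> m \<Longrightarrow> M \<le> n \<Longrightarrow> \<bar>a m - a n\<bar> < e / K"
        using metric_CauchyD[OF ca, of "e / K"] K(1) by (auto simp: dist_real_def)
      have "dist (\<Phi> m y) (\<Phi> n y) < e" if mn: "M \<le> m" "M \<le> n" "y \<in> cball z r" for m n y
      proof -
        have "dist (\<Phi> m y) (\<Phi> n y) \<le> \<bar>a m - a n\<bar> * K"
        proof (cases "n \<le> m")
          case True
          then show ?thesis using le[OF True mn(3)] incseqD[OF a(1) True] by simp
        next
          case False
          then have "m \<le> n" by simp
          then show ?thesis using le[OF _ mn(3)] incseqD[OF a(1)] by (simp add: dist_commute abs_minus_commute)
        qed
        also have "\<dots> < e" using M[OF mn(1,2)] K(1) by (simp add: pos_less_divide_eq)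
        finally show ?thesis .
      qed
      then show "\<exists>M. \<forall>x\<in>cball z r. \<forall>m\<ge>M. \<forall>n\<ge>M. dist (\<Phi> m x) (\<Phi> n x) < e" by blast
    qed
  qed
  define F where "F z = lim (\<lambda>n. \<Phi> n z)" for z
  have lim: "(\<lambda>n. \<Phi> n z) \<longlonglongrightarrow> F z" if "z \<in> upper_half_plane" for z
  proof -
    have "uniform_limit (cball z 0) \<Phi> F sequentially"
      using unif[of z 0] that unfolding uniformly_convergent_uniform_limit_iff F_def by simp
    then show ?thesis by (rule tendsto_uniform_limitI) simp
  qed
  show thesis
  proof
    show "F holomorphic_on upper_half_plane"
    proof (rule holomorphic_uniform_sequence[OF open_upper_half_plane hol])
      fix z assume "z \<in> upper_half_plane"
      then obtain r where r: "0 < r" "cball z r \<subseteq> upper_half_plane"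
        using open_upper_half_plane open_contains_cball by blast
      then have "uniform_limit (cball z r) \<Phi> F sequentially"
        using unif[of z r] unfolding uniformly_convergent_uniform_limit_iff F_def by simp
      with r show "\<exists>d>0. cball z d \<subseteq> upper_half_plane \<and> uniform_limit (cball z d) \<Phi> F sequentially" by blast
    qed
    show "0 \<le> Re (F z - \<Phi> n z)" if "z \<in> upper_half_plane" for n z
      using incseq_le[OF inc[OF that] tendsto_Re[OF lim[OF that]], of n] by simp
    have "Im (F \<i>) = 0"
      using LIMSEQ_unique[OF tendsto_Im[OF lim[OF iH]]] by (simp add: Im0)
    then show "Im (F \<i> - \<Phi> n \<i>) = 0" for n by (simp add: Im0)
    show "(\<lambda>n. Re (F \<i> - \<Phi> n \<i>)) \<longlonglongrightarrow> 0"
      using tendsto_diff[OF tendsto_const[of "Re (F \<i>)"] tendsto_Re[OF lim[OF iH]]] by simp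
  qed
qed

lemma sum_lessThan_double: "(\<Sum>k<2 * (m::nat). a k) = (\<Sum>k<m. a (2 * k) + a (2 * k + 1))"
  for a :: "nat \<Rightarrow> 'b :: comm_monoid_add"
  by (induction m) (simp_all add: ac_simps)

text \<open>
  \<open>v n k\<close> is the value on the \<open>k\<close>-th dyadic interval of generation \<open>n\<close> of a step function; these
  functions increase with \<open>n\<close>, so the differences of their analytic extensions have nonnegative real part.
\<close>

lemma step_function_boundary:
  fixes v :: "nat \<Rightarrow> nat \<Rightarrow> real"
  assumes v0: "\<And>n k. k < 2 ^ n \<Longrightarrow> 0 \<le> v n k"
    and v1: "\<And>n k. k < 2 ^ n \<Longrightarrow> v n k \<le> v (Suc n) (2 * k)"
    and v2: "\<And>n k. k < 2 ^ n \<Longrightarrow> v n k \<le> v (Suc n) (2 * k + 1)"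
    and bd: "\<And>n. (\<Sum>k<2 ^ n. v n k / 2 ^ n) \<le> C"
    and N: "countable N"
    and lim: "\<And>t. 0 < t \<Longrightarrow> t < 1 \<Longrightarrow> t \<notin> N \<Longrightarrow> (\<lambda>n. v n (nat \<lfloor>t * 2 ^ n\<rfloor>)) \<longlonglongrightarrow> \<psi> t"
  shows "\<exists>F. F holomorphic_on upper_half_plane \<and> (\<forall>(M :: 'a measure) W. planar_brownian_motion M W \<i> \<longrightarrow>
     (AE \<omega> in M. \<exists>T x l. exits_at (\<lambda>t. W t \<omega>) T x \<and> ((\<lambda>s. F (W s \<omega>)) \<longlongrightarrow> l) (at_left T) \<and> Re l = \<psi> (cauchy_cdf x)))"
proof -
  \<comment> \<open>The real part of each difference is the harmonic measure of an interval of
    Cauchy mass \<open>1 / 2 ^ n\<close>, so the value at \<open>\<i>\<close> is the mean of the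
    step function.\<close>
  define \<Phi> where "\<Phi> n z = (\<Sum>k<2 ^ n. of_real (v n k) * (half_line_fun (real k / 2 ^ n) z - half_line_fun (real (Suc k) / 2 ^ n) z))"
    for n z
  have hol: "\<Phi> n holomorphic_on upper_half_plane" for n
    unfolding \<Phi>_def[abs_def] by (intro holomorphic_intros holomorphic_half_line_fun)
  have mono: "0 \<le> Re (\<Phi> (Suc n) z - \<Phi> n z)" if z: "z \<in> upper_half_plane" for n z
  proof -
    define a where "a s = Re (half_line_fun s z)" for s
    have a: "s \<le> t \<Longrightarrow> a t \<le> a s" for s t
      unfolding a_def by (rule Re_half_line_fun_antimono[OF z])
    have Re\<Phi>: "Re (\<Phi> n z) = (\<Sum>k<2 ^ n. v n k * (a (real k / 2 ^ n) - a (real (Suc k) / 2 ^ n)))" for n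
      by (simp add: \<Phi>_def a_def)
    have "Re (\<Phi> n z) \<le> Re (\<Phi> (Suc n) z)"
      unfolding Re\<Phi> power_Suc sum_lessThan_double
    proof (rule sum_mono)
      fix k :: nat assume "k \<in> {..<2 ^ n}"
      then have k: "k < 2 ^ n" by simp
      \<comment> \<open>Harmonic measures of the half-lines that start at the left end, the midpoint
        and the right end of the \<open>k\<close>-th dyadic interval; \<open>A - B\<close> and
        \<open>B - D\<close> belong to its two halves.\<close>
      define A B D where "A = a (real k / 2 ^ n)" and "B = a (real (2 * k + 1) / (2 * 2 ^ n))"
        and "D = a (real (Suc k) / 2 ^ n)"
      have AB: "B \<le> A" "D \<le> B" unfolding A_def B_def D_def by (auto intro!: a simp: field_simps)
      have e1: "a (real (2 * k) / (2 * 2 ^ n)) = A" by (simp add: A_def)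
      have "real (Suc (2 * k + 1)) / (2 * 2 ^ n) = real (Suc k) / 2 ^ n" by (simp add: field_simps)
      then have e2: "a (real (Suc (2 * k + 1)) / (2 * 2 ^ n)) = D" by (simp only: D_def)
      have e3: "a (real (Suc (2 * k)) / (2 * 2 ^ n)) = B" by (simp add: B_def add.commute)
      have "v n k * (A - D) = v n k * (A - B) + v n k * (B - D)" by (simp add: algebra_simps)
      also have "\<dots> \<le> v (Suc n) (2 * k) * (A - B) + v (Suc n) (2 * k + 1) * (B - D)"
        using AB v1[OF k] v2[OF k] by (intro add_mono mult_right_mono) auto
      finally show "v n k * (a (real k / 2 ^ n) - a (real (Suc k) / 2 ^ n)) \<le>
         v (Suc n) (2 * k) * (a (real (2 * k) / (2 * 2 ^ n)) - a (real (Suc (2 * k)) / (2 * 2 ^ n))) +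
         v (Suc n) (2 * k + 1) * (a (real (2 * k + 1) / (2 * 2 ^ n)) - a (real (Suc (2 * k + 1)) / (2 * 2 ^ n)))"
        unfolding e1 e2 e3 A_def[symmetric] B_def[symmetric] D_def[symmetric] .
    qed
    then show ?thesis by simp
  qed
  have \<Phi>i: "\<Phi> n \<i> = of_real (\<Sum>k<2 ^ n. v n k / 2 ^ n)" for n
  proof -
    have "real (Suc k) \<le> 2 ^ n" if "k < 2 ^ n" for k
      using that by (metis Suc_leI of_nat_le_iff of_nat_numeral of_nat_power)
    then have "half_line_fun (real k / 2 ^ n) \<i> - half_line_fun (real (Suc k) / 2 ^ n) \<i> = of_real (1 / 2 ^ n)" if "k < 2 ^ n" for k
      using that by (subst (1 2) half_line_fun_ii) (auto simp: field_simps)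
    then show ?thesis by (simp add: \<Phi>_def)
  qed
  obtain F where F: "F holomorphic_on upper_half_plane"
    "\<And>n z. z \<in> upper_half_plane \<Longrightarrow> 0 \<le> Re (F z - \<Phi> n z)"
    "\<And>n. Im (F \<i> - \<Phi> n \<i>) = 0" "(\<lambda>n. Re (F \<i> - \<Phi> n \<i>)) \<longlonglongrightarrow> 0"
    by (rule holomorphic_increasing_limit[where \<Phi> = \<Phi> and C = C, OF hol mono]) (use bd \<Phi>i in auto)
  \<comment> \<open>The dyadic points are added because the functions \<open>half_line_fun\<close>
    are singular there.\<close>
  define N' where "N' = N \<union> range (\<lambda>(k::nat, n::nat). real k / 2 ^ n)"
  have N': "countable N'" unfolding N'_def using N by auto
  have bdry: "\<exists>l. (\<Phi> n \<longlongrightarrow> l) (at (of_real x) within upper_half_plane) \<and> Re l = v n (nat \<lfloor>cauchy_cdf x * 2 ^ n\<rfloor>)"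
    if x: "cauchy_cdf x \<notin> N'" for n x
  proof -
    define t where "t = cauchy_cdf x"
    have t: "0 < t" "t < 1" using cauchy_cdf_bounds by (auto simp: t_def)
    have tne: "t \<noteq> real k / 2 ^ n" for k
    proof
      assume "t = real k / 2 ^ n"
      then have "t \<in> range (\<lambda>(k::nat, n::nat). real k / 2 ^ n)" by (intro image_eqI[of _ _ "(k, n)"]) auto
      with x show False by (simp add: N'_def t_def)
    qed
    have "\<forall>k. \<exists>l. (half_line_fun (real k / 2 ^ n) \<longlongrightarrow> l) (at (of_real x) within upper_half_plane) \<and>
       Re l = (if real k / 2 ^ n < t then 1 else 0)"
      using half_line_fun_boundary tne unfolding t_def by metis
    then obtain L where L: "\<And>k. (half_line_fun (real k / 2 ^ n) \<longlongrightarrow> L k) (at (of_real x) within upper_half_plane)"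
       "\<And>k. Re (L k) = (if real k / 2 ^ n < t then 1 else 0)" by metis
    define j where "j = nat \<lfloor>t * 2 ^ n\<rfloor>"
    have "real j \<le> t * 2 ^ n" "t * 2 ^ n < real j + 1" using t by (auto simp: j_def)
    moreover have "real j \<noteq> t * 2 ^ n" using tne[of j] by (auto simp: field_simps)
    ultimately have j: "real j < t * 2 ^ n" "t * 2 ^ n < real j + 1" by auto
    have j2: "j < 2 ^ n"
    proof -
      have "t * 2 ^ n < 1 * 2 ^ n" using t by (intro mult_strict_right_mono) auto
      then have "real j < 2 ^ n" using j by linarith
      then show ?thesis by (metis of_nat_less_iff of_nat_numeral of_nat_power)
    qed
    \<comment> \<open>The real parts drop from 1 to 0 after \<open>k = j\<close>, so exactly one
      difference in the sum survives.\<close>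
    have ReL: "Re (L k) = (if k \<le> j then 1 else 0)" for k
    proof -
      have "real k / 2 ^ n < t \<longleftrightarrow> real k < t * 2 ^ n" by (simp add: field_simps)
      also have "\<dots> \<longleftrightarrow> k \<le> j" using j by linarith
      finally show ?thesis by (simp add: L(2))
    qed
    have "(\<Phi> n \<longlongrightarrow> (\<Sum>k<2 ^ n. of_real (v n k) * (L k - L (Suc k)))) (at (of_real x) within upper_half_plane)"
      unfolding \<Phi>_def[abs_def] by (intro tendsto_intros L(1))
    moreover have "Re (\<Sum>k<2 ^ n. of_real (v n k) * (L k - L (Suc k))) = (\<Sum>k<2 ^ n. if j = k then v n k else 0)"
      unfolding Re_sum by (intro sum.cong) (auto simp: ReL)
    moreover have "\<dots> = v n j" using j2 by simp
    ultimately show ?thesis unfolding j_def t_def by auto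
  qed
  have "AE \<omega> in M. \<exists>T x l. exits_at (\<lambda>t. W t \<omega>) T x \<and> ((\<lambda>s. F (W s \<omega>)) \<longlongrightarrow> l) (at_left T) \<and> Re l = \<psi> (cauchy_cdf x)"
    if W: "planar_brownian_motion M W \<i>" for M :: "'a measure" and W
  proof -
    have lim': "(\<lambda>n. v n (nat \<lfloor>cauchy_cdf x * 2 ^ n\<rfloor>)) \<longlonglongrightarrow> \<psi> (cauchy_cdf x)" if "cauchy_cdf x \<notin> N'" for x
      using that cauchy_cdf_bounds[of x] by (intro lim) (auto simp: N'_def)
    have "AE \<omega> in M. \<exists>T x l. exits_at (\<lambda>t. W t \<omega>) T x \<and> cauchy_cdf x \<notin> N' \<and>
       ((\<lambda>s. F (W s \<omega>)) \<longlongrightarrow> l) (at_left T) \<and> Re l = \<psi> (cauchy_cdf x)"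
      by (rule AE_boundary_limit[where \<Phi> = \<Phi> and v = "\<lambda>n t. v n (nat \<lfloor>t * 2 ^ n\<rfloor>)", OF W])
        (assumption | rule hol F N' bdry lim')+
    then show ?thesis by eventually_elim blast
  qed
  then show ?thesis using F(1) by blast
qed

section \<open>Measurability of the terminal value\<close>

lemma le_of_le_on_rationals:
  fixes g :: "real \<Rightarrow> real"
  assumes cont: "continuous_on {a..<b} g" and le: "\<And>s. s \<in> \<rat> \<Longrightarrow> a < s \<Longrightarrow> s < b \<Longrightarrow> g s \<le> c"
    and r: "a \<le> r" "r < b"
  shows "g r \<le> c"
proof (rule ccontr)
  assume n: "\<not> g r \<le> c"
  have "continuous (at r within {a..<b}) g" using cont r by (auto simp: continuous_on_eq_continuous_within)
  then obtain d where d: "0 < d" "\<And>s. s \<in> {a..<b} \<Longrightarrow> dist s r < d \<Longrightarrow> dist (g s) (g r) < g r - c"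
    unfolding continuous_within_eps_delta using n by (metis diff_gt_0_iff_gt not_le)
  obtain s where s: "s \<in> \<rat>" "r < s" "s < min b (r + d)"
    using Rats_dense_in_real[of r "min b (r + d)"] r d(1) by auto
  then have "dist (g s) (g r) < g r - c" using d(2)[of s] r by (auto simp: dist_real_def)
  moreover have "g s \<le> c" using le[of s] s r by auto
  ultimately show False by (simp add: dist_real_def)
qed

text \<open>Positivity at rational times would miss a zero at an irrational time. On a compact
  interval, however, positivity amounts to a lower bound \<open>1 / (m + 1)\<close>, and such a
  closed condition can be tested on rationals.\<close>

lemma alive_iff_rationals:
  assumes cont: "continuous_on {0..} w" and q: "0 \<le> q"
  shows "alive w q \<longleftrightarrow> (\<exists>m::nat. inverse (real (Suc m)) \<le> Im (w q) \<and>
     (\<forall>s\<in>\<rat>. 0 \<le> s \<and> s < q \<longrightarrow> inverse (real (Suc m)) \<le> Im (w s)))"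
proof
  assume a: "alive w q"
  have "\<exists>r\<in>{0..q}. \<forall>r'\<in>{0..q}. Im (w r) \<le> Im (w r')"
    using q by (intro continuous_attains_inf continuous_on_Im continuous_on_subset[OF cont]) auto
  then obtain \<eta> where \<eta>: "0 < \<eta>" "\<And>r. r \<in> {0..q} \<Longrightarrow> \<eta> \<le> Im (w r)"
    using a unfolding alive_def upper_half_plane_def by blast
  obtain m where "inverse (real (Suc m)) < \<eta>" using reals_Archimedean[OF \<eta>(1)] by blast
  then show "\<exists>m::nat. inverse (real (Suc m)) \<le> Im (w q) \<and>
     (\<forall>s\<in>\<rat>. 0 \<le> s \<and> s < q \<longrightarrow> inverse (real (Suc m)) \<le> Im (w s))"
    using \<eta>(2) q by (intro exI[of _ m]) (force simp del: of_nat_Suc)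
next
  assume "\<exists>m::nat. inverse (real (Suc m)) \<le> Im (w q) \<and>
     (\<forall>s\<in>\<rat>. 0 \<le> s \<and> s < q \<longrightarrow> inverse (real (Suc m)) \<le> Im (w s))"
  then obtain m :: nat where m: "inverse (real (Suc m)) \<le> Im (w q)"
     "\<And>s. s \<in> \<rat> \<Longrightarrow> 0 \<le> s \<Longrightarrow> s < q \<Longrightarrow> inverse (real (Suc m)) \<le> Im (w s)" by blast
  have le: "inverse (real (Suc m)) \<le> Im (w r)" if "0 \<le> r" "r \<le> q" for r
  proof (cases "r = q")
    case False
    have "- Im (w r) \<le> - inverse (real (Suc m))"
      by (rule le_of_le_on_rationals[of 0 q "\<lambda>r. - Im (w r)"])
        (use m(2) that False in \<open>auto intro!: continuous_on_minus continuous_on_Im continuous_on_subset[OF cont]\<close>)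
    then show ?thesis by simp
  qed (use m in auto)
  have "0 < Im (w r)" if "0 \<le> r" "r \<le> q" for r
    by (rule less_le_trans[OF _ le[OF that]]) simp
  then show "alive w q"
    using q unfolding alive_def upper_half_plane_def mem_Collect_eq atLeastAtMost_iff Ball_def by blast
qed

text \<open>This expresses behaviour just before the exit by countably many quantifiers, for the
  sake of measurability. The weak inequality \<open>\<le> c\<close> passes from rational to all
  times by continuity.\<close>

lemma eventually_at_left_exit_iff:
  fixes \<phi> :: "complex \<Rightarrow> real"
  assumes cont: "continuous_on {0..} w" and w0: "w 0 \<in> upper_half_plane"
    and \<phi>: "continuous_on upper_half_plane \<phi>"
  shows "(\<forall>\<^sub>F s in at_left (exit_time upper_half_plane w). \<phi> (w (real_of_ereal s)) \<le> c) \<longleftrightarrow>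
     (\<exists>q\<in>\<rat>. 0 \<le> q \<and> alive w q \<and> (\<forall>s\<in>\<rat>. q < s \<and> alive w s \<longrightarrow> \<phi> (w s) \<le> c))"
    (is "?L \<longleftrightarrow> ?R")
    and "at_left (exit_time upper_half_plane w) \<noteq> bot"
proof -
  let ?T = "exit_time upper_half_plane w"
  note al = less_exit_time_iff[OF cont]
  have "alive w 0" using w0 by (simp add: alive_def)
  then have T0: "0 < ?T" using al[of 0] by (simp add: zero_ereal_def)
  note ev = eventually_at_left[OF T0]
  show "at_left ?T \<noteq> bot"
  proof
    assume "at_left ?T = bot"
    then have "\<forall>\<^sub>F s in at_left ?T. False" by simp
    then obtain b where "b < ?T" "\<And>y. b < y \<Longrightarrow> \<not> y < ?T" unfolding ev by blast
    then show False using dense by blast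
  qed
  show "?L \<longleftrightarrow> ?R"
  proof
    assume ?L
    then obtain b where b: "b < ?T" "\<And>y. b < y \<Longrightarrow> y < ?T \<Longrightarrow> \<phi> (w (real_of_ereal y)) \<le> c"
      unfolding ev by blast
    have "max b 0 < ?T" using b(1) T0 by simp
    then obtain q where q: "max b 0 < ereal (real_of_rat q)" "ereal (real_of_rat q) < ?T"
      using ereal_dense3 by blast
    have q0: "0 \<le> real_of_rat q" using q(1) by (simp add: zero_ereal_def less_imp_le)
    show ?R
    proof (intro bexI[of _ "real_of_rat q"] conjI ballI impI)
      show "alive w (real_of_rat q)" using al[OF q0] q(2) by simp
      fix s assume s: "real_of_rat q < s \<and> alive w s"
      then have "b < ereal s" using q(1) by (meson ereal_less_ereal_Ex less_ereal.simps(1) less_trans max_less_iff_conj)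
      moreover have "ereal s < ?T" using al[of s] s q0 by simp
      ultimately show "\<phi> (w s) \<le> c" using b(2)[of "ereal s"] by simp
    qed (use q0 in auto)
  next
    assume ?R
    then obtain q where q: "0 \<le> q" "alive w q" "\<And>s. s \<in> \<rat> \<Longrightarrow> q < s \<Longrightarrow> alive w s \<Longrightarrow> \<phi> (w s) \<le> c" by blast
    show ?L
      unfolding ev
    proof (intro exI[of _ "ereal q"] conjI allI impI)
      show "ereal q < ?T" using al q by simp
      fix y assume y: "ereal q < y" "y < ?T"
      then obtain s where s: "y = ereal s" by (cases y) auto
      with y have qs: "q < s" "ereal s < ?T" by auto
      obtain q' where q': "ereal s < ereal q'" "ereal q' < ?T" using ereal_dense2[OF qs(2)] by blast
      have aq': "alive w q'" using al[of q'] q' qs q(1) by simp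
      have "continuous_on {s..<q'} (\<lambda>s. \<phi> (w s))"
      proof (rule continuous_on_compose2[OF \<phi>])
        show "continuous_on {s..<q'} w" by (rule continuous_on_subset[OF cont]) (use qs q in auto)
        show "w ` {s..<q'} \<subseteq> upper_half_plane" using aq' qs q(1) by (auto simp: alive_def)
      qed
      then have "\<phi> (w s) \<le> c"
      proof (rule le_of_le_on_rationals)
        fix s' assume "s' \<in> \<rat>" "s < s'" "s' < q'"
        moreover have "alive w s'" using aq' \<open>s' < q'\<close> \<open>s < s'\<close> qs q(1) by (auto simp: alive_def)
        ultimately show "\<phi> (w s') \<le> c" using q(3) qs by auto
      qed (use q' in auto)
      then show "\<phi> (w (real_of_ereal y)) \<le> c" by (simp add: s)
    qed
  qed
qed

text \<open>
  Since the probability space need not be complete, measurability has to be checked also for paths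
  without terminal value, where \<^const>\<open>Lim\<close> is the fixed junk value \<open>THE l. False\<close>.
\<close>

lemma terminal_value_measurable:
  assumes W: "planar_brownian_motion M W z0" and z0: "z0 \<in> upper_half_plane"
    and f: "continuous_on upper_half_plane f"
  shows "{\<omega>\<in>space M. cmod (Lim (at_left (exit_time upper_half_plane (\<lambda>t. W t \<omega>)))
     (\<lambda>s. f (W (real_of_ereal s) \<omega>))) \<le> r} \<in> sets M"
proof -
  note basic = planar_brownian_motion_basic[OF W]
  let ?w = "\<lambda>\<omega> t. W t \<omega>"
  let ?F = "\<lambda>\<omega>. at_left (exit_time upper_half_plane (?w \<omega>))"
  let ?g = "\<lambda>\<omega> s. f (W (real_of_ereal s) \<omega>)"
  have w0: "?w \<omega> 0 \<in> upper_half_plane" if "\<omega> \<in> space M" for \<omega> using basic(3)[OF that] z0 by simp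
  note cont = basic(4)
  have alive_meas: "Measurable.pred M (\<lambda>\<omega>. alive (?w \<omega>) q)" if q: "0 \<le> q" for q
  proof -
    have [measurable]: "W s \<in> borel_measurable M" if "0 \<le> s" for s by (rule basic(2)[OF that])
    have "Measurable.pred M (\<lambda>\<omega>. \<exists>m::nat. inverse (real (Suc m)) \<le> Im (W q \<omega>) \<and>
     (\<forall>s\<in>\<rat>. 0 \<le> s \<and> s < q \<longrightarrow> inverse (real (Suc m)) \<le> Im (W s \<omega>)))"
    proof (rule pred_intros_countable)
      fix m :: nat
      have pt: "Measurable.pred M (\<lambda>\<omega>. 0 \<le> s \<and> s < q \<longrightarrow> inverse (real (Suc m)) \<le> Im (W s \<omega>))" for s
        by (cases "0 \<le> s \<and> s < q") auto
      have [measurable]: "Measurable.pred M (\<lambda>\<omega>. \<forall>s\<in>\<rat>. 0 \<le> s \<and> s < q \<longrightarrow> inverse (real (Suc m)) \<le> Im (W s \<omega>))"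
        by (intro measurable_pred_countable countable_rat pt)
      have [measurable]: "Measurable.pred M (\<lambda>\<omega>. inverse (real (Suc m)) \<le> Im (W q \<omega>))" using q by measurable
      show "Measurable.pred M (\<lambda>\<omega>. inverse (real (Suc m)) \<le> Im (W q \<omega>) \<and>
          (\<forall>s\<in>\<rat>. 0 \<le> s \<and> s < q \<longrightarrow> inverse (real (Suc m)) \<le> Im (W s \<omega>)))"
        by measurable
    qed
    then show ?thesis
      by (subst measurable_cong[OF alive_iff_rationals[OF cont q]]) auto
  qed
  have ev_meas: "Measurable.pred M (\<lambda>\<omega>. \<forall>\<^sub>F s in ?F \<omega>. cmod (?g \<omega> s - a) \<le> c)" for a c
  proof -
    have \<phi>: "continuous_on upper_half_plane (\<lambda>z. cmod (f z - a))" by (intro continuous_intros f)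
    have "(\<lambda>z. if z \<in> upper_half_plane then cmod (f z - a) else 0) \<in> borel_measurable borel"
      by (intro borel_measurable_continuous_on_if \<phi>) (use open_upper_half_plane in auto)
    \<comment> \<open>\<open>f\<close> is controlled only on the half-plane, so a guard is built in
      to obtain a measurable function; at times when the path is alive the guard is true.\<close>
    then have m: "(\<lambda>\<omega>. if W s \<omega> \<in> upper_half_plane then cmod (f (W s \<omega>) - a) else 0) \<in> borel_measurable M"
      if "0 \<le> s" for s
      by (rule measurable_compose[OF basic(2)[OF that]])
    have "Measurable.pred M (\<lambda>\<omega>. \<exists>q\<in>\<rat>. 0 \<le> q \<and> alive (?w \<omega>) q \<and> (\<forall>s\<in>\<rat>. q < s \<and> alive (?w \<omega>) s \<longrightarrow>
        (if W s \<omega> \<in> upper_half_plane then cmod (f (W s \<omega>) - a) else 0) \<le> c))"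
    proof (intro measurable_pred_countable countable_rat)
      fix q :: real
      show "Measurable.pred M (\<lambda>\<omega>. 0 \<le> q \<and> alive (?w \<omega>) q \<and> (\<forall>s\<in>\<rat>. q < s \<and> alive (?w \<omega>) s \<longrightarrow>
        (if W s \<omega> \<in> upper_half_plane then cmod (f (W s \<omega>) - a) else 0) \<le> c))"
      proof (cases "0 \<le> q")
        case True
        note [measurable] = alive_meas[OF True]
        have pt: "Measurable.pred M (\<lambda>\<omega>. q < s \<and> alive (?w \<omega>) s \<longrightarrow>
          (if W s \<omega> \<in> upper_half_plane then cmod (f (W s \<omega>) - a) else 0) \<le> c)" for s
        proof (cases "q < s")
          case qs: True
          then have "0 \<le> s" using True by simp
          note [measurable] = m[OF this] alive_meas[OF this]
          show ?thesis by measurable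
        qed simp
        have [measurable]: "Measurable.pred M (\<lambda>\<omega>. \<forall>s\<in>\<rat>. q < s \<and> alive (?w \<omega>) s \<longrightarrow>
          (if W s \<omega> \<in> upper_half_plane then cmod (f (W s \<omega>) - a) else 0) \<le> c)"
          by (intro measurable_pred_countable countable_rat pt)
        show ?thesis by measurable
      qed simp
    qed
    moreover have "(\<forall>\<^sub>F s in ?F \<omega>. cmod (?g \<omega> s - a) \<le> c) \<longleftrightarrow>
       (\<exists>q\<in>\<rat>. 0 \<le> q \<and> alive (?w \<omega>) q \<and> (\<forall>s\<in>\<rat>. q < s \<and> alive (?w \<omega>) s \<longrightarrow>
        (if W s \<omega> \<in> upper_half_plane then cmod (f (W s \<omega>) - a) else 0) \<le> c))" if "\<omega> \<in> space M" for \<omega>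
    proof -
      have al: "W s \<omega> \<in> upper_half_plane" if "alive (?w \<omega>) s" for s using that by (simp add: alive_def)
      show ?thesis
        unfolding eventually_at_left_exit_iff(1)[OF cont[OF that] w0[OF that] \<phi>]
        by (intro bex_cong conj_cong ball_cong imp_cong refl) (simp add: al)
    qed
    ultimately show ?thesis by (subst measurable_cong) auto
  qed
  obtain C :: "complex set" where C: "countable C" "\<And>X. open X \<Longrightarrow> X \<noteq> {} \<Longrightarrow> \<exists>d\<in>C. d \<in> X"
    using countable_dense_exists[where 'a=complex] by blast
  \<comment> \<open>The Cauchy criterion with centres in a countable dense set, so that existence of
    the limit becomes a countable condition.\<close>
  define conv where "conv \<omega> \<longleftrightarrow> (\<forall>k::nat. \<exists>a\<in>C. \<forall>\<^sub>F s in ?F \<omega>. cmod (?g \<omega> s - a) \<le> inverse (real (Suc k)))" for \<omega>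
  \<comment> \<open>The slack is needed because the modulus may approach the value \<open>r\<close>
    from above.\<close>
  define small where "small \<omega> \<longleftrightarrow> (\<forall>k::nat. \<forall>\<^sub>F s in ?F \<omega>. cmod (?g \<omega> s - 0) \<le> r + inverse (real (Suc k)))" for \<omega>
  have conv_iff: "conv \<omega> \<longleftrightarrow> (\<exists>l. (?g \<omega> \<longlongrightarrow> l) (?F \<omega>))" if \<omega>: "\<omega> \<in> space M" for \<omega>
  proof
    assume c: "conv \<omega>"
    show "\<exists>l. (?g \<omega> \<longlongrightarrow> l) (?F \<omega>)"
    proof (rule convergent_if_eventually_close)
      show "?F \<omega> \<noteq> bot" by (rule eventually_at_left_exit_iff(2)[OF cont[OF \<omega>] w0[OF \<omega>] f[THEN continuous_on_norm]])
      fix e :: real assume "0 < e"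
      then obtain k where k: "inverse (real (Suc k)) < e" using reals_Archimedean by blast
      obtain a where "\<forall>\<^sub>F s in ?F \<omega>. cmod (?g \<omega> s - a) \<le> inverse (real (Suc k))" using c unfolding conv_def by blast
      then have "\<forall>\<^sub>F s in ?F \<omega>. cmod (?g \<omega> s - a) \<le> e" by eventually_elim (use k in linarith)
      then show "\<exists>a. \<forall>\<^sub>F s in ?F \<omega>. cmod (?g \<omega> s - a) \<le> e" by blast
    qed
  next
    assume "\<exists>l. (?g \<omega> \<longlongrightarrow> l) (?F \<omega>)"
    then obtain l where l: "(?g \<omega> \<longlongrightarrow> l) (?F \<omega>)" by blast
    show "conv \<omega>"
      unfolding conv_def
    proof
      fix k :: nat
      define e where "e = inverse (real (Suc k))"
      have e: "0 < e" by (simp add: e_def)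
      obtain a where a: "a \<in> C" "a \<in> ball l (e/2)" using C(2)[of "ball l (e/2)"] e by auto
      have "\<forall>\<^sub>F s in ?F \<omega>. dist (?g \<omega> s) l < e / 2" using l e by (intro tendstoD) auto
      then have "\<forall>\<^sub>F s in ?F \<omega>. cmod (?g \<omega> s - a) \<le> e"
      proof eventually_elim
        case (elim s)
        then show ?case using a(2) dist_triangle[of "?g \<omega> s" a l] by (simp add: dist_norm)
      qed
      then show "\<exists>a\<in>C. \<forall>\<^sub>F s in ?F \<omega>. cmod (?g \<omega> s - a) \<le> inverse (real (Suc k))"
        using a(1) unfolding e_def by blast
    qed
  qed
  have iff: "cmod (Lim (?F \<omega>) (?g \<omega>)) \<le> r \<longleftrightarrow> (conv \<omega> \<and> small \<omega>) \<or> (\<not> conv \<omega> \<and> cmod (THE l. False) \<le> r)"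
    if \<omega>: "\<omega> \<in> space M" for \<omega>
  proof (cases "conv \<omega>")
    case True
    then obtain l where l: "(?g \<omega> \<longlongrightarrow> l) (?F \<omega>)" using conv_iff[OF \<omega>] by blast
    have ne: "?F \<omega> \<noteq> bot" by (rule eventually_at_left_exit_iff(2)[OF cont[OF \<omega>] w0[OF \<omega>] f[THEN continuous_on_norm]])
    have L: "Lim (?F \<omega>) (?g \<omega>) = l" by (rule tendsto_Lim[OF ne l])
    have "cmod l \<le> r \<longleftrightarrow> small \<omega>"
    proof
      assume lr: "cmod l \<le> r"
      show "small \<omega>"
        unfolding small_def
      proof
        fix k :: nat
        have "r < r + inverse (real (Suc k))" by simp
        then have "\<forall>\<^sub>F s in ?F \<omega>. cmod (?g \<omega> s) < r + inverse (real (Suc k))"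
          using lr by (intro order_tendstoD(2)[OF tendsto_norm[OF l]]) linarith
        then show "\<forall>\<^sub>F s in ?F \<omega>. cmod (?g \<omega> s - 0) \<le> r + inverse (real (Suc k))"
          by eventually_elim simp
      qed
    next
      assume s: "small \<omega>"
      have "cmod (l - 0) \<le> r + inverse (real (Suc k))" for k
        by (rule limit_close[OF ne l]) (use s in \<open>auto simp: small_def\<close>)
      then have "cmod l - r \<le> inverse (real (Suc k))" for k by (simp add: algebra_simps)
      then have "cmod l - r \<le> 0"
        by (intro LIMSEQ_le_const[OF LIMSEQ_inverse_real_of_nat]) auto
      then show "cmod l \<le> r" by simp
    qed
    then show ?thesis using True L by simp
  next
    case False
    then have "\<And>l. \<not> (?g \<omega> \<longlongrightarrow> l) (?F \<omega>)" using conv_iff[OF \<omega>] by blast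
    then have "Lim (?F \<omega>) (?g \<omega>) = (THE l. False)" unfolding Topological_Spaces.Lim_def by simp
    then show ?thesis using False by simp
  qed
  have [measurable]: "Measurable.pred M conv"
    unfolding conv_def[abs_def] by (intro pred_intros_countable measurable_pred_countable C(1) ev_meas)
  have [measurable]: "Measurable.pred M small"
    unfolding small_def[abs_def] by (intro pred_intros_countable ev_meas)
  have "{\<omega>\<in>space M. cmod (Lim (?F \<omega>) (?g \<omega>)) \<le> r} =
     {\<omega>\<in>space M. (conv \<omega> \<and> small \<omega>) \<or> (\<not> conv \<omega> \<and> cmod (THE l. False) \<le> r)}"
    using iff by blast
  also have "\<dots> \<in> sets M" by measurable
  finally show ?thesis .
qed

section \<open>The generalised inverse and its boundary function\<close>

text \<open>The limit 1 and \<open>s < 1\<close> make the set nonempty, and right continuity puts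
  its infimum into it; the equivalence then follows from monotonicity.\<close>

lemma gen_inverse_facts:
  fixes h :: "real \<Rightarrow> real"
  assumes rc: "\<And>r. 0 \<le> r \<Longrightarrow> continuous (at_right r) h" and inc: "mono_on {0..} h"
    and lim: "(h \<longlongrightarrow> 1) at_top" and s: "0 < s" "s < 1"
  shows gen_inverse_nonneg: "0 \<le> gen_inverse h s"
    and gen_inverse_le_iff: "0 \<le> r \<Longrightarrow> gen_inverse h s \<le> r \<longleftrightarrow> s \<le> h r"
proof -
  define S where "S = {r. 0 \<le> r \<and> s \<le> h r}"
  have "\<forall>\<^sub>F r in at_top. s < h r \<and> 0 \<le> r"
    using order_tendstoD(1)[OF lim s(2)] eventually_ge_at_top[of 0] by eventually_elim auto
  then obtain r0 where "s < h r0" "0 \<le> r0" by (auto simp: eventually_at_top_linorder)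
  then have ne: "S \<noteq> {}" by (auto simp: S_def intro!: exI[of _ r0])
  have bd: "bdd_below S" by (auto simp: bdd_below_def S_def)
  have g: "gen_inverse h s = Inf S" by (simp add: gen_inverse_def S_def)
  show nn: "0 \<le> gen_inverse h s" unfolding g by (rule cInf_greatest[OF ne]) (auto simp: S_def)
  show "gen_inverse h s \<le> r \<longleftrightarrow> s \<le> h r" if r: "0 \<le> r"
  proof
    assume "s \<le> h r"
    then show "gen_inverse h s \<le> r" unfolding g using r by (intro cInf_lower bd) (auto simp: S_def)
  next
    assume le: "gen_inverse h s \<le> r"
    have "s \<le> h r'" if r': "Inf S < r'" for r'
    proof -
      obtain r'' where "r'' \<in> S" "r'' < r'" using cInf_lessD[OF ne r'] by blast
      then show ?thesis using mono_onD[OF inc, of r'' r'] by (auto simp: S_def)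
    qed
    then have "\<forall>\<^sub>F r' in at_right (Inf S). s \<le> h r'" by (simp add: eventually_at_filter)
    moreover have "(h \<longlongrightarrow> h (Inf S)) (at_right (Inf S))"
      using rc[OF nn] unfolding g by (simp add: continuous_within)
    ultimately have "s \<le> h (Inf S)" by (intro tendsto_lowerbound) auto
    also have "\<dots> \<le> h r" using le nn r mono_onD[OF inc, of "Inf S" r] unfolding g by auto
    finally show "s \<le> h r" .
  qed
qed

text \<open>The comparison concerns open dyadic intervals only, so the end points 0 and 1, where the
  boundary function need not follow its monotone pattern, are never tested.\<close>

lemma dyadic_sum_le_integral:
  fixes w :: "nat \<Rightarrow> real"
  assumes int: "set_integrable lborel {0..1} u" and u0: "\<And>s. 0 \<le> u s"
    and le: "\<And>k s. k < 2 ^ n \<Longrightarrow> real k / 2 ^ n < s \<Longrightarrow> s < real (Suc k) / 2 ^ n \<Longrightarrow> w k \<le> u s"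
  shows "(\<Sum>k<2 ^ n. w k / 2 ^ n) \<le> set_lebesgue_integral lborel {0..1} u"
proof -
  define I where "I k = {real k / 2 ^ n <..< real (Suc k) / 2 ^ n}" for k
  have hI: "has_bochner_integral lborel (\<lambda>s. w k * indicator (I k) s) (w k * (1 / 2 ^ n))" for k
  proof -
    have "measure lborel (I k) = 1 / 2 ^ n" by (simp add: I_def divide_right_mono diff_divide_distrib[symmetric])
    moreover have "emeasure lborel (I k) < \<infinity>" by (simp add: I_def emeasure_lborel_Ioo divide_right_mono)
    ultimately show ?thesis
      using has_bochner_integral_real_indicator[of "I k" lborel] by (intro has_bochner_integral_mult_right) (simp_all add: I_def)
  qed
  have hS: "has_bochner_integral lborel (\<lambda>s. \<Sum>k<2 ^ n. w k * indicator (I k) s) (\<Sum>k<2 ^ n. w k * (1 / 2 ^ n))"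
    by (intro has_bochner_integral_sum hI)
  have pt: "(\<Sum>k<2 ^ n. w k * indicator (I k) s) \<le> indicator {0..1} s *\<^sub>R u s" for s
  proof -
    define j where "j = nat \<lfloor>s * 2 ^ n\<rfloor>"
    have "k = j" if "s \<in> I k" for k
    proof -
      have "real k < s * 2 ^ n" "s * 2 ^ n < real k + 1" using that by (auto simp: I_def field_simps)
      then show ?thesis unfolding j_def by linarith
    qed
    then have "(\<Sum>k<2 ^ n. w k * indicator (I k) s) = (\<Sum>k<2 ^ n. if j = k then w k * indicator (I k) s else 0)"
      by (intro sum.cong) (auto simp: indicator_def)
    also have "\<dots> = (if j < 2 ^ n then w j * indicator (I j) s else 0)" by simp
    also have "\<dots> \<le> indicator {0..1} s *\<^sub>R u s"
    proof (cases "j < 2 ^ n \<and> s \<in> I j")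
      case True
      have "real (Suc j) \<le> 2 ^ n" using True by (metis Suc_leI of_nat_le_iff of_nat_numeral of_nat_power)
      then have "real (Suc j) / 2 ^ n \<le> 1" by simp
      moreover have "0 \<le> real j / 2 ^ n" by simp
      ultimately have "s \<in> {0..1}" using True unfolding I_def greaterThanLessThan_iff atLeastAtMost_iff by linarith
      then show ?thesis using True le[of j s] by (auto simp: I_def)
    qed (use u0[of s] in \<open>auto simp: indicator_def\<close>)
    finally show ?thesis .
  qed
  have "(\<Sum>k<2 ^ n. w k / 2 ^ n) = (\<integral>s. (\<Sum>k<2 ^ n. w k * indicator (I k) s) \<partial>lborel)"
    using has_bochner_integral_integral_eq[OF hS] by simp
  also have "\<dots> \<le> set_lebesgue_integral lborel {0..1} u"
    unfolding set_lebesgue_integral_def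
    using hS int pt by (intro integral_mono) (auto simp: has_bochner_integral_iff set_integrable_def)
  finally show ?thesis .
qed

lemma dyadic_floor_limits:
  assumes "0 < t" "t < (1::real)"
  shows "(\<lambda>n. real (nat \<lfloor>t * 2 ^ n\<rfloor>) / 2 ^ n) \<longlonglongrightarrow> t" "(\<lambda>n. real (Suc (nat \<lfloor>t * 2 ^ n\<rfloor>)) / 2 ^ n) \<longlonglongrightarrow> t"
    "\<forall>\<^sub>F n in sequentially. nat \<lfloor>t * 2 ^ n\<rfloor> \<noteq> 0" "\<forall>\<^sub>F n in sequentially. Suc (nat \<lfloor>t * 2 ^ n\<rfloor>) < 2 ^ n"
proof -
  define j where "j n = nat \<lfloor>t * 2 ^ n\<rfloor>" for n :: nat
  have j: "real (j n) \<le> t * 2 ^ n" "t * 2 ^ n < real (j n) + 1" for n using assms by (auto simp: j_def)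
  have d: "(\<lambda>n. 1 / 2 ^ n) \<longlonglongrightarrow> (0::real)" by real_asymp
  have 1: "(\<lambda>n. real (j n) / 2 ^ n) \<longlonglongrightarrow> t"
  proof (rule tendsto_sandwich[of "\<lambda>n. t - 1 / 2 ^ n" _ _ "\<lambda>_. t"])
    show "(\<lambda>n. t - 1 / 2 ^ n) \<longlonglongrightarrow> t" using tendsto_diff[OF tendsto_const d, of t] by simp
    show "\<forall>\<^sub>F n in sequentially. t - 1 / 2 ^ n \<le> real (j n) / 2 ^ n"
    proof (intro always_eventually allI)
      fix n
      have "t * 2 ^ n - 1 \<le> real (j n)" using j(2)[of n] by simp
      then show "t - 1 / 2 ^ n \<le> real (j n) / 2 ^ n"
        using divide_right_mono[of "t * 2 ^ n - 1" "real (j n)" "2 ^ n"] by (simp add: diff_divide_distrib)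
    qed
    show "\<forall>\<^sub>F n in sequentially. real (j n) / 2 ^ n \<le> t"
      using j(1) by (intro always_eventually) (auto simp: field_simps)
  qed simp
  have 2: "(\<lambda>n. real (Suc (j n)) / 2 ^ n) \<longlonglongrightarrow> t"
    using tendsto_add[OF 1 d] by (simp add: add_divide_distrib add.commute)
  show "(\<lambda>n. real (nat \<lfloor>t * 2 ^ n\<rfloor>) / 2 ^ n) \<longlonglongrightarrow> t" "(\<lambda>n. real (Suc (nat \<lfloor>t * 2 ^ n\<rfloor>)) / 2 ^ n) \<longlonglongrightarrow> t"
    using 1 2 by (simp_all only: j_def)
  show "\<forall>\<^sub>F n in sequentially. nat \<lfloor>t * 2 ^ n\<rfloor> \<noteq> 0"
    using order_tendstoD(1)[OF 1 assms(1)] unfolding j_def by eventually_elim auto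
  show "\<forall>\<^sub>F n in sequentially. Suc (nat \<lfloor>t * 2 ^ n\<rfloor>) < 2 ^ n"
    using order_tendstoD(2)[OF 2 assms(2)] unfolding j_def[symmetric]
  proof eventually_elim
    case (elim n)
    then have "real (Suc (j n)) < 2 ^ n" by (simp add: divide_less_eq)
    then show ?case by (metis of_nat_less_iff of_nat_numeral of_nat_power)
  qed
qed

text \<open>The part \<open>max 0 \<psi>\<close> is increasing and is approximated from below by its
  values at left end points, \<open>max 0 (- \<psi>)\<close> by its values at right end points.
  \<open>F\<close> depends on \<open>\<psi>\<close> only, so it is chosen before the probability
  space and the motion.\<close>

lemma analytic_with_boundary_values:
  fixes \<psi> :: "real \<Rightarrow> real"
  assumes mono: "mono_on {0<..<1} \<psi>" and int: "set_integrable lborel {0..1} (\<lambda>s. \<bar>\<psi> s\<bar>)"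
  shows "\<exists>F. F holomorphic_on upper_half_plane \<and> (\<forall>(M :: 'a measure) W. planar_brownian_motion M W \<i> \<longrightarrow>
     (AE \<omega> in M. \<exists>T x l. exits_at (\<lambda>t. W t \<omega>) T x \<and> ((\<lambda>s. F (W s \<omega>)) \<longlongrightarrow> l) (at_left T) \<and> Re l = \<psi> (cauchy_cdf x)))"
proof -
  define C where "C = set_lebesgue_integral lborel {0..1} (\<lambda>s. \<bar>\<psi> s\<bar>)"
  define N where "N = {t\<in>{0<..<1}. \<not> isCont \<psi> t}"
  have N: "countable N" unfolding N_def using mono by (intro mono_on_ctble_discont_open) auto
  have psi_mono: "\<psi> s \<le> \<psi> t" if "0 < s" "s \<le> t" "t < 1" for s t
    using mono_onD[OF mono, of s t] that by auto
  \<comment> \<open>The first interval of \<open>v\<close> and the last one of \<open>v'\<close> get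
    the value 0, since the end points 0 and 1 are outside the interval on which
    \<open>\<psi>\<close> is monotone. For a given \<open>t\<close> in \<open>(0, 1)\<close> this
    affects only finitely many \<open>n\<close>.\<close>
  define v where "v n k = (if k = 0 then 0 else max 0 (\<psi> (real k / 2 ^ n)))" for n k :: nat
  define v' where "v' n k = (if 2 ^ n \<le> Suc k then 0 else max 0 (- \<psi> (real (Suc k) / 2 ^ n)))" for n k :: nat
  have lt1: "real k / 2 ^ n < 1" if "k < 2 ^ n" for k n :: nat
    using that by (metis divide_less_eq_1_pos of_nat_less_iff of_nat_numeral of_nat_power zero_less_numeral zero_less_power)
  have pos: "0 < real k / 2 ^ n" if "0 < k" for k n :: nat using that by simp
  have pt: "real (2 * k) / 2 ^ Suc n = real k / 2 ^ n" for k n :: nat by simp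
  have pt_le: "real k / 2 ^ n \<le> real (Suc (2 * k)) / 2 ^ Suc n" "real (Suc (2 * k)) / 2 ^ Suc n \<le> real (Suc k) / 2 ^ n" for k n :: nat
    by (simp_all add: field_simps)
  have "\<exists>F. F holomorphic_on upper_half_plane \<and> (\<forall>(M :: 'a measure) W. planar_brownian_motion M W \<i> \<longrightarrow>
     (AE \<omega> in M. \<exists>T x l. exits_at (\<lambda>t. W t \<omega>) T x \<and> ((\<lambda>s. F (W s \<omega>)) \<longlongrightarrow> l) (at_left T) \<and> Re l = max 0 (\<psi> (cauchy_cdf x))))"
  proof (rule step_function_boundary[where v = v and C = C, OF _ _ _ _ N])
    show "0 \<le> v n k" for n k by (simp add: v_def)
    show "v n k \<le> v (Suc n) (2 * k)" for n k by (simp add: v_def)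
    show "v n k \<le> v (Suc n) (2 * k + 1)" if k: "k < 2 ^ n" for n k
    proof (cases "k = 0")
      case False
      have "Suc (2 * k) < 2 ^ Suc n" using k by simp
      then have "\<psi> (real k / 2 ^ n) \<le> \<psi> (real (Suc (2 * k)) / 2 ^ Suc n)"
        using False by (intro psi_mono pos pt_le lt1) auto
      then show ?thesis using False by (simp add: v_def)
    qed (simp add: v_def)
    show "(\<Sum>k<2 ^ n. v n k / 2 ^ n) \<le> C" for n
      unfolding C_def
    proof (rule dyadic_sum_le_integral[OF int])
      fix k :: nat and s assume k: "k < 2 ^ n" "real k / 2 ^ n < s" "s < real (Suc k) / 2 ^ n"
      show "v n k \<le> \<bar>\<psi> s\<bar>"
      proof (cases "k = 0")
        case False
        have "real (Suc k) / 2 ^ n \<le> 1" using k(1)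
          by (metis Suc_leI divide_le_eq_1_pos of_nat_le_iff of_nat_numeral of_nat_power zero_less_numeral zero_less_power)
        then have "s < 1" using k(3) by linarith
        then have "\<psi> (real k / 2 ^ n) \<le> \<psi> s" using k False by (intro psi_mono pos) auto
        then show ?thesis by (auto simp: v_def)
      qed (simp add: v_def)
    qed simp
    fix t :: real assume t: "0 < t" "t < 1" "t \<notin> N"
    then have "isCont \<psi> t" by (simp add: N_def)
    then have "(\<lambda>n. max 0 (\<psi> (real (nat \<lfloor>t * 2 ^ n\<rfloor>) / 2 ^ n))) \<longlonglongrightarrow> max 0 (\<psi> t)"
      by (intro tendsto_intros isCont_tendsto_compose[OF _ dyadic_floor_limits(1)[OF t(1,2)]])
    then show "(\<lambda>n. v n (nat \<lfloor>t * 2 ^ n\<rfloor>)) \<longlonglongrightarrow> max 0 (\<psi> t)"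
      by (rule Lim_transform_eventually) (use dyadic_floor_limits(3)[OF t(1,2)] in eventually_elim, simp add: v_def)
  qed
  then obtain F where F: "F holomorphic_on upper_half_plane"
    "\<And>(M :: 'a measure) W. planar_brownian_motion M W \<i> \<Longrightarrow>
     (AE \<omega> in M. \<exists>T x l. exits_at (\<lambda>t. W t \<omega>) T x \<and> ((\<lambda>s. F (W s \<omega>)) \<longlongrightarrow> l) (at_left T) \<and> Re l = max 0 (\<psi> (cauchy_cdf x)))"
    by blast
  have "\<exists>F. F holomorphic_on upper_half_plane \<and> (\<forall>(M :: 'a measure) W. planar_brownian_motion M W \<i> \<longrightarrow>
     (AE \<omega> in M. \<exists>T x l. exits_at (\<lambda>t. W t \<omega>) T x \<and> ((\<lambda>s. F (W s \<omega>)) \<longlongrightarrow> l) (at_left T) \<and> Re l = max 0 (- \<psi> (cauchy_cdf x))))"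
  proof (rule step_function_boundary[where v = v' and C = C, OF _ _ _ _ N])
    show "0 \<le> v' n k" for n k by (simp add: v'_def)
    show "v' n k \<le> v' (Suc n) (2 * k)" for n k
    proof (cases "2 ^ n \<le> Suc k")
      case False
      then have k: "Suc k < 2 ^ n" by simp
      then have k': "Suc (2 * k) < 2 ^ Suc n" by simp
      have "\<psi> (real (Suc (2 * k)) / 2 ^ Suc n) \<le> \<psi> (real (Suc k) / 2 ^ n)"
        using k by (intro psi_mono pos pt_le lt1) auto
      then show ?thesis using k k' by (simp add: v'_def)
    qed (simp add: v'_def)
    show "v' n k \<le> v' (Suc n) (2 * k + 1)" for n k
    proof -
      have "real (Suc (2 * k + 1)) / 2 ^ Suc n = real (Suc k) / 2 ^ n" by (simp add: field_simps)
      moreover have "2 * m \<le> Suc (2 * k + 1) \<longleftrightarrow> m \<le> Suc k" for m :: nat by arith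
      then have "2 ^ Suc n \<le> Suc (2 * k + 1) \<longleftrightarrow> 2 ^ n \<le> Suc k" by (simp only: power_Suc)
      ultimately show ?thesis unfolding v'_def by (simp only: order_refl)
    qed
    show "(\<Sum>k<2 ^ n. v' n k / 2 ^ n) \<le> C" for n
      unfolding C_def
    proof (rule dyadic_sum_le_integral[OF int])
      fix k :: nat and s assume k: "k < 2 ^ n" "real k / 2 ^ n < s" "s < real (Suc k) / 2 ^ n"
      show "v' n k \<le> \<bar>\<psi> s\<bar>"
      proof (cases "2 ^ n \<le> Suc k")
        case False
        have "0 \<le> real k / 2 ^ n" by simp
        then have "0 < s" using k(2) by (rule le_less_trans)
        then have "\<psi> s \<le> \<psi> (real (Suc k) / 2 ^ n)" using k False by (intro psi_mono lt1) auto
        then show ?thesis by (auto simp: v'_def)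
      qed (simp add: v'_def)
    qed simp
    fix t :: real assume t: "0 < t" "t < 1" "t \<notin> N"
    then have "isCont \<psi> t" by (simp add: N_def)
    then have "(\<lambda>n. max 0 (- \<psi> (real (Suc (nat \<lfloor>t * 2 ^ n\<rfloor>)) / 2 ^ n))) \<longlonglongrightarrow> max 0 (- \<psi> t)"
      by (intro tendsto_intros isCont_tendsto_compose[OF _ dyadic_floor_limits(2)[OF t(1,2)]])
    then show "(\<lambda>n. v' n (nat \<lfloor>t * 2 ^ n\<rfloor>)) \<longlonglongrightarrow> max 0 (- \<psi> t)"
      by (rule Lim_transform_eventually) (use dyadic_floor_limits(4)[OF t(1,2)] in eventually_elim, simp add: v'_def)
  qed
  then obtain F' where F': "F' holomorphic_on upper_half_plane"
    "\<And>(M :: 'a measure) W. planar_brownian_motion M W \<i> \<Longrightarrow>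
     (AE \<omega> in M. \<exists>T x l. exits_at (\<lambda>t. W t \<omega>) T x \<and> ((\<lambda>s. F' (W s \<omega>)) \<longlongrightarrow> l) (at_left T) \<and> Re l = max 0 (- \<psi> (cauchy_cdf x)))"
    by blast
  have "AE \<omega> in M. \<exists>T x l. exits_at (\<lambda>t. W t \<omega>) T x \<and> ((\<lambda>s. F (W s \<omega>) - F' (W s \<omega>)) \<longlongrightarrow> l) (at_left T) \<and> Re l = \<psi> (cauchy_cdf x)"
    if W: "planar_brownian_motion M W \<i>" for M :: "'a measure" and W
    using F(2)[OF W] F'(2)[OF W]
  proof eventually_elim
    case (elim \<omega>)
    then obtain T x l where l: "exits_at (\<lambda>t. W t \<omega>) T x" "((\<lambda>s. F (W s \<omega>)) \<longlongrightarrow> l) (at_left T)" "Re l = max 0 (\<psi> (cauchy_cdf x))"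
      by blast
    obtain T' x' l' where l': "exits_at (\<lambda>t. W t \<omega>) T' x'" "((\<lambda>s. F' (W s \<omega>)) \<longlongrightarrow> l') (at_left T')" "Re l' = max 0 (- \<psi> (cauchy_cdf x'))"
      using elim by blast
    \<comment> \<open>Exit time and exit point are determined by the path, so the two almost sure
      statements speak of the same limit.\<close>
    have "T' = T" "x' = x" using l(1) l'(1) by (auto simp: exits_at_def)
    then show ?case using l l' by (intro exI[of _ T] exI[of _ x] exI[of _ "l - l'"]) (auto intro!: tendsto_intros)
  qed
  moreover have "(\<lambda>z. F z - F' z) holomorphic_on upper_half_plane" using F(1) F'(1) by (intro holomorphic_intros)
  ultimately show ?thesis by blast
qed

section \<open>The distribution of the terminal modulus\<close>

theorem theorem1:
  fixes h :: "real \<Rightarrow> real" and p :: real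
  assumes right_cont: "\<And>r. 0 \<le> r \<Longrightarrow> continuous (at_right r) h"
    and nonneg: "\<And>r. 0 \<le> r \<Longrightarrow> 0 \<le> h r"
    and increasing: "mono_on {0..} h"
    and lim_one: "(h \<longlongrightarrow> 1) at_top"
    and p: "1 < p"
    and ln_g: "ln_in_Lp p {0..1} (gen_inverse h)"
  shows "\<exists>f w0. generates_class_H f \<and> w0 \<in> upper_half_plane \<and> f w0 = 0 \<and>
    (\<forall>(M :: 'a measure) W. planar_brownian_motion M W w0 \<longrightarrow>
       (AE \<omega> in M. has_terminal_value upper_half_plane f (\<lambda>t. W t \<omega>)) \<and>
       (\<forall>r\<ge>0. h r = h_function M W f 0 r))"
proof -
  let ?g = "gen_inverse h"
  define \<psi> where "\<psi> s = ln (?g s)" for s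
  have g_nonneg: "0 \<le> ?g s" if "0 < s" "s < 1" for s
    by (rule gen_inverse_nonneg[OF right_cont increasing lim_one that])
  have g_le: "?g s \<le> r \<longleftrightarrow> s \<le> h r" if "0 < s" "s < 1" "0 \<le> r" for s r
    by (rule gen_inverse_le_iff[OF right_cont increasing lim_one that])
  have g_mono: "?g s \<le> ?g t" if "0 < s" "s \<le> t" "t < 1" for s t
  proof -
    have t: "0 < t" "t < 1" and s: "0 < s" "s < 1" using that by auto
    have "t \<le> h (?g t)" using g_le[OF t g_nonneg[OF t]] by simp
    then show ?thesis using g_le[OF s g_nonneg[OF t]] that by simp
  qed
  \<comment> \<open>By monotonicity a zero of \<open>?g\<close> at \<open>s\<close> would force
    zeros on all of \<open>(0, s)\<close>, contrary to positivity almost everywhere.\<close>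
  have g_pos: "0 < ?g s" if s: "0 < s" "s < 1" for s
  proof (rule ccontr)
    assume "\<not> 0 < ?g s"
    then have "\<not> 0 < ?g s'" if "0 < s'" "s' < s" for s'
      using g_mono[of s' s] that s by auto
    moreover have "AE s' in lborel. s' \<in> {0..1} \<longrightarrow> 0 < ?g s'" using ln_g by (simp add: ln_in_Lp_def)
    ultimately have "AE s' in lborel. s' \<notin> {0<..<s}"
      by (elim AE_mp) (use s in \<open>auto intro!: AE_I2\<close>)
    then have "{0<..<s} \<in> null_sets lborel" by (subst AE_iff_null_sets) auto
    then show False using s by (simp add: null_sets_def)
  qed
  have \<psi>_mono: "mono_on {0<..<1} \<psi>"
    by (intro mono_onI) (use g_mono g_pos in \<open>auto simp: \<psi>_def\<close>)
  \<comment> \<open>On the unit interval an \<open>L^p\<close> function is integrable, by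
    \<open>\<bar>y\<bar> \<le> 1 + \<bar>y\<bar> powr p\<close>.\<close>
  have \<psi>_int: "set_integrable lborel {0..1} (\<lambda>s. \<bar>\<psi> s\<bar>)"
  proof -
    have a: "set_integrable lborel {0..1} (\<lambda>s. 1 + \<bar>\<psi> s\<bar> powr p)"
      using ln_g by (intro set_integral_add) (auto simp: ln_in_Lp_def \<psi>_def set_integrable_def)
    have b: "set_borel_measurable lborel {0..1} (\<lambda>s. \<bar>\<psi> s\<bar>)"
    proof -
      have "(\<lambda>s. indicator {0..1} s *\<^sub>R \<psi> s) \<in> borel_measurable lborel"
        using ln_g by (simp add: ln_in_Lp_def \<psi>_def set_borel_measurable_def)
      then have "(\<lambda>s. \<bar>indicator {0..1} s *\<^sub>R \<psi> s\<bar>) \<in> borel_measurable lborel" by measurable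
      then show ?thesis by (simp add: set_borel_measurable_def abs_mult)
    qed
    have c: "\<bar>y\<bar> \<le> 1 + \<bar>y\<bar> powr p" for y :: real
    proof (cases "1 \<le> \<bar>y\<bar>")
      case True
      then have "\<bar>y\<bar> powr 1 \<le> \<bar>y\<bar> powr p" using p by (intro powr_mono) auto
      then show ?thesis using True by simp
    next
      case False
      moreover have "0 \<le> \<bar>y\<bar> powr p" by simp
      ultimately show ?thesis by linarith
    qed
    show ?thesis
      by (rule set_integrable_bound[OF a b]) (use c in \<open>auto intro!: AE_I2 simp: abs_of_nonneg add_nonneg_nonneg\<close>)
  qed
  obtain F where F: "F holomorphic_on upper_half_plane"
    "\<And>(M :: 'a measure) W. planar_brownian_motion M W \<i> \<Longrightarrow> AE \<omega> in M. \<exists>T x l. exits_at (\<lambda>t. W t \<omega>) T x \<and>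
       ((\<lambda>s. F (W s \<omega>)) \<longlongrightarrow> l) (at_left T) \<and> Re l = \<psi> (cauchy_cdf x)"
    using analytic_with_boundary_values[OF \<psi>_mono \<psi>_int] by blast
  define f where "f z = (z - \<i>) / (z + \<i>) * exp (F z)" for z
  have zi: "z + \<i> \<noteq> 0" if "0 \<le> Im z" for z using that by (auto simp: complex_eq_iff)
  have f_hol: "f holomorphic_on upper_half_plane"
    unfolding f_def[abs_def] using zi by (intro holomorphic_intros F(1)) (auto simp: upper_half_plane_def)
  have iH: "\<i> \<in> upper_half_plane" "2 * \<i> \<in> upper_half_plane" by (auto simp: upper_half_plane_def)
  have fi: "f \<i> = 0" by (simp add: f_def)
  have "2 * \<i> - \<i> \<noteq> 0" by simp
  then have f2: "f (2 * \<i>) \<noteq> 0" using zi[of "2 * \<i>"] by (simp add: f_def)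
  have gen: "generates_class_H f"
    unfolding generates_class_H_def
  proof
    show "f analytic_on upper_half_plane"
      using f_hol by (simp add: analytic_on_open open_upper_half_plane)
    show "\<not> f constant_on upper_half_plane"
      using fi f2 iH unfolding constant_on_def by metis
  qed
  have h_le1: "h r \<le> 1" if "0 \<le> r" for r
  proof (rule tendsto_lowerbound[OF lim_one])
    show "\<forall>\<^sub>F r' in at_top. h r \<le> h r'"
      using eventually_ge_at_top[of r] by eventually_elim (use that mono_onD[OF increasing, of r] in auto)
  qed simp
  have "(AE \<omega> in M. has_terminal_value upper_half_plane f (\<lambda>t. W t \<omega>)) \<and>
       (\<forall>r\<ge>0. h r = h_function M W f 0 r)"
    if W: "planar_brownian_motion M W \<i>" for M :: "'a measure" and W
  proof -
    interpret prob_space M using planar_brownian_motion_basic[OF W] by simp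
    let ?F = "\<lambda>\<omega>. at_left (exit_time upper_half_plane (\<lambda>t. W t \<omega>))"
    let ?f = "\<lambda>\<omega> s. f (W (real_of_ereal s) \<omega>)"
    have ae: "AE \<omega> in M. \<exists>T x l. exits_at (\<lambda>t. W t \<omega>) T x \<and> (?f \<omega> \<longlongrightarrow> l) (?F \<omega>) \<and>
        cmod (Lim (?F \<omega>) (?f \<omega>)) = ?g (cauchy_cdf x)"
      using F(2)[OF W]
    proof eventually_elim
      case (elim \<omega>)
      then obtain T x l where ex: "exits_at (\<lambda>t. W t \<omega>) T x" and l: "((\<lambda>s. F (W s \<omega>)) \<longlongrightarrow> l) (at_left T)"
        "Re l = \<psi> (cauchy_cdf x)" by blast
      have xi: "of_real x + \<i> \<noteq> 0" using zi[of "of_real x"] by simp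
      have "((\<lambda>z. (z - \<i>) / (z + \<i>)) \<longlongrightarrow> (of_real x - \<i>) / (of_real x + \<i>)) (at (of_real x) within upper_half_plane)"
        using xi by (intro tendsto_intros)
      from exits_at_tendsto[OF ex this]
      have "((\<lambda>s. f (W s \<omega>)) \<longlongrightarrow> (of_real x - \<i>) / (of_real x + \<i>) * exp l) (at_left T)"
        unfolding f_def by (intro tendsto_mult tendsto_exp l(1))
      moreover have eT: "exit_time upper_half_plane (\<lambda>t. W t \<omega>) = ereal T" using ex by (simp add: exits_at_def)
      ultimately have lim: "(?f \<omega> \<longlongrightarrow> (of_real x - \<i>) / (of_real x + \<i>) * exp l) (?F \<omega>)"
        by (simp add: at_left_ereal filterlim_filtermap)
      have "?F \<omega> \<noteq> bot" unfolding eT at_left_ereal by (simp add: filtermap_bot_iff)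
      then have "Lim (?F \<omega>) (?f \<omega>) = (of_real x - \<i>) / (of_real x + \<i>) * exp l" by (rule tendsto_Lim[OF _ lim])
      moreover have "cmod (of_real x - \<i>) = cmod (of_real x + \<i>)" by (simp add: cmod_def)
      ultimately have "cmod (Lim (?F \<omega>) (?f \<omega>)) = exp (Re l)" using xi by (simp add: norm_mult norm_divide)
      also have "\<dots> = ?g (cauchy_cdf x)" using g_pos cauchy_cdf_bounds by (simp add: l(2) \<psi>_def)
      finally show ?case using ex lim by blast
    qed
    have "AE \<omega> in M. has_terminal_value upper_half_plane f (\<lambda>t. W t \<omega>)"
      using ae by eventually_elim (auto simp: has_terminal_value_def)
    moreover have "h r = h_function M W f 0 r" if r: "0 \<le> r" for r
    proof -
      define Q where "Q = {\<omega>\<in>space M. cmod (Lim (?F \<omega>) (?f \<omega>)) \<le> r}"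
      have Q: "Q \<in> sets M"
        unfolding Q_def using f_hol by (intro terminal_value_measurable[OF W iH(1)] holomorphic_on_imp_continuous_on)
      \<comment> \<open>\<open>h_function\<close> evaluates the motion at its stopping time itself;
        the strict comparison in \<open>stopped_motion\<close> then fails, which leaves the limit at
        the exit.\<close>
      have hQ: "h_function M W f 0 r = prob Q"
        by (simp add: h_function_def stopped_motion_def Q_def Let_def)
      define u where "u = h r"
      have u: "0 \<le> u" "u \<le> 1" using nonneg[OF r] h_le1[OF r] by (auto simp: u_def)
      have aeQ: "AE \<omega> in M. \<exists>T x. exits_at (\<lambda>t. W t \<omega>) T x \<and> (\<omega> \<in> Q \<longleftrightarrow> cauchy_cdf x \<le> u)"
        using ae AE_space
      proof eventually_elim
        case (elim \<omega>)
        then obtain T x where x: "exits_at (\<lambda>t. W t \<omega>) T x" "cmod (Lim (?F \<omega>) (?f \<omega>)) = ?g (cauchy_cdf x)" by blast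
        have "\<omega> \<in> Q \<longleftrightarrow> ?g (cauchy_cdf x) \<le> r" using elim(2) x(2) by (simp add: Q_def)
        also have "\<dots> \<longleftrightarrow> cauchy_cdf x \<le> u" unfolding u_def by (rule g_le[OF cauchy_cdf_bounds r])
        finally show ?case using x(1) by blast
      qed
      \<comment> \<open>On \<open>Q\<close> the inequality \<open>cauchy_cdf x \<le> u\<close> is
        weak while the cover is for a strict one, hence the detour through \<open>u' > u\<close>,
        possible within \<open>[0, 1]\<close> when \<open>u < 1\<close>. The factor
        \<open>1 / c\<close> disappears as \<open>c\<close> tends to 1.\<close>
      have "prob Q \<le> u"
      proof (cases "u = 1")
        case False
        show ?thesis
        proof (rule dense_ge_bounded[of u 1])
          show "u < 1" using False u by simp
          fix u' assume u': "u < u'" "u' < 1"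
          show "prob Q \<le> u'"
          proof (rule field_le_mult_one_interval)
            fix c :: real assume c: "0 < c" "c < 1"
            obtain A where A: "A \<in> sets M" "{\<omega>\<in>space M. \<exists>T x. exits_at (\<lambda>t. W t \<omega>) T x \<and> cauchy_cdf x < u'} \<subseteq> A"
              "prob A \<le> u' / c"
              using exit_law_covers(2)[OF W _ _ c, of u'] u u' by auto
            have "AE \<omega> in M. \<omega> \<in> Q \<longrightarrow> \<omega> \<in> A"
              using aeQ AE_space by eventually_elim (use A(2) u' in fastforce)
            then have "prob Q \<le> prob A" using A(1) by (intro finite_measure_mono_AE)
            then have "prob Q \<le> u' / c" using A(3) by simp
            then show "c * prob Q \<le> u'" using c by (simp add: field_simps)
          qed
        qed
      qed simp
      moreover have "1 - prob Q \<le> 1 - u"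
      proof (rule field_le_mult_one_interval)
        fix c :: real assume c: "0 < c" "c < 1"
        obtain A where A: "A \<in> sets M" "{\<omega>\<in>space M. \<exists>T x. exits_at (\<lambda>t. W t \<omega>) T x \<and> u < cauchy_cdf x} \<subseteq> A"
          "prob A \<le> (1 - u) / c"
          using exit_law_covers(1)[OF W u c] by auto
        have "AE \<omega> in M. \<omega> \<in> space M - Q \<longrightarrow> \<omega> \<in> A"
          using aeQ by eventually_elim (use A(2) in fastforce)
        then have "prob (space M - Q) \<le> prob A" using A(1) by (intro finite_measure_mono_AE)
        then have "1 - prob Q \<le> (1 - u) / c" using A(3) prob_compl[OF Q] by simp
        then show "c * (1 - prob Q) \<le> 1 - u" using c by (simp add: field_simps)
      qed
      ultimately show ?thesis unfolding hQ u_def by simp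
    qed
    ultimately show ?thesis by blast
  qed
  then show ?thesis using gen iH(1) fi by blast
qed

end
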